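(* Let $\Sigma$ be a compact (two-dimensional) minimal surface in the unit ball $B^n$ with $\partial\Sigma\subset\partial B^n$, meeting $\partial B^n$ orthogonally. Suppose $f:B^n\to B^n$ is conformal. Then $$|f(\partial\Sigma)|\le|\partial\Sigma| .$$
   Context: $B^n$ is the closed unit ball in $\mathbb{R}^n$. "Meeting $\partial B^n$ orthogonally" means that the outward unit conormal vector of $\Sigma$ along $\partial\Sigma$ equals the position vector $x$. $\Sigma$ is smooth up to its boundary. "$f:B^n\to B^n$ is conformal" means that $f$ is a conformal transformation (Möbius self-diffeomorphism) of the closed ball. $|\cdot|$ applied to a curve denotes its length. *)

theory Defs
  imports "HOL-Analysis.Analysis"
begin

subsection \<open>Smooth maps\<close>

text \<open>Meant for open \<open>U\<close>: continuously differentiable \<open>k\<close> times on \<open>U\<close>.\<close>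

primrec Ck_on :: "nat \<Rightarrow> 'a::euclidean_space set \<Rightarrow> ('a \<Rightarrow> 'b::euclidean_space) \<Rightarrow> bool" where
  "Ck_on 0 U f \<longleftrightarrow> continuous_on U f"
| "Ck_on (Suc k) U f \<longleftrightarrow>
     f differentiable_on U \<and> (\<forall>v. Ck_on k U (\<lambda>x. frechet_derivative f (at x) v))"

definition smooth_map_on :: "'a::euclidean_space set \<Rightarrow> ('a \<Rightarrow> 'b::euclidean_space) \<Rightarrow> bool" where
  "smooth_map_on U f \<longleftrightarrow> (\<forall>k. Ck_on k U f)"

definition pderiv_at :: "2 \<Rightarrow> (real^2 \<Rightarrow> 'a::euclidean_space) \<Rightarrow> real^2 \<Rightarrow> 'a" where
  "pderiv_at i F z = frechet_derivative F (at z) (axis i 1)"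


subsection \<open>Immersed surfaces with boundary\<close>

definition half_plane :: "(real^2) set" where
  "half_plane = {z. z $ 2 \<ge> 0}"

text \<open>
  A surface is a set \<open>M\<close> in a Hausdorff space together with a map \<open>\<phi>\<close> into Euclidean space, the
  immersion; an embedded surface \<open>\<Sigma>\<close> is the case \<open>M = \<Sigma>\<close>, \<open>\<phi> = id\<close>.
  A local parametrization of \<open>(M, \<phi>)\<close> is a homeomorphism \<open>h\<close> from \<open>U \<inter> half_plane\<close>, \<open>U\<close> open,
  onto an open piece of \<open>M\<close>, such that \<open>\<phi> \<circ> h\<close> extends to a smooth immersion \<open>F\<close> of \<open>U\<close>. The
  derivatives of \<open>F\<close> at points of \<open>U \<inter> half_plane\<close> do not depend on the chosen extension.
  Two local parametrizations differ by a smooth change of coordinates, because \<open>\<phi>\<close> is locally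
  injective; so \<open>\<phi>\<close> determines the smooth structure of \<open>M\<close> and no atlas has to be given.
\<close>

definition local_param ::
  "'p::t2_space set \<Rightarrow> ('p \<Rightarrow> 'a::euclidean_space) \<Rightarrow>
     (real^2) set \<Rightarrow> (real^2 \<Rightarrow> 'p) \<Rightarrow> (real^2 \<Rightarrow> 'a) \<Rightarrow> bool" where
  "local_param M \<phi> U h F \<longleftrightarrow>
     open U \<and> smooth_map_on U F \<and>
     (\<forall>z\<in>U. inj (frechet_derivative F (at z))) \<and>
     (\<forall>z\<in>U \<inter> half_plane. \<phi> (h z) = F z) \<and>
     openin (top_of_set M) (h ` (U \<inter> half_plane)) \<and>
     (\<exists>k. homeomorphism (U \<inter> half_plane) (h ` (U \<inter> half_plane)) h k)"

definition compact_immersed_surface ::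
  "'p::t2_space set \<Rightarrow> ('p \<Rightarrow> 'a::euclidean_space) \<Rightarrow> bool" where
  "compact_immersed_surface M \<phi> \<longleftrightarrow>
     compact M \<and>
     (\<forall>p\<in>M. \<exists>U h F. local_param M \<phi> U h F \<and> p \<in> h ` (U \<inter> half_plane))"

definition surface_boundary ::
  "'p::t2_space set \<Rightarrow> ('p \<Rightarrow> 'a::euclidean_space) \<Rightarrow> 'p set" where
  "surface_boundary M \<phi> = {h z | U h F z. local_param M \<phi> U h F \<and> z \<in> U \<and> z $ 2 = 0}"


subsection \<open>Minimal surfaces\<close>

definition tangent_plane :: "(real^2 \<Rightarrow> 'a::euclidean_space) \<Rightarrow> real^2 \<Rightarrow> 'a set" where
  "tangent_plane F z = range (frechet_derivative F (at z))"

definition first_fundamental_form :: "(real^2 \<Rightarrow> 'a::euclidean_space) \<Rightarrow> real^2 \<Rightarrow> real^2^2" where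
  "first_fundamental_form F z = (\<chi> i j. pderiv_at i F z \<bullet> pderiv_at j F z)"

text \<open>The closest point of a linear subspace is the orthogonal projection to it.\<close>

definition second_fundamental_form ::
  "(real^2 \<Rightarrow> 'a::euclidean_space) \<Rightarrow> real^2 \<Rightarrow> 2 \<Rightarrow> 2 \<Rightarrow> 'a" where
  "second_fundamental_form F z i j =
     (let w = pderiv_at i (pderiv_at j F) z in w - closest_point (tangent_plane F z) w)"

definition mean_curvature_vector :: "(real^2 \<Rightarrow> 'a::euclidean_space) \<Rightarrow> real^2 \<Rightarrow> 'a" where
  "mean_curvature_vector F z =
     (\<Sum>i\<in>UNIV. \<Sum>j\<in>UNIV.
        matrix_inv (first_fundamental_form F z) $ i $ j *\<^sub>R second_fundamental_form F z i j)"

definition minimal_surface ::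
  "'p::t2_space set \<Rightarrow> ('p \<Rightarrow> 'a::euclidean_space) \<Rightarrow> bool" where
  "minimal_surface M \<phi> \<longleftrightarrow>
     (\<forall>U h F. local_param M \<phi> U h F \<longrightarrow>
        (\<forall>z\<in>U \<inter> half_plane. mean_curvature_vector F z = 0))"


subsection \<open>Orthogonality to the unit sphere\<close>

text \<open>At a boundary point \<open>F z\<close>, \<open>z $ 2 = 0\<close>, the first coordinate direction is tangent to the
  boundary, and a tangent vector points outward iff its second coordinate is negative.\<close>

definition outward_unit_conormal ::
  "(real^2 \<Rightarrow> 'a::euclidean_space) \<Rightarrow> real^2 \<Rightarrow> 'a \<Rightarrow> bool" where
  "outward_unit_conormal F z \<eta> \<longleftrightarrow>
     norm \<eta> = 1 \<and> \<eta> \<bullet> pderiv_at 1 F z = 0 \<and>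
     (\<exists>w. w $ 2 < 0 \<and> \<eta> = frechet_derivative F (at z) w)"

definition meets_sphere_orthogonally ::
  "'p::t2_space set \<Rightarrow> ('p \<Rightarrow> 'a::euclidean_space) \<Rightarrow> bool" where
  "meets_sphere_orthogonally M \<phi> \<longleftrightarrow>
     (\<forall>U h F. local_param M \<phi> U h F \<longrightarrow>
        (\<forall>z\<in>U. z $ 2 = 0 \<longrightarrow> outward_unit_conormal F z (F z)))"


subsection \<open>Length\<close>

definition path_length :: "(real \<Rightarrow> 'a::metric_space) \<Rightarrow> ennreal" where
  "path_length c =
     (SUP ts \<in> {ts. sorted ts \<and> set ts \<subseteq> {0..1}}.
        \<Sum>i<length ts - 1. ennreal (dist (c (ts ! i)) (c (ts ! Suc i))))"

text \<open>
  The length of the image of a one-dimensional manifold \<open>C\<close> (possibly with several components,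
  possibly closed curves) under \<open>\<psi>\<close>, counted with multiplicity when \<open>\<psi>\<close> is not injective:
  the supremum of the total length of finitely many pairwise disjoint arcs of \<open>C\<close>. For a closed
  curve the supremum is approached by arcs that leave out a short piece.
\<close>

definition curve_length :: "('p::t2_space \<Rightarrow> 'a::metric_space) \<Rightarrow> 'p set \<Rightarrow> ennreal" where
  "curve_length \<psi> C =
     (SUP G \<in> {G. finite G \<and> (\<forall>g\<in>G. arc g \<and> path_image g \<subseteq> C) \<and>
                  pairwise (\<lambda>g g'. disjnt (path_image g) (path_image g')) G}.
        \<Sum>g\<in>G. path_length (\<psi> \<circ> g))"


subsection \<open>Conformal transformations of the ball\<close>

text \<open>In the one-point compactification \<open>'a option\<close> of \<open>'a\<close>, \<open>None\<close> is the point at infinity.\<close>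

definition sphere_inversion :: "'a::euclidean_space \<Rightarrow> real \<Rightarrow> 'a option \<Rightarrow> 'a option" where
  "sphere_inversion c r p =
     (case p of
        None \<Rightarrow> Some c
      | Some x \<Rightarrow> if x = c then None else Some (c + (r\<^sup>2 / (norm (x - c))\<^sup>2) *\<^sub>R (x - c)))"

definition hyperplane_reflection :: "'a::euclidean_space \<Rightarrow> real \<Rightarrow> 'a option \<Rightarrow> 'a option" where
  "hyperplane_reflection a b = map_option (\<lambda>x. x - (2 * (a \<bullet> x - b) / (a \<bullet> a)) *\<^sub>R a)"

inductive_set moebius_maps :: "('a::euclidean_space option \<Rightarrow> 'a option) set" where
  id: "id \<in> moebius_maps"
| inversion: "T \<in> moebius_maps \<Longrightarrow> r > 0 \<Longrightarrow> sphere_inversion c r \<circ> T \<in> moebius_maps"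
| reflection: "T \<in> moebius_maps \<Longrightarrow> a \<noteq> 0 \<Longrightarrow> hyperplane_reflection a b \<circ> T \<in> moebius_maps"

definition conformal_ball_map :: "('a::euclidean_space \<Rightarrow> 'a) \<Rightarrow> bool" where
  "conformal_ball_map f \<longleftrightarrow>
     (\<exists>T\<in>moebius_maps. \<forall>x\<in>cball 0 1. T (Some x) = Some (f x)) \<and>
     f ` cball 0 1 = cball 0 1"

end

theory Submission
  imports Defs
begin

text \<open>
  Unless it is a similarity, \<open>f\<close> has a pole \<open>c\<close> outside the closed ball, and its conformal factor on the
  unit sphere is at most \<open>u(x) = (\<bar>c\<bar>\<^sup>2 - 1) / \<bar>x - c\<bar>\<^sup>2\<close>; so it suffices that the integral of
  \<open>u\<close> over the boundary is at most its length. Let \<open>V(x) = (x - c) / \<bar>x - c\<bar>\<^sup>2\<close>, the gradient of \<open>ln \<bar>x - c\<bar>\<close>.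
  On the sphere, \<open>1 - u = 2 V \<bullet> x\<close>, and for every plane \<open>P\<close> through \<open>x\<close> the divergence of \<open>V\<close> along \<open>P\<close> is
  \<open>2 \<bar>(x - c)\<^sup>N\<bar>\<^sup>2 / \<bar>x - c\<bar>\<^sup>4 \<ge> 0\<close>, where \<open>N\<close> denotes the component normal to \<open>P\<close>. By minimality
  the integral of this divergence over the surface is the flux of \<open>V\<close> through its boundary, whose conormal is
  \<open>x\<close>, so the integral of \<open>1 - u\<close> over the boundary is nonnegative.
\<close>


subsection \<open>Moebius transformations of the ball\<close>

text \<open>\<open>unit_inv c\<close> is the field V and, up to a similarity, also the map
  \<open>f\<close>. The bound on the conformal factor comes from the diameter of the ball: the
  images of the points c / |c| and - c / |c| are at most 2 apart, which caps the scale k at |c|^2 -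
  1.

  The flux argument runs in half-plane charts. Cutting V into pieces \<psi> V by a partition of
  unity creates terms in which V meets the gradient of \<psi>. They have no sign, but their total is
  zero because the gradients add up to that of the constant 1; the work is to compare them across
  charts. Transition maps are shown to be differentiable off the boundary line, and separately along
  it, which serves the area integrals and the arc length integrals respectively.

  Lengths are suprema over chords of continuous arcs, so both sides are compared with an arc length
  integral in charts. For the image every chord needs an upper bound. For the boundary itself a
  lower bound is obtained by filling it, up to small measure, with finitely many disjoint coordinate
  segments.\<close>

definition unit_inv :: "'a::euclidean_space \<Rightarrow> 'a \<Rightarrow> 'a" where
  "unit_inv c x = (1 / (norm (x - c))\<^sup>2) *\<^sub>R (x - c)"

text \<open>Squaring turns both sides into rational expressions in inner products of
  \<open>x - c\<close> and \<open>y - c\<close>. This is the two-point form of the conformal factor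
  1 / |x - c|^2.\<close>

lemma dist_unit_inv:
  assumes "x \<noteq> c" "y \<noteq> c"
  shows "dist (unit_inv c x) (unit_inv c y) = dist x y / (norm (x - c) * norm (y - c))"
proof -
  define u v where "u = x - c" and "v = y - c"
  have nz: "norm u \<noteq> 0" "norm v \<noteq> 0" using assms by (auto simp: u_def v_def)
  have u: "u \<bullet> u = (norm u)\<^sup>2" and v: "v \<bullet> v = (norm v)\<^sup>2" by (simp_all add: power2_norm_eq_inner)
  have "(norm ((1 / (norm u)\<^sup>2) *\<^sub>R u - (1 / (norm v)\<^sup>2) *\<^sub>R v))\<^sup>2 = (norm (u - v) / (norm u * norm v))\<^sup>2"
    unfolding power_divide power_mult_distrib
    unfolding power2_norm_eq_inner[of "u - v"] power2_norm_eq_inner[of "_ *\<^sub>R u - _"]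
    using nz by (simp add: inner_diff u v inner_commute divide_simps power2_eq_square)
  then have "norm ((1 / (norm u)\<^sup>2) *\<^sub>R u - (1 / (norm v)\<^sup>2) *\<^sub>R v) = norm (u - v) / (norm u * norm v)"
    by (rule power2_eq_imp_eq) auto
  then show ?thesis by (simp add: unit_inv_def dist_norm u_def v_def)
qed

text \<open>The value \<open>1\<close> at infinity is chosen so that every Moebius transformation multiplies this function of
  \<open>p\<close> and \<open>q\<close> by a product \<open>m(p) m(q)\<close>, also at its pole and at infinity.\<close>

definition ext_dist :: "'a::euclidean_space option \<Rightarrow> 'a option \<Rightarrow> real" where
  "ext_dist p q = (case p of None \<Rightarrow> (case q of None \<Rightarrow> 0 | Some y \<Rightarrow> 1)
                   | Some x \<Rightarrow> (case q of None \<Rightarrow> 1 | Some y \<Rightarrow> dist x y))"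

lemma ext_dist_simps [simp]:
  "ext_dist None None = 0" "ext_dist (Some x) None = 1" "ext_dist None (Some x) = 1"
  "ext_dist (Some x) (Some y) = dist x y"
  by (simp_all add: ext_dist_def)

text \<open>\<open>m\<close> is the square root of the conformal factor r^2 / |x - c|^2. Its values
  at \<open>c\<close> and at infinity are the ones that the identity forces when the other argument
  is another finite point.\<close>

lemma ext_dist_sphere_inversion:
  fixes c :: "'a::euclidean_space"
  assumes "r > 0"
  defines "m \<equiv> \<lambda>p. case p of None \<Rightarrow> r | Some x \<Rightarrow> if x = c then 1 / r else r / norm (x - c)"
  shows "m p > 0"
    and "ext_dist (sphere_inversion c r p) (sphere_inversion c r q) = m p * m q * ext_dist p q"
proof -
  show "m p > 0" using assms by (auto simp: m_def split: option.splits)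
  have inv: "c + (r\<^sup>2 / (norm (x - c))\<^sup>2) *\<^sub>R (x - c) = c + r\<^sup>2 *\<^sub>R unit_inv c x" for x
    by (simp add: unit_inv_def)
  have 1: "dist (c + r\<^sup>2 *\<^sub>R unit_inv c x) (c + r\<^sup>2 *\<^sub>R unit_inv c y) =
      (r / norm (x - c)) * (r / norm (y - c)) * dist x y" if "x \<noteq> c" "y \<noteq> c" for x y
  proof -
    have "dist (c + r\<^sup>2 *\<^sub>R unit_inv c x) (c + r\<^sup>2 *\<^sub>R unit_inv c y)
      = r\<^sup>2 * dist (unit_inv c x) (unit_inv c y)"
      by (simp add: dist_norm flip: scaleR_diff_right)
    then show ?thesis using that by (simp add: dist_unit_inv power2_eq_square)
  qed
  have 2: "norm (r\<^sup>2 *\<^sub>R unit_inv c x) = (r / norm (x - c)) * r" if "x \<noteq> c" for x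
    using that by (simp add: unit_inv_def power2_eq_square divide_simps)
  show "ext_dist (sphere_inversion c r p) (sphere_inversion c r q) = m p * m q * ext_dist p q"
    using assms(1) 
    by (cases p; cases q)
       (auto simp: sphere_inversion_def m_def inv 1 simp del: dist_add_cancel; use 2 in \<open>simp add: dist_norm norm_minus_commute\<close>)+
qed

lemma sphere_inversion_involution:
  assumes "r > 0"
  shows "sphere_inversion c r (sphere_inversion c r p) = p"
proof (cases p)
  case (Some x)
  then show ?thesis using assms
    by (auto simp: sphere_inversion_def power_divide power2_eq_square)
qed (simp add: sphere_inversion_def)

lemma dist_reflection:
  fixes a :: "'a::euclidean_space"
  assumes "a \<noteq> 0"
  shows "dist (x - (2 * (a \<bullet> x - b) / (a \<bullet> a)) *\<^sub>R a) (y - (2 * (a \<bullet> y - b) / (a \<bullet> a)) *\<^sub>R a) = dist x y"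
proof -
  have "x - (2 * (a \<bullet> x - b) / (a \<bullet> a)) *\<^sub>R a - (y - (2 * (a \<bullet> y - b) / (a \<bullet> a)) *\<^sub>R a)
     = (x - y) - (2 * (a \<bullet> (x - y)) / (a \<bullet> a)) *\<^sub>R a"
    by (simp add: algebra_simps inner_diff_right diff_divide_distrib)
  moreover have "(norm (z - (2 * (a \<bullet> z) / (a \<bullet> a)) *\<^sub>R a))\<^sup>2 = (norm z)\<^sup>2" for z
    using assms unfolding power2_norm_eq_inner
    by (simp add: inner_diff inner_commute divide_simps power2_eq_square)
  ultimately show ?thesis unfolding dist_norm
    by (metis norm_ge_zero power2_eq_imp_eq)
qed

lemma hyperplane_reflection_involution:
  assumes "a \<noteq> 0"
  shows "hyperplane_reflection a b (hyperplane_reflection a b p) = p"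
  using assms
  by (cases p) (auto simp: hyperplane_reflection_def inner_diff_right algebra_simps
      diff_divide_distrib add_divide_distrib simp flip: scaleR_add_left)

text \<open>Factors multiply along a composition, so the form of the identity survives the
  induction. Surjectivity rides along because later the point sent to infinity has to be
  named.\<close>

lemma moebius_ext_dist:
  assumes "T \<in> moebius_maps"
  shows "surj T \<and> (\<exists>m. (\<forall>p. m p > 0) \<and> (\<forall>p q. ext_dist (T p) (T q) = m p * m q * ext_dist p q))"
  using assms
proof induction
  case id
  show ?case by (auto intro!: exI[of _ "\<lambda>_. 1"])
next
  case (inversion T r c)
  then obtain m where m: "\<And>p. m p > 0" "\<And>p q. ext_dist (T p) (T q) = m p * m q * ext_dist p q"
    by blast
  define n where "n = (\<lambda>p. case p of None \<Rightarrow> r | Some x \<Rightarrow> if x = c then 1 / r else r / norm (x - c))"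
  note n = ext_dist_sphere_inversion[OF \<open>r > 0\<close>, of c, folded n_def]
  have "surj (sphere_inversion c r \<circ> T)"
    using inversion sphere_inversion_involution[of r c] by (intro comp_surj) (auto intro!: surjI)
  moreover have "\<exists>m. (\<forall>p. m p > 0) \<and> (\<forall>p q. ext_dist ((sphere_inversion c r \<circ> T) p)
      ((sphere_inversion c r \<circ> T) q) = m p * m q * ext_dist p q)"
    using m n by (intro exI[of _ "\<lambda>p. n (T p) * m p"]) auto
  ultimately show ?case by blast
next
  case (reflection T a b)
  then obtain m where m: "\<And>p. m p > 0" "\<And>p q. ext_dist (T p) (T q) = m p * m q * ext_dist p q"
    by blast
  have "ext_dist (hyperplane_reflection a b p) (hyperplane_reflection a b q) = ext_dist p q" for p q
    using dist_reflection[OF reflection(2)]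
    by (cases p; cases q) (auto simp: hyperplane_reflection_def)
  moreover have "surj (hyperplane_reflection a b \<circ> T)"
    using reflection hyperplane_reflection_involution[of a b]
    by (intro comp_surj) (auto intro!: surjI)
  ultimately show ?case using m by auto
qed

text \<open>The point \<open>s\<close> that \<open>T\<close> sends to infinity decides the case:
  infinity itself gives a constant factor \<open>m\<close>, a finite point \<open>c\<close> gives a
  factor proportional to 1 / |x - c|. The constants are bounded because \<open>f\<close> maps the
  ball into a set of diameter 2.\<close>

lemma conformal_ball_map_cases:
  fixes f :: "'a::euclidean_space \<Rightarrow> 'a"
  assumes "conformal_ball_map f"
  obtains (similarity) l where "0 \<le> l" "l \<le> 1"
      "\<And>x y. x \<in> cball 0 1 \<Longrightarrow> y \<in> cball 0 1 \<Longrightarrow> dist (f x) (f y) = l * dist x y"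
  | (inversion) c k where "norm c > 1" "0 \<le> k" "k \<le> (norm c)\<^sup>2 - 1"
      "\<And>x y. x \<in> cball 0 1 \<Longrightarrow> y \<in> cball 0 1 \<Longrightarrow>
         dist (f x) (f y) = k * dist (unit_inv c x) (unit_inv c y)"
proof -
  obtain T where T: "T \<in> moebius_maps" "\<And>x. x \<in> cball 0 1 \<Longrightarrow> T (Some x) = Some (f x)"
    and im: "f ` cball 0 1 = cball 0 1"
    using assms by (auto simp: conformal_ball_map_def)
  obtain m where m: "\<And>p. m p > 0" "\<And>p q. ext_dist (T p) (T q) = m p * m q * ext_dist p q"
    and "surj T"
    using moebius_ext_dist[OF T(1)] by blast
  obtain s where s: "T s = None" using \<open>surj T\<close> by (metis surj_f_inv_f)
  have d: "dist (f x) (f y) = m (Some x) * m (Some y) * dist x y"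
    if "x \<in> cball 0 1" "y \<in> cball 0 1" for x y
    using m(2)[of "Some x" "Some y"] T(2) that by simp
  \<comment> \<open>\<open>T s\<close> is infinity and has \<open>ext_dist\<close> 1 to every finite
    point, so the identity against \<open>s\<close> determines \<open>m\<close> on the ball.\<close>
  have pole: "m (Some x) * m s * ext_dist (Some x) s = 1" if "x \<in> cball 0 1" for x
    using m(2)[of "Some x" s] T(2) that s by simp
  have le2: "dist (f x) (f y) \<le> 2" if "x \<in> cball 0 1" "y \<in> cball 0 1" for x y
  proof -
    have "norm (f x) \<le> 1" "norm (f y) \<le> 1"
      using that im by (auto simp: set_eq_iff image_iff simp del: mem_cball_0) (metis mem_cball_0)+
    then show ?thesis unfolding dist_norm using norm_triangle_ineq4[of "f x" "f y"] by simp
  qed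
  show thesis
  proof (cases s)
    case None
    define l where "l = 1 / (m None)\<^sup>2"
    have "m (Some x) = 1 / m None" if "x \<in> cball 0 1" for x
      using pole[OF that] m(1)[of None] None by (simp add: field_simps)
    then have l: "dist (f x) (f y) = l * dist x y" if "x \<in> cball 0 1" "y \<in> cball 0 1" for x y
      using d that by (simp add: l_def power2_eq_square)
    obtain e :: 'a where e: "norm e = 1" using vector_choose_size[of 1] by auto
    have "dist e (-e) = 2" using e by (metis diff_minus_eq_add dist_norm mult.right_neutral
          norm_scaleR abs_numeral scaleR_2)
    then have "l \<le> 1" using l[of e "-e"] le2[of e "-e"] e by simp
    moreover have "0 \<le> l" by (simp add: l_def)
    ultimately show thesis using similarity l by blast
  next
    case (Some c)
    \<comment> \<open>A pole in the closed ball could be inserted into \<open>pole\<close>, where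
      its distance 0 to itself would have to yield 1.\<close>
    have c1: "norm c > 1"
    proof (rule ccontr)
      assume "\<not> norm c > 1"
      then show False using pole[of c] Some by simp
    qed
    have nz: "norm (x - c) > 0" if "x \<in> cball 0 1" for x using that c1 by auto
    define k where "k = 1 / (m (Some c))\<^sup>2"
    have "m (Some x) = 1 / (m (Some c) * norm (x - c))" if "x \<in> cball 0 1" for x
      using pole[OF that] m(1)[of "Some c"] Some nz[OF that] by (simp add: dist_norm field_simps)
    then have k: "dist (f x) (f y) = k * dist (unit_inv c x) (unit_inv c y)"
      if "x \<in> cball 0 1" "y \<in> cball 0 1" for x y
      using d that nz by (subst dist_unit_inv) (auto simp: k_def power2_eq_square)
    \<comment> \<open>The two points of the sphere on the line through \<open>c\<close> lie at
      distances |c| - 1 and |c| + 1 from it, so their inverted distance is 2 / (|c|^2 - 1).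
      Comparing with the diameter 2 yields the bound on \<open>k\<close>.\<close>
    define e where "e = (1 / norm c) *\<^sub>R c"
    have e: "e \<in> cball 0 1" "- e \<in> cball 0 1" using c1 by (auto simp: e_def)
    have "e - c = - ((norm c - 1) / norm c) *\<^sub>R c" "- e - c = - ((norm c + 1) / norm c) *\<^sub>R c"
      using c1 by (auto simp: e_def diff_divide_distrib add_divide_distrib algebra_simps)
    then have n: "norm (e - c) = norm c - 1" "norm (-e - c) = norm c + 1"
      using c1 by (auto simp: norm_minus_commute)
    have "norm e = 1" using c1 by (auto simp: e_def)
    then have "dist e (-e) = 2" by (metis diff_minus_eq_add dist_norm mult.right_neutral
          norm_scaleR abs_numeral scaleR_2)
    moreover have "e \<noteq> c" "- e \<noteq> c" using n c1 by auto
    ultimately have "dist (unit_inv c e) (unit_inv c (-e)) = 2 / ((norm c)\<^sup>2 - 1)"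
      using n c1 by (subst dist_unit_inv) (auto simp: power2_eq_square square_diff_one_factored n mult.commute)
    moreover have "(norm c)\<^sup>2 > 1" using c1 by (simp add: one_less_power)
    ultimately have "k \<le> (norm c)\<^sup>2 - 1"
      using k[OF e] le2[OF e] by (simp add: pos_divide_le_eq)
    moreover have "0 \<le> k" by (simp add: k_def)
    ultimately show thesis using inversion c1 k by blast
  qed
qed


subsection \<open>Derivatives\<close>

text \<open>With a left inverse \<open>L\<close> of \<open>D'\<close>, the candidate derivative is
  \<open>L o D\<close>. Continuity of \<open>t\<close> keeps \<open>t y\<close> where
  \<open>G\<close> is close to its linearization, and injectivity of \<open>D'\<close> upgrades
  continuity to a Lipschitz bound at \<open>z\<close>. Charts are only homeomorphisms by definition,
  and this lemma is what makes their transition maps differentiable.\<close>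

lemma has_derivative_factor:
  fixes G :: "'b::euclidean_space \<Rightarrow> 'c::euclidean_space" and t :: "'a::euclidean_space \<Rightarrow> 'b"
  assumes G: "(G has_derivative D') (at (t z))" and inj: "inj D'"
    and F: "(F has_derivative D) (at z within S)"
    and cont: "continuous (at z within S) t"
    and eq: "\<And>x. x \<in> S \<Longrightarrow> G (t x) = F x" and z: "z \<in> S"
  obtains A where "(t has_derivative A) (at z within S)"
proof -
  have lin': "linear D'" using G has_derivative_linear by blast
  obtain L where L: "linear L" "L \<circ> D' = id"
    using linear_injective_left_inverse[OF lin' inj] by blast
  obtain B where B: "B > 0" "\<And>x. B * norm x \<le> norm (D' x)"
    using linear_inj_bounded_below_pos[OF lin' inj] by blast
  have blD: "bounded_linear D" using F has_derivative_bounded_linear by blast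
  obtain K where K: "K > 0" "\<And>x. norm (D x) \<le> norm x * K"
    using bounded_linear.pos_bounded[OF blD] by blast
  obtain N where N: "N > 0" "\<And>x. norm (L x) \<le> norm x * N"
    using bounded_linear.pos_bounded[OF linear_conv_bounded_linear[THEN iffD1, OF L(1)]] by blast
  have "((t has_derivative (L \<circ> D)) (at z within S))"
    unfolding has_derivative_within_alt
  proof (intro conjI allI impI)
    show "bounded_linear (L \<circ> D)" using L(1) blD
      by (simp add: linear_linear linear_compose bounded_linear.linear flip: linear_conv_bounded_linear)
    fix e :: real assume e: "e > 0"
    \<comment> \<open>With \<open>e' \<le> B / 2\<close> the linearization error of \<open>G\<close>
      is absorbed into B |w|, leaving B / 2 * |w| on the left and at most (K + 1) |y - z| on the
      right; \<open>C\<close> is the resulting Lipschitz constant.\<close>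
    define C where "C = 2 * (K + 1) / B"
    have C: "C > 0" using K B by (simp add: C_def)
    \<comment> \<open>The three entries serve the absorption, the replacement of
      \<open>K + e'\<close> by \<open>K + 1\<close>, and the final error bound.\<close>
    define e' where "e' = min (B / 2) (min 1 (e / (N * (C + 1))))"
    have NC: "N * (C + 1) > 0" using N C by simp
    have e': "e' > 0" "e' \<le> B / 2" "e' \<le> 1" using e B NC unfolding e'_def
      by (simp_all only: min.cobounded1 min.coboundedI2 min_less_iff_conj) auto
    have "e' \<le> e / (N * (C + 1))" by (simp add: e'_def)
    then have e'4: "e' * (N * (C + 1)) \<le> e" using NC by (simp add: pos_le_divide_eq)
    obtain d1 where d1: "d1 > 0"
      "\<And>y. norm (y - t z) < d1 \<Longrightarrow> norm (G y - G (t z) - D' (y - t z)) \<le> e' * norm (y - t z)"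
      using G e'(1) unfolding has_derivative_at_alt by metis
    obtain d2 where d2: "d2 > 0"
      "\<And>y. y \<in> S \<Longrightarrow> norm (y - z) < d2 \<Longrightarrow> norm (F y - F z - D (y - z)) \<le> e' * norm (y - z)"
      using F e'(1) unfolding has_derivative_within_alt by metis
    obtain d3 where d3: "d3 > 0" "\<And>y. y \<in> S \<Longrightarrow> norm (y - z) < d3 \<Longrightarrow> norm (t y - t z) < d1"
      using cont d1(1) unfolding continuous_within_eps_delta dist_norm by metis
    show "\<exists>d>0. \<forall>y\<in>S. norm (y - z) < d \<longrightarrow> norm (t y - t z - (L \<circ> D) (y - z)) \<le> e * norm (y - z)"
    proof (intro exI[of _ "min d2 d3"] conjI ballI impI)
      show "min d2 d3 > 0" using d2 d3 by simp
      fix y assume y: "y \<in> S" "norm (y - z) < min d2 d3"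
      define w where "w = t y - t z"
      have 1: "norm (F y - F z - D' w) \<le> e' * norm w"
        using d1(2)[of "t y"] d3(2)[of y] y eq z by (simp add: w_def)
      have 2: "norm (F y - F z - D (y - z)) \<le> e' * norm (y - z)" using d2 y by simp
      have "norm (F y - F z) \<le> norm (D (y - z)) + e' * norm (y - z)"
        using 2 norm_triangle_sub[of "F y - F z" "D (y - z)"] by linarith
      also have "\<dots> \<le> (K + 1) * norm (y - z)"
        using K(2)[of "y - z"] e'(3) mult_right_mono[OF e'(3), of "norm (y - z)"]
        by (simp add: algebra_simps)
      finally have 3: "norm (F y - F z) \<le> (K + 1) * norm (y - z)" .
      have "B * norm w \<le> norm (F y - F z) + e' * norm w"
        using B(2)[of w] 1 norm_triangle_sub[of "D' w" "F y - F z"]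
        by (simp add: norm_minus_commute)
      moreover have "e' * norm w \<le> B / 2 * norm w" by (rule mult_right_mono[OF e'(2)]) simp
      ultimately have "B / 2 * norm w \<le> (K + 1) * norm (y - z)" using 3 by linarith
      then have w: "norm w \<le> C * norm (y - z)" using B(1) by (simp add: C_def field_simps)
      have "t y - t z - (L \<circ> D) (y - z) = L (D' w - D (y - z))"
        using L by (simp add: linear_diff w_def o_def fun_eq_iff)
      also have "norm \<dots> \<le> norm (D' w - D (y - z)) * N" by (rule N)
      also have "norm (D' w - D (y - z)) \<le> norm (F y - F z - D' w) + norm (F y - F z - D (y - z))"
        using norm_triangle_ineq4[of "F y - F z - D (y - z)" "F y - F z - D' w"] by simp
      also have "\<dots> \<le> e' * (C * norm (y - z)) + e' * norm (y - z)"
        using 1 2 mult_left_mono[OF w, of e'] e'(1) by linarith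
      also have "(e' * (C * norm (y - z)) + e' * norm (y - z)) * N = e' * (N * (C + 1)) * norm (y - z)"
        by (simp add: algebra_simps)
      also have "\<dots> \<le> e * norm (y - z)" using e'4 by (simp add: mult_right_mono)
      finally show "norm (t y - t z - (L \<circ> D) (y - z)) \<le> e * norm (y - z)" using N(1) by simp
    qed
  qed
  then show thesis using that by blast
qed

text \<open>The mean value theorem is applied first in \<open>x\<close>, to the difference of
  \<open>f\<close> in \<open>y\<close>, and then in \<open>y\<close>.\<close>

lemma mixed_difference_mvt:
  fixes f :: "real \<Rightarrow> real \<Rightarrow> real"
  assumes s: "s > 0"
    and f1: "\<And>x y. 0 \<le> x \<Longrightarrow> x \<le> s \<Longrightarrow> 0 \<le> y \<Longrightarrow> y \<le> s \<Longrightarrow> ((\<lambda>x. f x y) has_real_derivative f1 x y) (at x)"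
    and f12: "\<And>x y. 0 \<le> x \<Longrightarrow> x \<le> s \<Longrightarrow> 0 \<le> y \<Longrightarrow> y \<le> s \<Longrightarrow> ((\<lambda>y. f1 x y) has_real_derivative f12 x y) (at y)"
  shows "\<exists>x y. 0 \<le> x \<and> x \<le> s \<and> 0 \<le> y \<and> y \<le> s \<and> f s s - f 0 s - f s 0 + f 0 0 = s * s * f12 x y"
proof -
  have "\<exists>x. 0 < x \<and> x < s \<and> (f s s - f s 0) - (f 0 s - f 0 0) = (s - 0) * (f1 x s - f1 x 0)"
    using s by (intro MVT2[of 0 s "\<lambda>x. f x s - f x 0"]) (auto intro!: derivative_eq_intros f1)
  then obtain x where x: "0 < x" "x < s" "(f s s - f s 0) - (f 0 s - f 0 0) = s * (f1 x s - f1 x 0)"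
    by auto
  have "\<exists>y. 0 < y \<and> y < s \<and> f1 x s - f1 x 0 = (s - 0) * f12 x y"
    using s x by (intro MVT2) (auto intro!: f12)
  then obtain y where "0 < y" "y < s" "f1 x s - f1 x 0 = s * f12 x y" by auto
  with x show ?thesis by (intro exI[of _ x] exI[of _ y]) (auto simp: algebra_simps)
qed

text \<open>The mixed difference over a small parallelogram is symmetric in \<open>u\<close> and
  \<open>v\<close>. Evaluating it in both orders equates the two second derivatives at two points
  near \<open>z\<close>, and continuity moves both to \<open>z\<close>.\<close>

lemma mixed_second_derivatives_commute:
  fixes f :: "'a::euclidean_space \<Rightarrow> real"
  assumes U: "open U" "z \<in> U"
    and f: "\<And>x. x \<in> U \<Longrightarrow> (f has_derivative (D x)) (at x)"
    and fu: "\<And>x. x \<in> U \<Longrightarrow> ((\<lambda>y. D y u) has_derivative (Du x)) (at x)"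
    and fv: "\<And>x. x \<in> U \<Longrightarrow> ((\<lambda>y. D y v) has_derivative (Dv x)) (at x)"
    and cu: "continuous_on U (\<lambda>x. Du x v)" and cv: "continuous_on U (\<lambda>x. Dv x u)"
  shows "Du z v = Dv z u"
proof (rule ccontr)
  assume ne: "Du z v \<noteq> Dv z u"
  define e where "e = \<bar>Du z v - Dv z u\<bar> / 2"
  have e: "e > 0" using ne by (simp add: e_def)
  have "isCont (\<lambda>x. Du x v) z" "isCont (\<lambda>x. Dv x u) z"
    using cu cv U continuous_on_eq_continuous_at by blast+
  then obtain d1 d2 where d1: "d1 > 0" "\<And>x. dist x z < d1 \<Longrightarrow> dist (Du x v) (Du z v) < e"
    and d2: "d2 > 0" "\<And>x. dist x z < d2 \<Longrightarrow> dist (Dv x u) (Dv z u) < e"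
    using e unfolding continuous_at_eps_delta by metis
  obtain d3 where d3: "d3 > 0" "ball z d3 \<subseteq> U" using U open_contains_ball by blast
  define d where "d = min d1 (min d2 d3)"
  have d: "d > 0" using d1 d2 d3 by (simp add: d_def)
  \<comment> \<open>This size keeps the parallelogram with sides \<open>s *\<^sub>R u\<close> and
    \<open>s *\<^sub>R v\<close> within distance \<open>d\<close> of \<open>z\<close>; the summand 1
    keeps the denominator positive.\<close>
  define s where "s = d / (2 * (norm u + norm v + 1))"
  have s: "s > 0" using d by (simp add: s_def add_nonneg_pos)
  have near: "dist (z + x *\<^sub>R u + y *\<^sub>R v) z < d" if "0 \<le> x" "x \<le> s" "0 \<le> y" "y \<le> s" for x y
  proof -
    have "dist (z + x *\<^sub>R u + y *\<^sub>R v) z \<le> x * norm u + y * norm v"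
      using norm_triangle_ineq[of "x *\<^sub>R u" "y *\<^sub>R v"] that by (simp add: dist_norm)
    also have "\<dots> \<le> s * norm u + s * norm v" using that by (intro add_mono mult_right_mono) auto
    also have "\<dots> < s * (2 * (norm u + norm v + 1))" using s
      by (simp add: algebra_simps add_strict_increasing2 add_nonneg_pos)
    also have "\<dots> = d" using add_nonneg_pos[of "norm u + norm v" 1] by (simp add: s_def)
    finally show ?thesis .
  qed
  have inU: "z + x *\<^sub>R u + y *\<^sub>R v \<in> U" if "0 \<le> x" "x \<le> s" "0 \<le> y" "y \<le> s" for x y
    using near[OF that] d3(2) by (auto simp: d_def dist_commute)
  have line: "((\<lambda>x. g (z + x *\<^sub>R u + y *\<^sub>R v)) has_real_derivative g' u) (at x)"
    if "(g has_derivative g') (at (z + x *\<^sub>R u + y *\<^sub>R v))" for g g' x y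
  proof -
    have "((\<lambda>x. z + x *\<^sub>R u + y *\<^sub>R v) has_derivative (\<lambda>h. h *\<^sub>R u)) (at x)"
      by (auto intro!: derivative_eq_intros)
    from has_derivative_compose[OF this that]
    show ?thesis unfolding has_field_derivative_def
      by (rule has_derivative_eq_rhs)
         (simp add: fun_eq_iff linear_scale[OF has_derivative_linear[OF that]])
  qed
  have line2: "((\<lambda>y. g (z + x *\<^sub>R u + y *\<^sub>R v)) has_real_derivative g' v) (at y)"
    if "(g has_derivative g') (at (z + x *\<^sub>R u + y *\<^sub>R v))" for g g' x y
  proof -
    have "((\<lambda>y. z + x *\<^sub>R u + y *\<^sub>R v) has_derivative (\<lambda>h. h *\<^sub>R v)) (at y)"
      by (auto intro!: derivative_eq_intros)
    from has_derivative_compose[OF this that]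
    show ?thesis unfolding has_field_derivative_def
      by (rule has_derivative_eq_rhs)
         (simp add: fun_eq_iff linear_scale[OF has_derivative_linear[OF that]])
  qed
  let ?p = "\<lambda>x y. z + x *\<^sub>R u + y *\<^sub>R v"
  obtain x y where xy: "0 \<le> x" "x \<le> s" "0 \<le> y" "y \<le> s"
    "f (?p s s) - f (?p 0 s) - f (?p s 0) + f (?p 0 0) = s * s * Du (?p x y) v"
    using mixed_difference_mvt[OF s, of "\<lambda>x y. f (?p x y)" "\<lambda>x y. D (?p x y) u" "\<lambda>x y. Du (?p x y) v"]
      line[OF f[OF inU]] line2[OF fu[OF inU]] by blast
  obtain y' x' where xy': "0 \<le> x'" "x' \<le> s" "0 \<le> y'" "y' \<le> s"
    "f (?p s s) - f (?p s 0) - f (?p 0 s) + f (?p 0 0) = s * s * Dv (?p x' y') u"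
    using mixed_difference_mvt[OF s, of "\<lambda>y x. f (?p x y)" "\<lambda>y x. D (?p x y) v" "\<lambda>y x. Dv (?p x y) u"]
      line2[OF f[OF inU]] line[OF fv[OF inU]] by blast
  have "s * s * Du (?p x y) v = s * s * Dv (?p x' y') u" using xy(5) xy'(5) by linarith
  then have "Du (?p x y) v = Dv (?p x' y') u" using s by simp
  moreover have "dist (Du (?p x y) v) (Du z v) < e" using d1(2) near[OF xy(1-4)] by (simp add: d_def)
  moreover have "dist (Dv (?p x' y') u) (Dv z u) < e" using d2(2) near[OF xy'(1-4)] by (simp add: d_def)
  ultimately have "dist (Du z v) (Dv z u) < \<bar>Du z v - Dv z u\<bar>"
    unfolding e_def by (metis dist_triangle_half_r)
  then show False by (simp add: dist_real_def)
qed


subsection \<open>Minimality and the first fundamental form\<close>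

lemma vec2_eq: "(v::real^2) = v $ 1 *\<^sub>R axis 1 1 + v $ 2 *\<^sub>R axis 2 1"
  by (simp add: vec_eq_iff forall_2 axis_def)

lemma has_derivative_pderiv_at:
  assumes "f differentiable (at z)"
  shows "(f has_derivative (\<lambda>v. v $ 1 *\<^sub>R pderiv_at 1 f z + v $ 2 *\<^sub>R pderiv_at 2 f z)) (at z)"
proof -
  have D: "(f has_derivative frechet_derivative f (at z)) (at z)"
    using assms frechet_derivative_works by blast
  have "frechet_derivative f (at z) v = v $ 1 *\<^sub>R pderiv_at 1 f z + v $ 2 *\<^sub>R pderiv_at 2 f z" for v
    using linear_add[OF has_derivative_linear[OF D]] linear_scale[OF has_derivative_linear[OF D]]
    unfolding pderiv_at_def by (subst vec2_eq) simp
  with D show ?thesis by (metis (no_types, lifting) ext)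
qed

lemma pderiv_at_eq:
  assumes "(f has_derivative D) (at z)"
  shows "pderiv_at i f z = D (axis i 1)"
  using assms frechet_derivative_at pderiv_at_def by metis

lemma smooth_map_onD:
  assumes U: "open U" "smooth_map_on U F"
  shows "z \<in> U \<Longrightarrow> F differentiable (at z)"
    and "z \<in> U \<Longrightarrow> pderiv_at i F differentiable (at z)"
    and "continuous_on U F"
    and "continuous_on U (pderiv_at i F)"
    and "continuous_on U (pderiv_at i (pderiv_at j F))"
proof -
  have "Ck_on (Suc (Suc (Suc 0))) U F" using U(2) by (simp only: smooth_map_on_def)
  then have 1: "F differentiable_on U"
    and 2: "\<And>v. (\<lambda>x. frechet_derivative F (at x) v) differentiable_on U"
    and 3: "\<And>v w. (\<lambda>y. frechet_derivative (\<lambda>x. frechet_derivative F (at x) v) (at y) w) differentiable_on U"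
    by auto
  have p: "pderiv_at i F = (\<lambda>x. frechet_derivative F (at x) (axis i 1))" for i F
    by (simp add: pderiv_at_def fun_eq_iff)
  show "z \<in> U \<Longrightarrow> F differentiable (at z)" using 1 U differentiable_on_eq_differentiable_at by blast
  show "z \<in> U \<Longrightarrow> pderiv_at i F differentiable (at z)"
    using 2[of "axis i 1"] U differentiable_on_eq_differentiable_at unfolding p by blast
  show "continuous_on U F" using 1 differentiable_imp_continuous_on by blast
  show "continuous_on U (pderiv_at i F)"
    using 2[of "axis i 1"] differentiable_imp_continuous_on unfolding p by blast
  show "continuous_on U (pderiv_at i (pderiv_at j F))"
    using 3[of "axis j 1" "axis i 1"] differentiable_imp_continuous_on unfolding p by blast
qed

lemma pderiv_at_commute:
  fixes F :: "real^2 \<Rightarrow> 'a::euclidean_space"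
  assumes U: "open U" "smooth_map_on U F" and z: "z \<in> U"
  shows "pderiv_at 1 (pderiv_at 2 F) z = pderiv_at 2 (pderiv_at 1 F) z"
proof (rule euclidean_eqI)
  fix b :: 'a assume "b \<in> Basis"
  note s = smooth_map_onD[OF U]
  define D where "D = (\<lambda>f x (v::real^2). v $ 1 *\<^sub>R pderiv_at 1 f x + v $ 2 *\<^sub>R pderiv_at 2 f x :: 'a)"
  have D: "(f has_derivative D f x) (at x)" if "f differentiable (at x)" for f :: "real^2 \<Rightarrow> 'a" and x
    using has_derivative_pderiv_at[OF that] by (simp add: D_def)
  have e: "D F x (axis i 1) = pderiv_at i F x" for x i
    using exhaust_2[of i] by (auto simp: D_def axis_def)
  have e2: "D (pderiv_at i F) x (axis j 1) = pderiv_at j (pderiv_at i F) x" for x i j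
    using exhaust_2[of j] by (auto simp: D_def axis_def)
  have "D (pderiv_at 2 F) z (axis 1 1) \<bullet> b = D (pderiv_at 1 F) z (axis 2 1) \<bullet> b"
  proof (rule mixed_second_derivatives_commute[OF U(1) z, where f = "\<lambda>x. F x \<bullet> b"
        and D = "\<lambda>x w. D F x w \<bullet> b" and Du = "\<lambda>x w. D (pderiv_at 2 F) x w \<bullet> b"
        and Dv = "\<lambda>x w. D (pderiv_at 1 F) x w \<bullet> b"])
    show "((\<lambda>x. F x \<bullet> b) has_derivative (\<lambda>v. D F x v \<bullet> b)) (at x)" if "x \<in> U" for x
      using D[OF s(1)[OF that]] by (rule has_derivative_inner_left)
    have d: "((\<lambda>y. D F y (axis i 1) \<bullet> b) has_derivative (\<lambda>v. D (pderiv_at i F) x v \<bullet> b)) (at x)"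
      if "x \<in> U" for x i
      unfolding e using D[OF s(2)[OF that]] by (rule has_derivative_inner_left)
    have c: "continuous_on U (\<lambda>x. D (pderiv_at i F) x (axis j 1) \<bullet> b)" for i j
      unfolding e2 using s(5) by (intro continuous_intros)
    show "((\<lambda>y. D F y (axis 2 1) \<bullet> b) has_derivative (\<lambda>v. D (pderiv_at 2 F) x v \<bullet> b)) (at x)"
      "((\<lambda>y. D F y (axis 1 1) \<bullet> b) has_derivative (\<lambda>v. D (pderiv_at 1 F) x v \<bullet> b)) (at x)"
      if "x \<in> U" for x using d that by blast+
    show "continuous_on U (\<lambda>x. D (pderiv_at 2 F) x (axis 1 1) \<bullet> b)"
      "continuous_on U (\<lambda>x. D (pderiv_at 1 F) x (axis 2 1) \<bullet> b)" using c by blast+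
  qed
  then show "pderiv_at 1 (pderiv_at 2 F) z \<bullet> b = pderiv_at 2 (pderiv_at 1 F) z \<bullet> b"
    unfolding e2 .
qed

section \<open>Area density, dual tangent vectors and minimality\<close>

definition area_density :: "(real^2 \<Rightarrow> 'a::euclidean_space) \<Rightarrow> real^2 \<Rightarrow> real" where
  "area_density F z =
     sqrt ((pderiv_at 1 F z \<bullet> pderiv_at 1 F z) * (pderiv_at 2 F z \<bullet> pderiv_at 2 F z) -
           (pderiv_at 1 F z \<bullet> pderiv_at 2 F z)\<^sup>2)"

text \<open>In classical notation, these are the vectors \<open>sqrt g * (\<Sum>j. g^{ij} F_j)\<close> for \<open>i = 1, 2\<close>, whose
  divergence is \<open>sqrt g\<close> times the Laplacian of the immersion.\<close>

definition cofield1 :: "(real^2 \<Rightarrow> 'a::euclidean_space) \<Rightarrow> real^2 \<Rightarrow> 'a" where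
  "cofield1 F z = (1 / area_density F z) *\<^sub>R
     ((pderiv_at 2 F z \<bullet> pderiv_at 2 F z) *\<^sub>R pderiv_at 1 F z - (pderiv_at 1 F z \<bullet> pderiv_at 2 F z) *\<^sub>R pderiv_at 2 F z)"

definition cofield2 :: "(real^2 \<Rightarrow> 'a::euclidean_space) \<Rightarrow> real^2 \<Rightarrow> 'a" where
  "cofield2 F z = (1 / area_density F z) *\<^sub>R
     ((pderiv_at 1 F z \<bullet> pderiv_at 1 F z) *\<^sub>R pderiv_at 2 F z - (pderiv_at 1 F z \<bullet> pderiv_at 2 F z) *\<^sub>R pderiv_at 1 F z)"

lemma frechet_pderiv:
  assumes "F differentiable (at z)"
  shows "frechet_derivative F (at z) v = v $ 1 *\<^sub>R pderiv_at 1 F z + v $ 2 *\<^sub>R pderiv_at 2 F z"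
  by (rule fun_cong[OF frechet_derivative_at[OF has_derivative_pderiv_at[OF assms]], symmetric])

lemma gram_pos:
  assumes F: "F differentiable (at z)" and inj: "inj (frechet_derivative F (at z))"
  defines "a \<equiv> pderiv_at 1 F z" and "b \<equiv> pderiv_at 2 F z"
  shows "a \<bullet> a > 0" "b \<bullet> b > 0" "(a \<bullet> a) * (b \<bullet> b) - (a \<bullet> b)\<^sup>2 > 0"
proof -
  have ind: "s = 0 \<and> t = 0" if "s *\<^sub>R a + t *\<^sub>R b = 0" for s t
  proof -
    have "frechet_derivative F (at z) (vector [s, t]) = frechet_derivative F (at z) 0"
      using that by (simp add: frechet_pderiv[OF F] a_def b_def)
    then have "(vector [s, t] :: real^2) = 0" using inj by (meson injD)
    then show ?thesis by (metis vector_2 zero_index)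
  qed
  show aa: "a \<bullet> a > 0" using ind[of 1 0] by (auto simp: inner_gt_zero_iff)
  show "b \<bullet> b > 0" using ind[of 0 1] by (auto simp: inner_gt_zero_iff)
  \<comment> \<open>\<open>t\<close> is |a|^2 times the component of \<open>b\<close> orthogonal to
    \<open>a\<close>, so its squared length is |a|^2 times the Gram determinant.\<close>
  define t where "t = (a \<bullet> a) *\<^sub>R b - (a \<bullet> b) *\<^sub>R a"
  have "t \<noteq> 0" using ind[of "- (a \<bullet> b)" "a \<bullet> a"] aa by (auto simp: t_def)
  then have "t \<bullet> t > 0" by simp
  also have "t \<bullet> t = (a \<bullet> a) * ((a \<bullet> a) * (b \<bullet> b) - (a \<bullet> b)\<^sup>2)"
    by (simp add: t_def inner_diff inner_commute[of b a] power2_eq_square right_diff_distrib left_diff_distrib)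
  finally show "(a \<bullet> a) * (b \<bullet> b) - (a \<bullet> b)\<^sup>2 > 0" using aa zero_less_mult_pos by blast
qed

lemma area_density_pos:
  assumes "F differentiable (at z)" "inj (frechet_derivative F (at z))"
  shows "area_density F z > 0"
  using gram_pos[OF assms] by (simp add: area_density_def)

lemma area_density_sq:
  assumes "F differentiable (at z)" "inj (frechet_derivative F (at z))"
  shows "area_density F z * area_density F z =
     (pderiv_at 1 F z \<bullet> pderiv_at 1 F z) * (pderiv_at 2 F z \<bullet> pderiv_at 2 F z) -
           (pderiv_at 1 F z \<bullet> pderiv_at 2 F z)\<^sup>2"
  using gram_pos[OF assms] by (simp add: area_density_def)

text \<open>Divided by the area density, the two tangent vectors form the basis dual to the
  coordinate vectors.\<close>

lemma cofield_inner:
  assumes "F differentiable (at z)" "inj (frechet_derivative F (at z))"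
  shows "cofield1 F z \<bullet> pderiv_at 1 F z = area_density F z" "cofield1 F z \<bullet> pderiv_at 2 F z = 0"
    "cofield2 F z \<bullet> pderiv_at 1 F z = 0" "cofield2 F z \<bullet> pderiv_at 2 F z = area_density F z"
  using area_density_pos[OF assms] area_density_sq[OF assms]
  by (simp_all add: cofield1_def cofield2_def inner_diff inner_commute field_simps power2_eq_square)

lemma matrix_inv_eqI:
  fixes A B :: "real^'n^'n"
  assumes "A ** B = mat 1"
  shows "matrix_inv A = B"
proof -
  have "B ** A = mat 1" using assms matrix_left_right_inverse by blast
  then have "\<exists>A'. A ** A' = mat 1 \<and> A' ** A = mat 1" using assms by blast
  then have "matrix_inv A ** A = mat 1" unfolding matrix_inv_def by (rule someI2_ex) blast
  then show ?thesis by (metis assms matrix_mul_assoc matrix_mul_lid matrix_mul_rid)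
qed


text \<open>Multiplying by the Gram determinant \<open>d\<close> clears the inverse matrix. Each
  normal part is a second derivative minus a projection in the tangent plane, so moving the
  projections to the other side leaves a tangent vector.\<close>

lemma mean_curvature_zero_imp_tangent:
  fixes F :: "real^2 \<Rightarrow> 'a::euclidean_space"
  assumes F: "F differentiable (at z)" "inj (frechet_derivative F (at z))"
    and H: "mean_curvature_vector F z = 0"
  defines "a \<equiv> pderiv_at 1 F z" and "b \<equiv> pderiv_at 2 F z"
  shows "\<exists>s t. (b \<bullet> b) *\<^sub>R pderiv_at 1 (pderiv_at 1 F) z
       - (a \<bullet> b) *\<^sub>R (pderiv_at 1 (pderiv_at 2 F) z + pderiv_at 2 (pderiv_at 1 F) z)
       + (a \<bullet> a) *\<^sub>R pderiv_at 2 (pderiv_at 2 F) z = s *\<^sub>R a + t *\<^sub>R b"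
proof -
  define d where "d = (a \<bullet> a) * (b \<bullet> b) - (a \<bullet> b)\<^sup>2"
  have d: "d > 0" using gram_pos[OF F] by (simp add: d_def a_def b_def)
  \<comment> \<open>Cofactor formula for the inverse of the Gram matrix.\<close>
  define B :: "real^2^2" where "B = (\<chi> i j. (if i = 1 then if j = 1 then b \<bullet> b else - (a \<bullet> b)
     else if j = 1 then - (a \<bullet> b) else a \<bullet> a) / d)"
  have "first_fundamental_form F z ** B = mat 1"
    using d by (auto simp: vec_eq_iff forall_2 matrix_matrix_mult_def sum_2 first_fundamental_form_def
        B_def mat_def a_def[symmetric] b_def[symmetric] inner_commute divide_simps)
      (auto simp: d_def power2_eq_square inner_commute algebra_simps)
  then have inv: "matrix_inv (first_fundamental_form F z) = B" by (rule matrix_inv_eqI)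
  define w where "w = (\<lambda>i j. pderiv_at i (pderiv_at j F) z)"
  define c where "c = (\<lambda>i j. closest_point (tangent_plane F z) (w i j))"
  have lin: "linear (frechet_derivative F (at z))"
    using F(1) frechet_derivative_works has_derivative_linear by blast
  have sub: "subspace (tangent_plane F z)"
    unfolding tangent_plane_def by (rule linear_subspace_image[OF lin subspace_UNIV])
  have c: "c i j \<in> tangent_plane F z" for i j unfolding c_def
    using sub by (intro closest_point_in_set closed_subspace) (auto simp: tangent_plane_def)
  have "0 = d *\<^sub>R mean_curvature_vector F z" using H by simp
  also have "\<dots> = (b \<bullet> b) *\<^sub>R (w 1 1 - c 1 1) - (a \<bullet> b) *\<^sub>R (w 1 2 - c 1 2)
      - (a \<bullet> b) *\<^sub>R (w 2 1 - c 2 1) + (a \<bullet> a) *\<^sub>R (w 2 2 - c 2 2)"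
    using d unfolding mean_curvature_vector_def inv
    by (simp add: sum_2 B_def second_fundamental_form_def Let_def w_def c_def
        scaleR_add_right scaleR_diff_right[of d])
  finally have "(b \<bullet> b) *\<^sub>R w 1 1 - (a \<bullet> b) *\<^sub>R (w 1 2 + w 2 1) + (a \<bullet> a) *\<^sub>R w 2 2 =
      (b \<bullet> b) *\<^sub>R c 1 1 - (a \<bullet> b) *\<^sub>R c 1 2 - (a \<bullet> b) *\<^sub>R c 2 1 + (a \<bullet> a) *\<^sub>R c 2 2"
    by (simp add: algebra_simps)
  also have "\<dots> \<in> tangent_plane F z"
    by (intro subspace_add[OF sub] subspace_diff[OF sub] subspace_mul[OF sub] c)
  finally show ?thesis
    by (auto simp: tangent_plane_def frechet_pderiv[OF F(1)] w_def a_def b_def)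
qed

lemma cofield_differentiable:
  assumes U: "open U" "smooth_map_on U F" and inj: "\<And>z. z \<in> U \<Longrightarrow> inj (frechet_derivative F (at z))"
    and z: "z \<in> U"
  shows "area_density F differentiable (at z)" "cofield1 F differentiable (at z)"
    "cofield2 F differentiable (at z)"
proof -
  note s = smooth_map_onD[OF U]
  note d = s(2)[OF z]
  note ip = differentiable_inner differentiable_mult differentiable_diff differentiable_power
  have p: "(pderiv_at 1 F z \<bullet> pderiv_at 1 F z) * (pderiv_at 2 F z \<bullet> pderiv_at 2 F z) -
           (pderiv_at 1 F z \<bullet> pderiv_at 2 F z)\<^sup>2 > 0"
    using gram_pos[OF s(1)[OF z] inj[OF z]] by simp
  have "(\<lambda>z. (pderiv_at 1 F z \<bullet> pderiv_at 1 F z) * (pderiv_at 2 F z \<bullet> pderiv_at 2 F z) -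
           (pderiv_at 1 F z \<bullet> pderiv_at 2 F z)\<^sup>2) differentiable (at z)"
    by (intro ip d)
  then obtain G' where "((\<lambda>z. (pderiv_at 1 F z \<bullet> pderiv_at 1 F z) * (pderiv_at 2 F z \<bullet> pderiv_at 2 F z) -
           (pderiv_at 1 F z \<bullet> pderiv_at 2 F z)\<^sup>2) has_derivative G') (at z)"
    unfolding differentiable_def by blast
  from has_derivative_real_sqrt[OF p this]
  show A: "area_density F differentiable (at z)"
    unfolding differentiable_def area_density_def[abs_def] by blast
  have nz: "area_density F z \<noteq> 0" using area_density_pos[OF s(1)[OF z] inj[OF z]] by simp
  have i: "(\<lambda>z. 1 / area_density F z) differentiable (at z)"
    using A nz by (intro differentiable_divide differentiable_const)
  show "cofield1 F differentiable (at z)" "cofield2 F differentiable (at z)"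
    unfolding cofield1_def[abs_def] cofield2_def[abs_def]
    by (intro differentiable_scaleR differentiable_diff i differentiable_inner d)+
qed

text \<open>Coordinate form of the fact that a minimal immersion is harmonic. The tangential part of
  the divergence \<open>D\<close> vanishes for every immersion, as one sees by differentiating the
  duality relations and the formula for the squared area density. Minimality makes
  \<open>W z *\<^sub>R D\<close> a combination of tangent vectors. Hence \<open>D\<close> is
  orthogonal to itself.\<close>

lemma cofield_divergence_free:
  fixes F :: "real^2 \<Rightarrow> 'a::euclidean_space"
  assumes U: "open U" "smooth_map_on U F" and inj: "\<And>z. z \<in> U \<Longrightarrow> inj (frechet_derivative F (at z))"
    and z: "z \<in> U" and H: "mean_curvature_vector F z = 0"
  shows "pderiv_at 1 (cofield1 F) z + pderiv_at 2 (cofield2 F) z = 0"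
proof -
  note s = smooth_map_onD[OF U]
  note Fd = s(1) and cd = cofield_differentiable[OF U inj]
  define a b where "a = pderiv_at 1 F" and "b = pderiv_at 2 F"
  define W where "W = area_density F"
  define X Y where "X = cofield1 F" and "Y = cofield2 F"
  have da: "a differentiable (at z)" and db: "b differentiable (at z)" using s(2) z by (auto simp: a_def b_def)
  have dX: "X differentiable (at z)" and dY: "Y differentiable (at z)" and dW: "W differentiable (at z)"
    using cd z by (auto simp: X_def Y_def W_def)
  have W: "W z > 0" using area_density_pos Fd inj z by (auto simp: W_def)
  let ?d = "\<lambda>f. frechet_derivative f (at z)"
  note fw = frechet_derivative_works[THEN iffD1]
  \<comment> \<open>Identities that hold on all of \<open>U\<close> may be differentiated at
    \<open>z\<close>.\<close>
  have eq: "?d f = ?d g" if "f differentiable (at z)" "\<And>x. x \<in> U \<Longrightarrow> f x = g x"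
    for f g :: "real^2 \<Rightarrow> 'c::euclidean_space"
    by (rule frechet_derivative_at[OF has_derivative_transform_within_open[OF fw[OF that(1)] U(1) z that(2)]])
  have prod: "?d (\<lambda>x. f x \<bullet> g x) v = f z \<bullet> ?d g v + ?d f v \<bullet> g z"
    if "f differentiable (at z)" "g differentiable (at z)" for f g :: "real^2 \<Rightarrow> 'a" and v
    by (rule fun_cong[OF frechet_derivative_at[OF has_derivative_inner[OF fw[OF that(1)] fw[OF that(2)]], symmetric]])
  have sprod: "?d (\<lambda>x. f x *\<^sub>R g x) v = f z *\<^sub>R ?d g v + ?d f v *\<^sub>R g z"
    if "f differentiable (at z)" "g differentiable (at z)" for f and g :: "real^2 \<Rightarrow> 'a" and v
    by (rule fun_cong[OF frechet_derivative_at[OF has_derivative_scaleR[OF fw[OF that(1)] fw[OF that(2)]], symmetric]])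
  have "?d (\<lambda>x. X x \<bullet> a x) v = ?d W v" for v
    by (rule fun_cong[OF eq]) (use dX da cofield_inner(1) Fd inj in
        \<open>auto intro!: differentiable_inner simp: X_def a_def W_def\<close>)
  then have Xa: "X z \<bullet> ?d a v + ?d X v \<bullet> a z = ?d W v" for v
    by (simp add: prod dX da)
  have "?d (\<lambda>x. X x \<bullet> b x) v = ?d (\<lambda>x. 0 :: real) v" for v
    by (rule fun_cong[OF eq]) (use dX db cofield_inner(2) Fd inj in
        \<open>auto intro!: differentiable_inner simp: X_def b_def W_def\<close>)
  then have Xb: "X z \<bullet> ?d b v + ?d X v \<bullet> b z = 0" for v
    by (simp add: prod dX db)
  have "?d (\<lambda>x. Y x \<bullet> a x) v = ?d (\<lambda>x. 0 :: real) v" for v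
    by (rule fun_cong[OF eq]) (use dY da cofield_inner(3) Fd inj in
        \<open>auto intro!: differentiable_inner simp: Y_def a_def W_def\<close>)
  then have Ya: "Y z \<bullet> ?d a v + ?d Y v \<bullet> a z = 0" for v
    by (simp add: prod dY da)
  have "?d (\<lambda>x. Y x \<bullet> b x) v = ?d W v" for v
    by (rule fun_cong[OF eq]) (use dY db cofield_inner(4) Fd inj in
        \<open>auto intro!: differentiable_inner simp: Y_def b_def W_def\<close>)
  then have Yb: "Y z \<bullet> ?d b v + ?d Y v \<bullet> b z = ?d W v" for v
    by (simp add: prod dY db)
  define E G m where "E = (\<lambda>x. a x \<bullet> a x)" and "G = (\<lambda>x. b x \<bullet> b x)" and "m = (\<lambda>x. a x \<bullet> b x)"
  have dE: "E differentiable (at z)" "G differentiable (at z)" "m differentiable (at z)"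
    using da db by (auto simp: E_def G_def m_def intro!: differentiable_inner)
  have E': "?d E v = 2 * (a z \<bullet> ?d a v)" and G': "?d G v = 2 * (b z \<bullet> ?d b v)"
    and m': "?d m v = a z \<bullet> ?d b v + ?d a v \<bullet> b z" for v
    unfolding E_def G_def m_def prod[OF da da] prod[OF db db] prod[OF da db] by (simp_all add: inner_commute)
  have rprod: "?d (\<lambda>x. f x * g x) v = f z * ?d g v + ?d f v * g z"
    if "f differentiable (at z)" "g differentiable (at z)" for f g :: "real^2 \<Rightarrow> real" and v
    by (rule fun_cong[OF frechet_derivative_at[OF has_derivative_mult[OF fw[OF that(1)] fw[OF that(2)]], symmetric]])
  have rdiff: "?d (\<lambda>x. f x - g x) v = ?d f v - ?d g v"
    if "f differentiable (at z)" "g differentiable (at z)" for f g :: "real^2 \<Rightarrow> 'c::euclidean_space" and v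
    by (rule fun_cong[OF frechet_derivative_at[OF has_derivative_diff[OF fw[OF that(1)] fw[OF that(2)]], symmetric]])
  have "?d (\<lambda>x. W x * W x) v = ?d (\<lambda>x. E x * G x - m x * m x) v" for v
    by (rule fun_cong[OF eq]) (use dW area_density_sq Fd inj in
        \<open>auto intro!: differentiable_mult simp: a_def b_def W_def E_def G_def m_def power2_eq_square\<close>)
  then have W': "2 * (W z * ?d W v) = E z * ?d G v + G z * ?d E v - 2 * (m z * ?d m v)" for v
    using dW dE by (simp add: rprod rdiff differentiable_mult)
  \<comment> \<open>Multiplied by \<open>W\<close>, the fields become polynomial in \<open>a\<close>
    and \<open>b\<close>, so that no derivative of the quotient 1 / W has to be taken.\<close>
  have WX: "W x *\<^sub>R X x = G x *\<^sub>R a x - m x *\<^sub>R b x" "W x *\<^sub>R Y x = E x *\<^sub>R b x - m x *\<^sub>R a x"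
    if "x \<in> U" for x
    using area_density_pos[OF Fd[OF that] inj[OF that]]
    by (auto simp: W_def X_def Y_def cofield1_def cofield2_def a_def b_def E_def G_def m_def)
  have "?d (\<lambda>x. W x *\<^sub>R X x) v = ?d (\<lambda>x. G x *\<^sub>R a x - m x *\<^sub>R b x) v" for v
    by (rule fun_cong[OF eq]) (use dW dX WX in \<open>auto intro!: differentiable_scaleR\<close>)
  then have X': "W z *\<^sub>R ?d X v + ?d W v *\<^sub>R X z =
      G z *\<^sub>R ?d a v + ?d G v *\<^sub>R a z - (m z *\<^sub>R ?d b v + ?d m v *\<^sub>R b z)" for v
    using dW dX dE da db by (simp add: sprod rdiff differentiable_scaleR)
  have "?d (\<lambda>x. W x *\<^sub>R Y x) v = ?d (\<lambda>x. E x *\<^sub>R b x - m x *\<^sub>R a x) v" for v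
    by (rule fun_cong[OF eq]) (use dW dY WX in \<open>auto intro!: differentiable_scaleR\<close>)
  then have Y': "W z *\<^sub>R ?d Y v + ?d W v *\<^sub>R Y z =
      E z *\<^sub>R ?d b v + ?d E v *\<^sub>R b z - (m z *\<^sub>R ?d a v + ?d m v *\<^sub>R a z)" for v
    using dW dY dE da db by (simp add: sprod rdiff differentiable_scaleR)
  let ?e1 = "axis 1 1 :: real^2" and ?e2 = "axis 2 1 :: real^2"
  define a1 a2 b1 b2 where "a1 = ?d a ?e1" and "a2 = ?d a ?e2" and "b1 = ?d b ?e1" and "b2 = ?d b ?e2"
  \<comment> \<open>Symmetry of second derivatives, on which the cancellations in
    \<open>D \<bullet> a z\<close> and \<open>D \<bullet> b z\<close> rest.\<close>
  have b1: "b1 = a2"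
    using pderiv_at_commute[OF U z] by (simp add: b1_def a2_def b_def a_def pderiv_at_def)
  define D where "D = ?d X ?e1 + ?d Y ?e2"
  have WXz: "W z * (X z \<bullet> u) = G z * (a z \<bullet> u) - m z * (b z \<bullet> u)"
    "W z * (Y z \<bullet> u) = E z * (b z \<bullet> u) - m z * (a z \<bullet> u)" for u
    using arg_cong[OF WX(1)[OF z], of "\<lambda>x. x \<bullet> u"] arg_cong[OF WX(2)[OF z], of "\<lambda>x. x \<bullet> u"]
    by (simp_all add: inner_diff)
  have "W z * (D \<bullet> a z) = W z * ?d W ?e1 - W z * (X z \<bullet> a1) - W z * (Y z \<bullet> a2)"
    using arg_cong[OF Xa[of ?e1], of "\<lambda>x. W z * x"] arg_cong[OF Ya[of ?e2], of "\<lambda>x. W z * x"]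
    by (simp add: D_def a1_def a2_def inner_add algebra_simps)
  also have "\<dots> = 0"
    using W'[of ?e1] unfolding WXz E' G' m' a1_def[symmetric] b1_def[symmetric] unfolding b1
    by (simp add: inner_commute algebra_simps)
  finally have Da: "D \<bullet> a z = 0" using W by simp
  have "W z * (D \<bullet> b z) = W z * ?d W ?e2 - W z * (X z \<bullet> b1) - W z * (Y z \<bullet> b2)"
    using arg_cong[OF Xb[of ?e1], of "\<lambda>x. W z * x"] arg_cong[OF Yb[of ?e2], of "\<lambda>x. W z * x"]
    by (simp add: D_def b1_def b2_def inner_add algebra_simps)
  also have "\<dots> = 0"
    using W'[of ?e2] unfolding WXz E' G' m' a2_def[symmetric] b2_def[symmetric] unfolding b1
    by (simp add: inner_commute algebra_simps)
  finally have Db: "D \<bullet> b z = 0" using W by simp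
  obtain s t where st: "G z *\<^sub>R a1 - m z *\<^sub>R (b1 + a2) + E z *\<^sub>R b2 = s *\<^sub>R a z + t *\<^sub>R b z"
    using mean_curvature_zero_imp_tangent[OF Fd[OF z] inj[OF z] H]
    by (auto simp: a1_def a2_def b1_def b2_def pderiv_at_def[of _ "pderiv_at _ F"] a_def b_def E_def G_def m_def)
  \<comment> \<open>The first three terms are tangential by minimality, and the others are multiples
    of \<open>a z\<close>, \<open>b z\<close>, \<open>X z\<close> and \<open>Y z\<close>.\<close>
  have "W z *\<^sub>R D = G z *\<^sub>R a1 - m z *\<^sub>R (b1 + a2) + E z *\<^sub>R b2
     + (?d G ?e1 - ?d m ?e2) *\<^sub>R a z + (?d E ?e2 - ?d m ?e1) *\<^sub>R b z
     - ?d W ?e1 *\<^sub>R X z - ?d W ?e2 *\<^sub>R Y z"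
    using X'[of ?e1] Y'[of ?e2] by (simp add: D_def a1_def a2_def b1_def b2_def algebra_simps)
  moreover have "X z \<bullet> D = 0" "Y z \<bullet> D = 0"
    using WXz[of D] Da Db W by (auto simp: inner_commute)
  ultimately have "(W z *\<^sub>R D) \<bullet> D = 0"
    using Da Db unfolding st by (simp add: inner_add inner_diff inner_commute)
  then have "D = 0" using W by simp
  then show ?thesis by (simp add: D_def X_def Y_def pderiv_at_def)
qed

section \<open>Divergence of V along tangent planes, and the conormal\<close>

text \<open>Bessel's inequality for the projection to the span of \<open>a\<close> and
  \<open>b\<close>, with denominators cleared: \<open>s\<close> and \<open>r\<close> are the
  numerators in Cramer's rule, and \<open>t\<close> is \<open>d\<close> times the component of
  \<open>y\<close> normal to the span.\<close>

lemma gram_bessel: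
  fixes a b y :: "'a::real_inner"
  defines "d \<equiv> (a \<bullet> a) * (b \<bullet> b) - (a \<bullet> b)\<^sup>2"
  assumes "d > 0"
  shows "(b \<bullet> b) * (y \<bullet> a)\<^sup>2 - 2 * (a \<bullet> b) * (y \<bullet> a) * (y \<bullet> b) + (a \<bullet> a) * (y \<bullet> b)\<^sup>2 \<le> d * (y \<bullet> y)"
proof -
  define E G M p q where "E = a \<bullet> a" and "G = b \<bullet> b" and "M = a \<bullet> b" and "p = y \<bullet> a" and "q = y \<bullet> b"
  define s r where "s = p * G - q * M" and "r = q * E - p * M"
  have d: "d = E * G - M * M" by (simp add: d_def E_def G_def M_def power2_eq_square)
  define t where "t = d *\<^sub>R y - (s *\<^sub>R a + r *\<^sub>R b)"
  have "t \<bullet> a = d * p - (s * E + r * M)" "t \<bullet> b = d * q - (s * M + r * G)"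
    by (simp_all add: t_def inner_diff_left inner_add_left E_def G_def M_def p_def q_def inner_commute[of b a])
  then have ta: "t \<bullet> a = 0" "t \<bullet> b = 0" by (auto simp: d s_def r_def algebra_simps)
  have "0 \<le> t \<bullet> t" by simp
  also have "t \<bullet> t = t \<bullet> (d *\<^sub>R y) - s * (t \<bullet> a) - r * (t \<bullet> b)"
    by (subst (2) t_def) (simp add: inner_diff_right inner_add_right)
  also have "\<dots> = d * (t \<bullet> y)" by (simp add: ta)
  also have "t \<bullet> y = d * (y \<bullet> y) - (s * p + r * q)"
    by (simp add: t_def inner_diff_left inner_add_left p_def q_def inner_commute[of a y] inner_commute[of b y])
  finally have "s * p + r * q \<le> d * (y \<bullet> y)" using assms(2) by (simp add: zero_le_mult_iff)
  then show ?thesis unfolding E_def[symmetric] G_def[symmetric] M_def[symmetric] p_def[symmetric] q_def[symmetric]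
    by (simp add: s_def r_def power2_eq_square algebra_simps)
qed

lemma has_derivative_unit_inv:
  assumes "x \<noteq> c"
  shows "(unit_inv c has_derivative (\<lambda>v. (1 / (norm (x - c))\<^sup>2) *\<^sub>R v
      - (2 * ((x - c) \<bullet> v) / ((norm (x - c))\<^sup>2)\<^sup>2) *\<^sub>R (x - c))) (at x)"
proof -
  have "(x - c) \<bullet> (x - c) \<noteq> 0" using assms by simp
  then have "((\<lambda>x. (1 / ((x - c) \<bullet> (x - c))) *\<^sub>R (x - c)) has_derivative (\<lambda>v. (1 / ((x - c) \<bullet> (x - c))) *\<^sub>R v
      - (2 * ((x - c) \<bullet> v) / ((x - c) \<bullet> (x - c))\<^sup>2) *\<^sub>R (x - c))) (at x)"
    by (auto intro!: derivative_eq_intros simp: fun_eq_iff inner_commute power2_eq_square divide_simps)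
  then show ?thesis by (simp add: unit_inv_def[abs_def] power2_norm_eq_inner)
qed

text \<open>\<open>DV\<close> is the derivative of \<open>unit_inv c\<close> at \<open>F z\<close>, so the sum is the area density times the divergence
  of \<open>unit_inv c\<close> along the tangent plane.\<close>

lemma surface_divergence_unit_inv_nonneg:
  assumes F: "F differentiable (at z)" "inj (frechet_derivative F (at z))" and c: "F z \<noteq> c"
  defines "DV \<equiv> (\<lambda>v. (1 / (norm (F z - c))\<^sup>2) *\<^sub>R v - (2 * ((F z - c) \<bullet> v) / ((norm (F z - c))\<^sup>2)\<^sup>2) *\<^sub>R (F z - c))"
  shows "DV (pderiv_at 1 F z) \<bullet> cofield1 F z + DV (pderiv_at 2 F z) \<bullet> cofield2 F z \<ge> 0"
proof -
  define a b y r W where "a = pderiv_at 1 F z" and "b = pderiv_at 2 F z" and "y = F z - c"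
    and "r = (norm y)\<^sup>2" and "W = area_density F z"
  have r: "r > 0" using c by (simp add: r_def y_def)
  have W: "W > 0" using area_density_pos[OF F] by (simp add: W_def)
  note ci = cofield_inner[OF F, folded a_def b_def W_def]
  have WW: "W * W = (a \<bullet> a) * (b \<bullet> b) - (a \<bullet> b)\<^sup>2"
    using area_density_sq[OF F] by (simp add: W_def a_def b_def)
  have yX: "W * (y \<bullet> cofield1 F z) = (b \<bullet> b) * (y \<bullet> a) - (a \<bullet> b) * (y \<bullet> b)"
    "W * (y \<bullet> cofield2 F z) = (a \<bullet> a) * (y \<bullet> b) - (a \<bullet> b) * (y \<bullet> a)"
    using W by (simp_all add: cofield1_def cofield2_def a_def[symmetric] b_def[symmetric] W_def[symmetric] inner_diff_right)
  have "W * (DV a \<bullet> cofield1 F z + DV b \<bullet> cofield2 F z) =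
     2 * (W * W) / r - 2 / r\<^sup>2 * ((y \<bullet> a) * (W * (y \<bullet> cofield1 F z)) + (y \<bullet> b) * (W * (y \<bullet> cofield2 F z)))"
    using ci by (simp add: DV_def y_def[symmetric] r_def[symmetric] inner_diff_left inner_commute[of a] inner_commute[of b] algebra_simps)
  \<comment> \<open>The bracket is W^2 times the squared length of the component of \<open>y\<close>
    normal to the tangent plane; \<open>gram_bessel\<close> gives its sign.\<close>
  also have "\<dots> = 2 / r\<^sup>2 * (W * W * r - ((b \<bullet> b) * (y \<bullet> a)\<^sup>2 - 2 * (a \<bullet> b) * (y \<bullet> a) * (y \<bullet> b) + (a \<bullet> a) * (y \<bullet> b)\<^sup>2))"
    unfolding yX using r by (simp add: field_simps power2_eq_square)
  also have "\<dots> \<ge> 0"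
    using gram_bessel[of a b y] W r unfolding WW[symmetric] r_def power2_norm_eq_inner
    by (intro mult_nonneg_nonneg) auto
  finally show ?thesis using W by (simp add: zero_le_mult_iff a_def b_def)
qed

text \<open>Inside the tangent plane \<open>cofield2 F z\<close> is orthogonal to the boundary
  direction, has the length of \<open>pderiv_at 1 F z\<close> and points inward, so it is minus the
  conormal times the arc length density. The difference \<open>u\<close> of the two sides is shown
  to be orthogonal to itself.\<close>

lemma cofield2_conormal:
  assumes F: "F differentiable (at z)" "inj (frechet_derivative F (at z))"
    and eta: "outward_unit_conormal F z \<eta>"
  shows "cofield2 F z = - norm (pderiv_at 1 F z) *\<^sub>R \<eta>"
proof -
  define a b W X where "a = pderiv_at 1 F z" and "b = pderiv_at 2 F z" and "W = area_density F z" and "X = cofield2 F z"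
  note ci = cofield_inner(3,4)[OF F, folded a_def b_def W_def X_def]
  have W: "W > 0" using area_density_pos[OF F] by (simp add: W_def)
  have WW: "W * W = (a \<bullet> a) * (b \<bullet> b) - (a \<bullet> b)\<^sup>2"
    using area_density_sq[OF F] by (simp add: W_def a_def b_def)
  obtain w :: "real^2" where w: "w $ 2 < 0" "\<eta> = w $ 1 *\<^sub>R a + w $ 2 *\<^sub>R b" and n: "norm \<eta> = 1" and perp: "\<eta> \<bullet> a = 0"
    using eta by (auto simp: outward_unit_conormal_def frechet_pderiv[OF F(1)] a_def b_def)
  have h1: "\<eta> \<bullet> \<eta> = 1" using n by (simp add: norm_eq_1)
  have h2: "w $ 1 * (a \<bullet> a) = - w $ 2 * (a \<bullet> b)" using perp w(2) by (simp add: inner_add_left inner_commute[of b a])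
  have "\<eta> \<bullet> \<eta> = w $ 2 * (\<eta> \<bullet> b)"
    by (subst (2) w(2)) (simp add: inner_add_right perp)
  then have "1 = w $ 2 * (w $ 1 * (a \<bullet> b) + w $ 2 * (b \<bullet> b))" using h1 w(2) by (simp add: inner_add_left)
  \<comment> \<open>Multiplied by \<open>a \<bullet> a\<close>, so that orthogonality in the form
    \<open>h2\<close> can eliminate \<open>w $ 1\<close>.\<close>
  then have "a \<bullet> a = w $ 2 * ((w $ 1 * (a \<bullet> a)) * (a \<bullet> b) + w $ 2 * (a \<bullet> a) * (b \<bullet> b))" by algebra
  also have "\<dots> = (w $ 2)\<^sup>2 * (W * W)" unfolding h2 WW by (simp add: power2_eq_square algebra_simps)
  finally have "(norm a)\<^sup>2 = (- (w $ 2 * W))\<^sup>2" unfolding power2_norm_eq_inner by (simp add: power2_eq_square)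
  moreover have "0 \<le> - (w $ 2 * W)" using mult_neg_pos[OF w(1) W] by linarith
  ultimately have na: "norm a = - (w $ 2 * W)" using power2_eq_imp_eq norm_ge_zero by blast
  define u where "u = X + norm a *\<^sub>R \<eta>"
  have ua: "u \<bullet> a = 0" by (simp add: u_def inner_add_left ci perp)
  have "X \<bullet> \<eta> = w $ 2 * W" by (simp add: w(2) inner_add_right ci)
  then have ue: "u \<bullet> \<eta> = 0" using na h1 unfolding u_def inner_add_left inner_scaleR_left by simp
  then have ub: "u \<bullet> b = 0" using ua w by (simp add: inner_add_right)
  have "u \<bullet> X = 0" by (simp add: X_def cofield2_def a_def[symmetric] b_def[symmetric] inner_diff_right ua ub)
  then have "u \<bullet> u = 0" using ue unfolding u_def inner_add_right inner_scaleR_right by simp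
  then show ?thesis by (simp add: u_def X_def a_def eq_neg_iff_add_eq_0)
qed

lemma unit_inv_inner_sphere:
  assumes "norm x = 1" "norm c > 1"
  shows "unit_inv c x \<bullet> x = (1 - ((norm c)\<^sup>2 - 1) / (norm (x - c))\<^sup>2) / 2"
proof -
  have "x \<noteq> c" using assms by auto
  then have nz: "(norm (x - c))\<^sup>2 \<noteq> 0" by simp
  have "(norm (x - c))\<^sup>2 = 1 - 2 * (x \<bullet> c) + (norm c)\<^sup>2"
    using assms(1) by (simp add: power2_norm_eq_inner inner_diff inner_commute norm_eq_1)
  moreover have "(x - c) \<bullet> x = 1 - x \<bullet> c" using assms(1) by (simp add: inner_diff_left norm_eq_1 inner_commute[of c])
  ultimately show ?thesis using nz unfolding unit_inv_def inner_scaleR_left by (simp add: field_simps)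
qed

section \<open>Charts and their transition maps\<close>

definition "open_upper = {z::real^2. z $ 2 > 0}"

lemma open_upper [simp]: "open open_upper"
  unfolding open_upper_def by (intro open_Collect_less continuous_intros)

lemma open_upper_subset: "open_upper \<subseteq> half_plane" by (auto simp: open_upper_def half_plane_def)

lemma closed_half_plane: "closed half_plane"
  unfolding half_plane_def by (intro closed_Collect_le continuous_intros)

text \<open>The inverse of a chart is only asserted to exist; \<open>the_inv_into\<close> fixes it
  by a term, so that transition maps can be defined.\<close>

lemma local_paramD:
  assumes "local_param M \<phi> U h F"
  shows "open U" "smooth_map_on U F" "\<And>z. z \<in> U \<Longrightarrow> inj (frechet_derivative F (at z))"
    "\<And>z. z \<in> U \<Longrightarrow> z \<in> half_plane \<Longrightarrow> \<phi> (h z) = F z"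
    "openin (top_of_set M) (h ` (U \<inter> half_plane))"
    "\<And>z. z \<in> U \<Longrightarrow> z \<in> half_plane \<Longrightarrow> h z \<in> M"
    "continuous_on (U \<inter> half_plane) h" "inj_on h (U \<inter> half_plane)"
    "continuous_on (h ` (U \<inter> half_plane)) (the_inv_into (U \<inter> half_plane) h)"
proof -
  show "open U" "smooth_map_on U F" "\<And>z. z \<in> U \<Longrightarrow> inj (frechet_derivative F (at z))"
    "\<And>z. z \<in> U \<Longrightarrow> z \<in> half_plane \<Longrightarrow> \<phi> (h z) = F z"
    "openin (top_of_set M) (h ` (U \<inter> half_plane))"
    using assms by (auto simp: local_param_def)
  then show "\<And>z. z \<in> U \<Longrightarrow> z \<in> half_plane \<Longrightarrow> h z \<in> M"
    by (meson IntI image_subset_iff openin_imp_subset)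
  obtain k where k: "homeomorphism (U \<inter> half_plane) (h ` (U \<inter> half_plane)) h k"
    using assms by (auto simp: local_param_def)
  show "continuous_on (U \<inter> half_plane) h" using k homeomorphism_cont1 by blast
  show inj: "inj_on h (U \<inter> half_plane)" using k by (metis homeomorphism_apply1 inj_on_inverseI)
  show "continuous_on (h ` (U \<inter> half_plane)) (the_inv_into (U \<inter> half_plane) h)"
  proof (rule continuous_on_eq[OF homeomorphism_cont2[OF k]])
    fix p assume "p \<in> h ` (U \<inter> half_plane)"
    then show "k p = the_inv_into (U \<inter> half_plane) h p"
      using the_inv_into_f_f[OF inj] homeomorphism_apply1[OF k] by auto
  qed
qed

lemma local_param_open_image:
  assumes lp: "local_param M \<phi> U h F" and "open W"
  shows "openin (top_of_set M) (h ` (U \<inter> W \<inter> half_plane))"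
proof -
  obtain k where k: "homeomorphism (U \<inter> half_plane) (h ` (U \<inter> half_plane)) h k"
    using lp by (auto simp: local_param_def)
  have "openin (top_of_set (U \<inter> half_plane)) (U \<inter> W \<inter> half_plane)"
    using \<open>open W\<close> by (auto simp: openin_open intro!: exI[of _ W])
  from homeomorphism_imp_open_map[OF k this] local_paramD(5)[OF lp]
  show ?thesis by (metis openin_trans)
qed

text \<open>\<open>W\<close> is open in the plane; intersected with \<open>open_upper\<close> it
  yields open sets on which ordinary derivatives make sense.\<close>

lemma local_param_preimage:
  assumes lp: "local_param M \<phi> U h F" and N: "openin (top_of_set M) N"
  obtains W where "open W" "W \<subseteq> U" "\<And>z. z \<in> U \<Longrightarrow> z \<in> half_plane \<Longrightarrow> h z \<in> N \<longleftrightarrow> z \<in> W"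
proof -
  have "openin (top_of_set (U \<inter> half_plane)) (U \<inter> half_plane \<inter> h -` N)"
    using local_paramD(6,7)[OF lp] N by (intro continuous_openin_preimage[of _ _ M]) auto
  then obtain W where W: "open W" "U \<inter> half_plane \<inter> h -` N = U \<inter> half_plane \<inter> W"
    by (auto simp: openin_open)
  show thesis
    using W local_paramD(1)[OF lp] by (intro that[of "W \<inter> U"]) auto
qed

definition transition ::
  "(real^2) set \<Rightarrow> (real^2 \<Rightarrow> 'p) \<Rightarrow> (real^2 \<Rightarrow> 'p) \<Rightarrow> real^2 \<Rightarrow> real^2" where
  "transition U' h' h z = the_inv_into (U' \<inter> half_plane) h' (h z)"

lemma transition:
  assumes "local_param M \<phi> U' h' F'" "h z \<in> h' ` (U' \<inter> half_plane)"
  shows "h' (transition U' h' h z) = h z" "transition U' h' h z \<in> U'" "transition U' h' h z \<in> half_plane"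
  using local_paramD(8)[OF assms(1)] assms(2)
  by (auto simp: transition_def f_the_inv_into_f the_inv_into_f_f)

lemma transition_continuous:
  assumes lp: "local_param M \<phi> U h F" and lp': "local_param M \<phi> U' h' F'"
  shows "continuous_on {z \<in> U \<inter> half_plane. h z \<in> h' ` (U' \<inter> half_plane)} (transition U' h' h)"
  unfolding transition_def[abs_def]
  by (rule continuous_on_compose2[OF local_paramD(9)[OF lp']])
     (auto intro: continuous_on_subset[OF local_paramD(7)[OF lp]])

text \<open>Invariance of domain: the transition map is injective and continuous on a plane
  neighbourhood of \<open>z\<close>, so the image of that neighbourhood is open. Being contained in
  the closed half plane, it lies in the interior.\<close>

lemma transition_upper:
  assumes lp: "local_param M \<phi> U h F" and lp': "local_param M \<phi> U' h' F'"
    and z: "z \<in> U" "z \<in> open_upper" "h z \<in> h' ` (U' \<inter> half_plane)"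
  shows "transition U' h' h z \<in> open_upper"
proof -
  obtain W where W: "open W" "W \<subseteq> U" "\<And>z. z \<in> U \<Longrightarrow> z \<in> half_plane \<Longrightarrow> h z \<in> h' ` (U' \<inter> half_plane) \<longleftrightarrow> z \<in> W"
    using local_param_preimage[OF lp local_paramD(5)[OF lp']] by metis
  define S where "S = W \<inter> open_upper"
  have S: "open S" "z \<in> S" "S \<subseteq> {z \<in> U \<inter> half_plane. h z \<in> h' ` (U' \<inter> half_plane)}"
    using W z open_upper_subset by (auto simp: S_def)
  have "inj_on (transition U' h' h) S"
  proof (rule inj_onI)
    fix x y assume "x \<in> S" "y \<in> S" "transition U' h' h x = transition U' h' h y"
    then have "h x = h y" "x \<in> U \<inter> half_plane" "y \<in> U \<inter> half_plane"
      using transition(1)[OF lp'] S(3) by (metis (no_types, lifting) mem_Collect_eq subsetD, auto)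
    then show "x = y" using local_paramD(8)[OF lp] by (meson inj_onD)
  qed
  then have op: "open (transition U' h' h ` S)"
    using continuous_on_subset[OF transition_continuous[OF lp lp'] S(3)] S(1) invariance_of_domain by blast
  have "transition U' h' h ` S \<subseteq> half_plane" using transition(3)[OF lp'] S(3) by auto
  moreover have "interior half_plane = open_upper"
    unfolding half_plane_def open_upper_def using interior_halfspace_component_ge[of 0 2] 
    by (simp add: inner_axis interior_halfspace_component_ge)
  ultimately show ?thesis using interior_maximal[OF _ op] S(2) by blast
qed

text \<open>On \<open>S\<close> the transition turns \<open>F'\<close> into \<open>F\<close>, so
  \<open>has_derivative_factor\<close> makes it differentiable and the chain rule relates the
  derivatives. \<open>S\<close> avoids the boundary line, hence is open in the plane and fits the
  change of variables in area integrals. The reverse transition gives injectivity and the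
  image.\<close>

lemma transition_derivative:
  assumes lp: "local_param M \<phi> U h F" and lp': "local_param M \<phi> U' h' F'"
  defines "S \<equiv> {z \<in> U \<inter> open_upper. h z \<in> h' ` (U' \<inter> half_plane)}"
  shows "open S"
    and "z \<in> S \<Longrightarrow> \<exists>A. (transition U' h' h has_derivative A) (at z) \<and>
       (\<forall>v. frechet_derivative F' (at (transition U' h' h z)) (A v) = frechet_derivative F (at z) v)"
    and "inj_on (transition U' h' h) S"
    and "transition U' h' h ` S = {z \<in> U' \<inter> open_upper. h' z \<in> h ` (U \<inter> half_plane)}"
proof -
  let ?t = "transition U' h' h"
  obtain W where W: "open W" "W \<subseteq> U" "\<And>z. z \<in> U \<Longrightarrow> z \<in> half_plane \<Longrightarrow> h z \<in> h' ` (U' \<inter> half_plane) \<longleftrightarrow> z \<in> W"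
    using local_param_preimage[OF lp local_paramD(5)[OF lp']] by metis
  have S: "S = W \<inter> open_upper" using W(2,3) open_upper_subset by (auto simp: S_def)
  show opS: "open S" using W(1) by (auto simp: S)
  have sub: "S \<subseteq> {z \<in> U \<inter> half_plane. h z \<in> h' ` (U' \<inter> half_plane)}"
    using open_upper_subset by (auto simp: S_def)
  have inv: "transition U h h' (?t z) = z" if "z \<in> S" for z
    using that transition(1)[OF lp', of h z] the_inv_into_f_f[OF local_paramD(8)[OF lp], of z] open_upper_subset
    by (auto simp: S_def transition_def[of U])
  then show "inj_on ?t S" by (metis inj_on_inverseI)
  show "?t ` S = {z \<in> U' \<inter> open_upper. h' z \<in> h ` (U \<inter> half_plane)}" (is "_ = ?S'")
  proof
    show "?t ` S \<subseteq> ?S'"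
      using transition[OF lp'] transition_upper[OF lp lp'] sub
      by (auto simp: S_def) (metis IntI image_eqI open_upper_subset subsetD)
    show "?S' \<subseteq> ?t ` S"
    proof
      fix w assume w: "w \<in> ?S'"
      have "transition U h h' w \<in> S"
        using transition[OF lp, of h' w] transition_upper[OF lp' lp, of w] w open_upper_subset
        by (auto simp: S_def)
      moreover have "?t (transition U h h' w) = w"
        using w transition(1)[OF lp, of h' w] the_inv_into_f_f[OF local_paramD(8)[OF lp'], of w] open_upper_subset
        by (auto simp: transition_def[of U'])
      ultimately show "w \<in> ?t ` S" by (metis image_eqI)
    qed
  qed
  assume z: "z \<in> S"
  have zU: "z \<in> U" and tz: "?t z \<in> U'" using z transition(2)[OF lp', of h z] by (auto simp: S_def)
  have FF: "F' (?t x) = F x" if "x \<in> S" for x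
    using that transition[OF lp', of h x] local_paramD(4)[OF lp] local_paramD(4)[OF lp'] open_upper_subset
    by (auto simp: S_def subset_iff) metis
  have dF: "(F has_derivative frechet_derivative F (at z)) (at z)"
    using smooth_map_onD(1)[OF local_paramD(1,2)[OF lp] zU] frechet_derivative_works by blast
  have dF': "(F' has_derivative frechet_derivative F' (at (?t z))) (at (?t z))"
    using smooth_map_onD(1)[OF local_paramD(1,2)[OF lp'] tz] frechet_derivative_works by blast
  have cont: "continuous (at z within S) ?t"
    using continuous_on_subset[OF transition_continuous[OF lp lp'] sub] z continuous_on_eq_continuous_within by blast
  obtain A where "(?t has_derivative A) (at z within S)"
    using has_derivative_factor[OF dF' local_paramD(3)[OF lp' tz] has_derivative_at_withinI[OF dF] cont FF z] by blast
  then have A: "(?t has_derivative A) (at z)" using opS z at_within_open by metis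
  have "((\<lambda>x. F' (?t x)) has_derivative (\<lambda>v. frechet_derivative F' (at (?t z)) (A v))) (at z)"
    by (rule has_derivative_compose[OF A dF'])
  then have "(F has_derivative (\<lambda>v. frechet_derivative F' (at (?t z)) (A v))) (at z)"
    by (rule has_derivative_transform_within_open[OF _ opS z FF])
  then have "frechet_derivative F' (at (?t z)) (A v) = frechet_derivative F (at z) v" for v
    using has_derivative_unique[OF dF] by (metis (no_types, lifting))
  then show "\<exists>A. (?t has_derivative A) (at z) \<and>
       (\<forall>v. frechet_derivative F' (at (?t z)) (A v) = frechet_derivative F (at z) v)" using A by blast
qed


subsection \<open>Integration over the half plane\<close>

definition axis_pt :: "real \<Rightarrow> real^2" where "axis_pt x = x *\<^sub>R axis 1 1"

lemma axis_pt_nth [simp]: "axis_pt x $ 1 = x" "axis_pt x $ 2 = 0"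
  by (simp_all add: axis_pt_def axis_def)

lemma axis_pt_in_half_plane [simp]: "axis_pt x \<in> half_plane"
  by (simp add: half_plane_def)

lemma axis_pt_eq: "z $ 2 = 0 \<Longrightarrow> axis_pt (z $ 1) = z"
  by (simp add: vec_eq_iff forall_2)

lemma continuous_on_axis_pt [continuous_intros]: "continuous_on S f \<Longrightarrow> continuous_on S (\<lambda>x. axis_pt (f x))"
  unfolding axis_pt_def by (intro continuous_intros)

definition plane_pt :: "real \<times> real \<Rightarrow> real^2" where
  "plane_pt p = fst p *\<^sub>R axis 1 1 + snd p *\<^sub>R axis 2 1"

lemma plane_pt_nth [simp]: "plane_pt p $ 1 = fst p" "plane_pt p $ 2 = snd p"
  by (simp_all add: plane_pt_def axis_def)

lemma plane_pt_axis_pt: "plane_pt (x, 0) = axis_pt x" by (simp add: plane_pt_def axis_pt_def)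

lemma continuous_plane_pt: "continuous_on UNIV plane_pt"
  unfolding plane_pt_def[abs_def] by (intro continuous_intros)

lemma plane_pt_measurable [measurable]: "plane_pt \<in> borel_measurable borel"
  using continuous_plane_pt by (rule borel_measurable_continuous_onI)

lemma Basis_real2: "(Basis :: (real^2) set) = {axis 1 1, axis 2 1}"
  by (auto simp: Basis_vec_def axis_def UNIV_2)

lemma axis_12_neq: "(axis 1 1 :: real^2) \<noteq> axis 2 1"
  by (simp add: axis_eq_axis)

text \<open>Moves integrals over \<open>real^2\<close> to pairs of reals, where Fubini applies;
  agreement on boxes determines the measure.\<close>

lemma lborel_plane_pt: "(lborel :: (real^2) measure) = distr lborel borel plane_pt"
proof (rule lborel_eqI)
  fix l u :: "real^2" assume le: "\<And>b. b \<in> Basis \<Longrightarrow> l \<bullet> b \<le> u \<bullet> b"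
  then have le': "l $ 1 \<le> u $ 1" "l $ 2 \<le> u $ 2"
    using le[of "axis 1 1"] le[of "axis 2 1"] by (auto simp: Basis_real2 inner_axis)
  have pre: "plane_pt -` box l u = box (l $ 1, l $ 2) (u $ 1, u $ 2)"
    by (auto simp: mem_box Basis_real2 inner_axis Basis_prod_def)
  have "emeasure (distr lborel borel plane_pt) (box l u) = emeasure lborel (box (l $ 1, l $ 2) (u $ 1, u $ 2))"
    by (subst emeasure_distr) (auto simp: pre)
  also have "\<dots> = ennreal ((u $ 1 - l $ 1) * (u $ 2 - l $ 2))"
    by (subst emeasure_lborel_box) (use le' in \<open>auto simp: Basis_prod_def\<close>)
  also have "(u $ 1 - l $ 1) * (u $ 2 - l $ 2) = (\<Prod>b\<in>Basis. (u - l) \<bullet> b)"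
    by (simp add: Basis_real2 axis_12_neq inner_axis)
  finally show "emeasure (distr lborel borel plane_pt) (box l u) = (\<Prod>b\<in>Basis. (u - l) \<bullet> b)" .
qed simp

text \<open>\<open>K \<inter> half_plane\<close> is compact while
  \<open>K \<inter> open_upper\<close> may fail to be; continuity up to the boundary line is what
  bounds \<open>g\<close>.\<close>

lemma set_integrable_compact_support:
  fixes g :: "real^2 \<Rightarrow> real"
  assumes "open U" "compact K" "K \<subseteq> U" and g: "continuous_on (U \<inter> half_plane) g"
    and 0: "\<And>z. z \<in> U \<Longrightarrow> z \<in> open_upper \<Longrightarrow> z \<notin> K \<Longrightarrow> g z = 0"
  shows "set_integrable lborel (U \<inter> open_upper) g"
proof -
  have "set_integrable lborel (K \<inter> half_plane) g"
    unfolding set_integrable_def using assms closed_half_plane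
    by (intro borel_integrable_compact) (auto intro: continuous_on_subset[OF g] compact_Int_closed)
  then have "set_integrable lborel (K \<inter> open_upper) g"
    by (rule set_integrable_subset) (use assms open_upper_subset in \<open>auto simp: compact_imp_closed\<close>)
  moreover have "(\<lambda>z. indicator (U \<inter> open_upper) z *\<^sub>R g z) = (\<lambda>z. indicator (K \<inter> open_upper) z *\<^sub>R g z)"
    using 0 assms(3) by (auto simp: indicator_def fun_eq_iff)
  ultimately show ?thesis unfolding set_integrable_def by (simp only:)
qed

text \<open>Extended by zero, \<open>f\<close> can be integrated along whole lines. Horizontal lines
  contribute nothing, and a vertical line contributes minus the value of \<open>f\<close> at its
  foot; Fubini assembles the lines.\<close>

lemma half_plane_divergence:
  fixes f f1 f2 :: "real^2 \<Rightarrow> real"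
  assumes U: "open U" and K: "compact K" "K \<subseteq> U"
    and cf: "continuous_on (U \<inter> half_plane) f" and cf1: "continuous_on (U \<inter> half_plane) f1"
    and cf2: "continuous_on (U \<inter> half_plane) f2"
    and der: "\<And>z. z \<in> U \<Longrightarrow> z \<in> open_upper \<Longrightarrow> (f has_derivative (\<lambda>v. v $ 1 * f1 z + v $ 2 * f2 z)) (at z)"
    and f0: "\<And>z. z \<in> U \<Longrightarrow> z \<in> half_plane \<Longrightarrow> z \<notin> K \<Longrightarrow> f z = 0"
  shows "set_integrable lborel (U \<inter> open_upper) f1" "set_integrable lborel (U \<inter> open_upper) f2"
    and "(LINT z:U \<inter> open_upper|lborel. f1 z) = 0"
    and "(LINT z:U \<inter> open_upper|lborel. f2 z) = - (LINT x|lborel. indicator {x. axis_pt x \<in> U} x * f (axis_pt x))"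
proof -
  have opK: "open ((U \<inter> open_upper) - K)" "open (open_upper - K)"
    using U K by (auto intro!: open_Diff compact_imp_closed)
  have z0: "f1 z = 0 \<and> f2 z = 0" if "z \<in> U" "z \<in> open_upper" "z \<notin> K" for z
  proof -
    have "(f has_derivative (\<lambda>v. 0)) (at z)"
      by (rule has_derivative_transform_within_open[OF has_derivative_const[of 0] opK(1)])
         (use that f0 open_upper_subset in auto)
    then have "(\<lambda>v::real^2. v $ 1 * f1 z + v $ 2 * f2 z) = (\<lambda>v. 0)"
      by (rule has_derivative_unique[OF der[OF that(1,2)]])
    from fun_cong[OF this, of "axis 1 1"] fun_cong[OF this, of "axis 2 1"] show ?thesis
      by (simp add: axis_def)
  qed
  show i1: "set_integrable lborel (U \<inter> open_upper) f1"
    using set_integrable_compact_support[OF U K cf1] z0 by blast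
  show i2: "set_integrable lborel (U \<inter> open_upper) f2"
    using set_integrable_compact_support[OF U K cf2] z0 by blast
  define g1 g2 where "g1 = (\<lambda>z. indicator (U \<inter> open_upper) z * f1 z)" and "g2 = (\<lambda>z. indicator (U \<inter> open_upper) z * f2 z)"
  have ig: "integrable lborel g1" "integrable lborel g2"
    using i1 i2 by (auto simp: set_integrable_def g1_def g2_def)
  define fe where "fe = (\<lambda>z. if z \<in> U \<inter> half_plane then f z else 0)"
  \<comment> \<open>Points with a coordinate of absolute value at least \<open>R\<close> lie outside
    \<open>K\<close>, so \<open>fe\<close> vanishes at the far endpoints of the lines below.\<close>
  obtain R where R: "R > 0" "K \<subseteq> ball 0 R"
    using bounded_subset_ballD[OF compact_imp_bounded[OF K(1)]] by blast
  have fe_der: "(fe has_derivative (\<lambda>v. v $ 1 * g1 z + v $ 2 * g2 z)) (at z)" if z: "z \<in> open_upper" for z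
  proof (cases "z \<in> U")
    case True
    have "(fe has_derivative (\<lambda>v. v $ 1 * f1 z + v $ 2 * f2 z)) (at z)"
      by (rule has_derivative_transform_within_open[OF der[OF True z], of "U \<inter> open_upper"])
         (use U True z open_upper_subset in \<open>auto simp: fe_def\<close>)
    then show ?thesis using True z by (simp add: g1_def g2_def)
  next
    case False
    have "(fe has_derivative (\<lambda>v. 0)) (at z)"
      by (rule has_derivative_transform_within_open[OF has_derivative_const[of 0] opK(2)])
         (use z False K f0 open_upper_subset in \<open>auto simp: fe_def\<close>)
    then show ?thesis using False by (simp add: g1_def g2_def)
  qed
  have fe_cont: "continuous_on half_plane fe"
  proof -
    have eq: "half_plane = (half_plane \<inter> U) \<union> (half_plane - K)" using K by auto
    have 1: "continuous_on (half_plane \<inter> U) fe"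
      by (rule continuous_on_eq[OF cf[unfolded Int_commute[of U]]]) (auto simp: fe_def)
    have 2: "continuous_on (half_plane - K) fe"
      by (rule continuous_on_eq[OF continuous_on_const[of _ 0]]) (use f0 in \<open>auto simp: fe_def\<close>)
    have 3: "openin (top_of_set half_plane) (half_plane \<inter> U)" using U by auto
    have 4: "openin (top_of_set half_plane) (half_plane - K)"
      using K(1) by (metis Diff_eq compact_imp_closed open_Compl openin_open_Int)
    show ?thesis using continuous_on_Un_local_open[of "half_plane \<inter> U" "half_plane - K" fe] 1 2 3 4 eq by simp
  qed
  have fe0: "fe z = 0" "g1 z = 0" "g2 z = 0" if "z \<notin> K" for z
    using that f0 z0 by (auto simp: fe_def g1_def g2_def indicator_def)
  have g0: "g1 z = 0" "g2 z = 0" if "z \<notin> open_upper" for z using that by (auto simp: g1_def g2_def)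
  have nK: "plane_pt (x, y) \<notin> K" if "R \<le> \<bar>x\<bar> \<or> R \<le> \<bar>y\<bar>" for x y
  proof
    assume "plane_pt (x, y) \<in> K"
    then have "norm (plane_pt (x, y)) < R" using R by auto
    then show False using that component_le_norm_cart[of "plane_pt (x, y)" 1] component_le_norm_cart[of "plane_pt (x, y)" 2] by auto
  qed
  have line2: "((\<lambda>y. g2 (plane_pt (x, y))) has_integral - fe (axis_pt x)) UNIV" for x
  proof -
    have "((\<lambda>y. g2 (plane_pt (x, y))) has_integral (fe (plane_pt (x, R)) - fe (plane_pt (x, 0)))) {0..R}"
    proof (rule fundamental_theorem_of_calculus_interior)
      show "continuous_on {0..R} (\<lambda>y. fe (plane_pt (x, y)))"
        by (rule continuous_on_compose2[OF fe_cont])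
           (auto simp: half_plane_def intro!: continuous_on_compose2[OF continuous_plane_pt] continuous_intros)
      fix y assume "y \<in> {0<..<R}"
      then have up: "plane_pt (x, y) \<in> open_upper" by (simp add: open_upper_def)
      have "((\<lambda>y. plane_pt (x, y)) has_derivative (\<lambda>h. h *\<^sub>R axis 2 1)) (at y)"
        unfolding plane_pt_def by (auto intro!: derivative_eq_intros)
      from has_derivative_compose[OF this fe_der[OF up]]
      show "((\<lambda>y. fe (plane_pt (x, y))) has_vector_derivative g2 (plane_pt (x, y))) (at y)"
        by (simp add: has_vector_derivative_def axis_def)
    qed (use R in simp)
    then have "((\<lambda>y. g2 (plane_pt (x, y))) has_integral - fe (axis_pt x)) {0..R}"
      using fe0(1)[of "plane_pt (x, R)"] nK[of x R] R(1) by (simp add: plane_pt_axis_pt)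
    then show ?thesis
    proof (rule has_integral_on_superset)
      fix y assume "y \<notin> {0..R}"
      then have "y < 0 \<or> R \<le> \<bar>y\<bar>" by auto
      then show "g2 (plane_pt (x, y)) = 0" using fe0(3) nK[of x y] g0(2)[of "plane_pt (x, y)"] by (auto simp: open_upper_def)
    qed auto
  qed
  have line1: "((\<lambda>x. g1 (plane_pt (x, y))) has_integral 0) UNIV" for y
  proof (cases "y > 0")
    case True
    have "((\<lambda>x. g1 (plane_pt (x, y))) has_integral (fe (plane_pt (R, y)) - fe (plane_pt (-R, y)))) {-R..R}"
    proof (rule fundamental_theorem_of_calculus_interior)
      show "continuous_on {-R..R} (\<lambda>x. fe (plane_pt (x, y)))"
        using True by (intro continuous_on_compose2[OF fe_cont])
           (auto simp: half_plane_def intro!: continuous_on_compose2[OF continuous_plane_pt] continuous_intros)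
      fix x assume "x \<in> {-R<..<R}"
      have up: "plane_pt (x, y) \<in> open_upper" using True by (simp add: open_upper_def)
      have "((\<lambda>x. plane_pt (x, y)) has_derivative (\<lambda>h. h *\<^sub>R axis 1 1)) (at x)"
        unfolding plane_pt_def by (auto intro!: derivative_eq_intros)
      from has_derivative_compose[OF this fe_der[OF up]]
      show "((\<lambda>x. fe (plane_pt (x, y))) has_vector_derivative g1 (plane_pt (x, y))) (at x)"
        by (simp add: has_vector_derivative_def axis_def)
    qed (use R in simp)
    then have "((\<lambda>x. g1 (plane_pt (x, y))) has_integral 0) {-R..R}"
      using fe0(1)[of "plane_pt (R, y)"] fe0(1)[of "plane_pt (- R, y)"] nK[of R y] nK[of "-R" y] R(1) by simp
    then show ?thesis
    proof (rule has_integral_on_superset)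
      fix x assume "x \<notin> {-R..R}"
      then have "R \<le> \<bar>x\<bar>" by auto
      then show "g1 (plane_pt (x, y)) = 0" using fe0(2) nK[of x y] by auto
    qed auto
  next
    case False
    then have "g1 (plane_pt (x, y)) = 0" for x using g0(1) by (auto simp: open_upper_def)
    then show ?thesis by simp
  qed
  have igp: "integrable (lborel \<Otimes>\<^sub>M lborel) (\<lambda>p. g (plane_pt p))"
    and split: "integral\<^sup>L lborel g = integral\<^sup>L (lborel \<Otimes>\<^sub>M lborel) (\<lambda>p. g (plane_pt p))"
    if g: "integrable lborel g" for g :: "real^2 \<Rightarrow> real"
  proof -
    have [measurable]: "g \<in> borel_measurable borel" using g by auto
    have "integrable (distr lborel borel plane_pt) g" using g lborel_plane_pt by metis
    then show "integrable (lborel \<Otimes>\<^sub>M lborel) (\<lambda>p. g (plane_pt p))"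
      unfolding lborel_prod using integrable_distr_eq[of plane_pt lborel borel g] by simp
    have "integral\<^sup>L lborel g = integral\<^sup>L (distr lborel borel plane_pt) g" using lborel_plane_pt by metis
    then show "integral\<^sup>L lborel g = integral\<^sup>L (lborel \<Otimes>\<^sub>M lborel) (\<lambda>p. g (plane_pt p))"
      unfolding lborel_prod using integral_distr[of plane_pt lborel borel g] by simp
  qed
  note igp = igp[OF ig(1)] igp[OF ig(2)]
  have "integral\<^sup>L lborel g1 = (LINT y|lborel. LINT x|lborel. g1 (plane_pt (x, y)))"
    unfolding split[OF ig(1)] using lborel_pair.integral_snd[of "\<lambda>x y. g1 (plane_pt (x, y))"] igp(1) by (simp add: case_prod_beta')
  also have "\<dots> = (LINT y|(lborel :: real measure). 0)"
  proof (rule Bochner_Integration.integral_cong_AE)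
    \<comment> \<open>On every line the slice integral is known in the gauge sense. It equals the
      Lebesgue integral on those slices that Fubini shows to be integrable, hence almost
      everywhere.\<close>
    have "AE y in lborel. integrable lborel (\<lambda>x. g1 (plane_pt (x, y)))"
      using lborel_pair.AE_integrable_snd[of "\<lambda>x y. g1 (plane_pt (x, y))"] igp(1) by (simp add: case_prod_beta')
    then show "AE y in lborel. (LINT x|lborel. g1 (plane_pt (x, y))) = 0"
      by eventually_elim (use line1 has_integral_integral_lborel has_integral_unique in blast)
    show "(\<lambda>y. LINT x|lborel. g1 (plane_pt (x, y))) \<in> borel_measurable lborel"
      using lborel_pair.integrable_snd[of "\<lambda>x y. g1 (plane_pt (x, y))"] igp(1) borel_measurable_integrable by (force simp: case_prod_beta')
  qed simp
  finally show "(LINT z:U \<inter> open_upper|lborel. f1 z) = 0"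
    by (simp add: set_lebesgue_integral_def g1_def)
  have cb: "continuous_on UNIV (\<lambda>x. fe (axis_pt x))"
    by (intro continuous_on_compose2[OF fe_cont] continuous_intros) auto
  have "integral\<^sup>L lborel g2 = (LINT x|lborel. LINT y|lborel. g2 (plane_pt (x, y)))"
    unfolding split[OF ig(2)] using lborel_pair.integral_fst[of "\<lambda>x y. g2 (plane_pt (x, y))"] igp(2) by (simp add: case_prod_beta')
  also have "\<dots> = (LINT x|lborel. - fe (axis_pt x))"
  proof (rule Bochner_Integration.integral_cong_AE)
    have "AE x in lborel. integrable lborel (\<lambda>y. g2 (plane_pt (x, y)))"
      using lborel_pair.AE_integrable_fst[of "\<lambda>x y. g2 (plane_pt (x, y))"] igp(2) by (simp add: case_prod_beta')
    then show "AE x in lborel. (LINT y|lborel. g2 (plane_pt (x, y))) = - fe (axis_pt x)"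
      by eventually_elim (use line2 has_integral_integral_lborel has_integral_unique in blast)
    show "(\<lambda>x. LINT y|lborel. g2 (plane_pt (x, y))) \<in> borel_measurable lborel"
      using lborel_pair.integrable_fst[of "\<lambda>x y. g2 (plane_pt (x, y))"] igp(2) borel_measurable_integrable by (force simp: case_prod_beta')
    show "(\<lambda>x. - fe (axis_pt x)) \<in> borel_measurable lborel"
      using borel_measurable_continuous_onI[OF cb] by simp
  qed
  also have "\<dots> = - (LINT x|lborel. indicator {x. axis_pt x \<in> U} x * f (axis_pt x))"
    by (simp, rule Bochner_Integration.integral_cong) (auto simp: fe_def)
  finally show "(LINT z:U \<inter> open_upper|lborel. f2 z) = - (LINT x|lborel. indicator {x. axis_pt x \<in> U} x * f (axis_pt x))"
    by (simp add: set_lebesgue_integral_def g2_def)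
qed

section \<open>Change of variables\<close>

lemma set_borel_measurable_continuous_open:
  fixes f :: "'a::euclidean_space \<Rightarrow> real"
  assumes "open S" "continuous_on S f"
  shows "(\<lambda>x. indicator S x * f x) \<in> borel_measurable lborel"
  using borel_measurable_continuous_on_indicator[of S f] assms by simp

lemma set_integral_lborel_eq_integral:
  fixes f :: "'a::euclidean_space \<Rightarrow> real"
  assumes "open S" "continuous_on S f" 
  shows "f absolutely_integrable_on S \<longleftrightarrow> set_integrable lborel S f"
    "f absolutely_integrable_on S \<Longrightarrow> integral S f = (LINT x:S|lborel. f x)"
proof -
  show 1: "f absolutely_integrable_on S \<longleftrightarrow> set_integrable lborel S f"
    unfolding set_integrable_def using set_borel_measurable_continuous_open[OF assms]
    by (subst integrable_completion) auto
  show "f absolutely_integrable_on S \<Longrightarrow> integral S f = (LINT x:S|lborel. f x)"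
    using set_borel_integral_eq_integral(2) 1 by metis
qed

lemma set_integral_change_of_variables:
  fixes f g :: "real^2 \<Rightarrow> real" and t :: "real^2 \<Rightarrow> real^2"
  assumes "open S" "continuous_on S f" and fi: "set_integrable lborel S f"
    and "open (t ` S)" "continuous_on (t ` S) g"
    and der: "\<And>z. z \<in> S \<Longrightarrow> (t has_derivative A z) (at z)" and inj: "inj_on t S"
    and fg: "\<And>z. z \<in> S \<Longrightarrow> f z = \<bar>det (matrix (A z))\<bar> * g (t z)"
  shows "(LINT z:S|lborel. f z) = (LINT z:t ` S|lborel. g z)"
proof -
  have fa: "f absolutely_integrable_on S"
    using fi set_integral_lborel_eq_integral(1) assms by blast
  \<comment> \<open>The change of variables rule used here concerns functions into a cartesian power
    of the reals; \<open>L\<close> embeds the reals into \<open>real^1\<close>.\<close>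
  define L where "L = (vec :: real \<Rightarrow> real^1)"
  have cv: "(\<lambda>x. \<bar>det (matrix (A x))\<bar> *\<^sub>R L (g (t x))) absolutely_integrable_on S \<and>
           integral S (\<lambda>x. \<bar>det (matrix (A x))\<bar> *\<^sub>R L (g (t x))) = L (integral S f)
     \<longleftrightarrow> (\<lambda>x. L (g x)) absolutely_integrable_on (t ` S) \<and> integral (t ` S) (\<lambda>x. L (g x)) = L (integral S f)"
    by (rule has_absolute_integral_change_of_variables)
       (use assms(1) der inj in \<open>auto intro: has_derivative_at_withinI\<close>)
  have eq: "\<bar>det (matrix (A x))\<bar> *\<^sub>R L (g (t x)) = L (f x)" if "x \<in> S" for x
    using fg[OF that] by (simp add: L_def vec_eq_iff)
  have 1: "(\<lambda>x. L (f x)) absolutely_integrable_on S \<and> integral S (\<lambda>x. L (f x)) = L (integral S f)"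
    using fa by (simp add: L_def absolutely_integrable_on_1_iff integral_on_1_eq)
  have "(\<lambda>x. \<bar>det (matrix (A x))\<bar> *\<^sub>R L (g (t x))) absolutely_integrable_on S
      \<longleftrightarrow> (\<lambda>x. L (f x)) absolutely_integrable_on S"
    by (rule set_integrable_cong[OF refl refl eq])
  then have "(\<lambda>x. \<bar>det (matrix (A x))\<bar> *\<^sub>R L (g (t x))) absolutely_integrable_on S" using 1 by blast
  moreover have "integral S (\<lambda>x. \<bar>det (matrix (A x))\<bar> *\<^sub>R L (g (t x))) = L (integral S f)"
    using conjunct2[OF 1] Henstock_Kurzweil_Integration.integral_cong[of S, OF eq] by (simp only:)
  ultimately have "(\<lambda>x. L (g x)) absolutely_integrable_on (t ` S) \<and> integral (t ` S) (\<lambda>x. L (g x)) = L (integral S f)"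
    using cv by blast
  then have "g absolutely_integrable_on (t ` S)" "integral (t ` S) g = integral S f"
    by (auto simp: L_def absolutely_integrable_on_1_iff integral_on_1_eq)
  then show ?thesis
    using set_integral_lborel_eq_integral(2) assms fa by metis
qed

text \<open>The change of variables decides integrability on both sides at once; where it fails,
  both integrals of nonnegative functions are infinite. \<open>S\<close> may be any Borel set, as
  the traces of arcs require.\<close>

lemma nn_integral_change_of_variables_real:
  fixes f g :: "real \<Rightarrow> real"
  assumes S: "S \<in> sets borel" "t ` S \<in> sets borel"
    and f[measurable]: "f \<in> borel_measurable borel" and g[measurable]: "g \<in> borel_measurable borel"
    and nn: "\<And>x. f x \<ge> 0" "\<And>x. g x \<ge> 0"
    and der: "\<And>x. x \<in> S \<Longrightarrow> (t has_real_derivative t' x) (at x)" and inj: "inj_on t S"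
    and fg: "\<And>x. x \<in> S \<Longrightarrow> f x = \<bar>t' x\<bar> * g (t x)"
  shows "(\<integral>\<^sup>+ x. ennreal (f x) * indicator S x \<partial>lborel) = (\<integral>\<^sup>+ x. ennreal (g x) * indicator (t ` S) x \<partial>lborel)"
proof -
  note [measurable] = S
  have cv: "f absolutely_integrable_on S \<and> integral S f = b
     \<longleftrightarrow> g absolutely_integrable_on (t ` S) \<and> integral (t ` S) g = b" for b
  proof -
    have "(\<lambda>x. \<bar>t' x\<bar> * g (t x)) absolutely_integrable_on S \<and> integral S (\<lambda>x. \<bar>t' x\<bar> * g (t x)) = b
     \<longleftrightarrow> g absolutely_integrable_on (t ` S) \<and> integral (t ` S) g = b"
      by (rule has_absolute_integral_change_of_variables_1')
         (use S der inj in \<open>auto intro: has_field_derivative_at_within\<close>)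
    moreover have "(\<lambda>x. \<bar>t' x\<bar> * g (t x)) absolutely_integrable_on S \<longleftrightarrow> f absolutely_integrable_on S"
      by (rule set_integrable_cong) (auto simp: fg)
    moreover have "integral S (\<lambda>x. \<bar>t' x\<bar> * g (t x)) = integral S f"
      by (rule Henstock_Kurzweil_Integration.integral_cong) (simp add: fg)
    ultimately show ?thesis by simp
  qed
  have ind: "ennreal (k x) * indicator X x = ennreal (indicator X x * k x)" for k :: "real \<Rightarrow> real" and X x
    by (auto simp: indicator_def)
  have iff: "k absolutely_integrable_on X \<longleftrightarrow> integrable lborel (\<lambda>x. indicator X x * k x)"
    if [measurable]: "k \<in> borel_measurable borel" "X \<in> sets borel" for k :: "real \<Rightarrow> real" and X
    unfolding set_integrable_def by (subst integrable_completion) auto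
  have val: "(\<integral>\<^sup>+ x. ennreal (k x) * indicator X x \<partial>lborel) = ennreal (integral X k)"
    if "k absolutely_integrable_on X" "\<And>x. k x \<ge> 0" "k \<in> borel_measurable borel" "X \<in> sets borel"
    for k :: "real \<Rightarrow> real" and X
  proof -
    have i: "integrable lborel (\<lambda>x. indicator X x * k x)" using that iff by blast
    then have "integral X k = (LINT x|lborel. indicator X x * k x)"
      using set_borel_integral_eq_integral(2)[of X k] by (simp add: set_integrable_def set_lebesgue_integral_def)
    then show ?thesis unfolding ind using nn_integral_eq_integral[OF i] that(2) by simp
  qed
  have inf: "(\<integral>\<^sup>+ x. ennreal (k x) * indicator X x \<partial>lborel) = \<infinity>"
    if "\<not> k absolutely_integrable_on X" "\<And>x. k x \<ge> 0" and [measurable]: "k \<in> borel_measurable borel" "X \<in> sets borel"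
    for k :: "real \<Rightarrow> real" and X
  proof (rule ccontr)
    assume "(\<integral>\<^sup>+ x. ennreal (k x) * indicator X x \<partial>lborel) \<noteq> \<infinity>"
    then have "(\<integral>\<^sup>+ x. ennreal (norm (indicator X x * k x)) \<partial>lborel) < \<infinity>"
      unfolding ind using that(2) by (simp add: top.not_eq_extremum abs_mult)
    then have "integrable lborel (\<lambda>x. indicator X x * k x)" by (intro integrableI_bounded) auto
    then show False using that iff by blast
  qed
  show ?thesis
  proof (cases "f absolutely_integrable_on S")
    case True
    then have "g absolutely_integrable_on (t ` S)" "integral (t ` S) g = integral S f" using cv by blast+
    then show ?thesis using val True nn S f g by metis
  next
    case False
    then have "\<not> g absolutely_integrable_on (t ` S)" using cv by blast
    then show ?thesis using inf False nn S f g by metis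
  qed
qed


subsection \<open>Functions on the surface and partitions of unity\<close>

text \<open>Regularity up to the boundary line is encoded by partial derivatives that extend
  continuously to \<open>U \<inter> half_plane\<close>, while the derivative itself is taken only in
  \<open>open_upper\<close>. The condition is imposed in all charts, so it may be used in whichever
  chart an integral lives.\<close>

definition C1_on_surface ::
  "'p::t2_space set \<Rightarrow> ('p \<Rightarrow> 'a::euclidean_space) \<Rightarrow> ('p \<Rightarrow> real) \<Rightarrow> bool" where
  "C1_on_surface M \<phi> q \<longleftrightarrow> (\<forall>U h F. local_param M \<phi> U h F \<longrightarrow>
     continuous_on (U \<inter> half_plane) (\<lambda>z. q (h z)) \<and>
     (\<exists>q1 q2. continuous_on (U \<inter> half_plane) q1 \<and> continuous_on (U \<inter> half_plane) q2 \<and>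
        (\<forall>z\<in>U \<inter> open_upper. ((\<lambda>z. q (h z)) has_derivative (\<lambda>v. v $ 1 * q1 z + v $ 2 * q2 z)) (at z))))"

lemma C1_on_surfaceD:
  assumes "C1_on_surface M \<phi> q" "local_param M \<phi> U h F"
  shows "continuous_on (U \<inter> half_plane) (\<lambda>z. q (h z))"
    and "\<exists>q1 q2. continuous_on (U \<inter> half_plane) q1 \<and> continuous_on (U \<inter> half_plane) q2 \<and>
        (\<forall>z\<in>U \<inter> open_upper. ((\<lambda>z. q (h z)) has_derivative (\<lambda>v. v $ 1 * q1 z + v $ 2 * q2 z)) (at z))"
  using assms unfolding C1_on_surface_def by blast+

lemma C1_on_surface_add:
  assumes "C1_on_surface M \<phi> p" "C1_on_surface M \<phi> q"
  shows "C1_on_surface M \<phi> (\<lambda>x. p x + q x)"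
  unfolding C1_on_surface_def
proof (intro allI impI conjI)
  fix U h F assume lp: "local_param M \<phi> U h F"
  obtain p1 p2 where p12: "continuous_on (U \<inter> half_plane) p1" "continuous_on (U \<inter> half_plane) p2"
    "\<And>z. z\<in>U \<inter> open_upper \<Longrightarrow> ((\<lambda>z. p (h z)) has_derivative (\<lambda>v. v $ 1 * p1 z + v $ 2 * p2 z)) (at z)"
    using C1_on_surfaceD(2)[OF assms(1) lp] by blast
  obtain q1 q2 where q12: "continuous_on (U \<inter> half_plane) q1" "continuous_on (U \<inter> half_plane) q2"
    "\<And>z. z\<in>U \<inter> open_upper \<Longrightarrow> ((\<lambda>z. q (h z)) has_derivative (\<lambda>v. v $ 1 * q1 z + v $ 2 * q2 z)) (at z)"
    using C1_on_surfaceD(2)[OF assms(2) lp] by blast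
  note pq = p12 q12
  show "continuous_on (U \<inter> half_plane) (\<lambda>z. p (h z) + q (h z))"
    using C1_on_surfaceD(1)[OF _ lp] assms by (intro continuous_intros)
  show "\<exists>r1 r2. continuous_on (U \<inter> half_plane) r1 \<and> continuous_on (U \<inter> half_plane) r2 \<and>
        (\<forall>z\<in>U \<inter> open_upper. ((\<lambda>z. p (h z) + q (h z)) has_derivative (\<lambda>v. v $ 1 * r1 z + v $ 2 * r2 z)) (at z))"
    by (rule exI[of _ "\<lambda>z. p1 z + q1 z"], rule exI[of _ "\<lambda>z. p2 z + q2 z"], intro conjI ballI continuous_intros)
      (use pq in \<open>auto intro!: derivative_eq_intros simp: fun_eq_iff algebra_simps\<close>)
qed

lemma C1_on_surface_const: "C1_on_surface M \<phi> (\<lambda>x. c)"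
  unfolding C1_on_surface_def
  by (intro allI impI conjI exI[of _ "\<lambda>z. 0"]) auto

lemma C1_on_surface_sum:
  "(\<And>i. i \<in> I \<Longrightarrow> C1_on_surface M \<phi> (q i)) \<Longrightarrow> C1_on_surface M \<phi> (\<lambda>x. \<Sum>i\<in>I. q i x)"
  by (induction I rule: infinite_finite_induct) (auto intro: C1_on_surface_add C1_on_surface_const)

lemma C1_on_surface_divide:
  assumes "C1_on_surface M \<phi> p" "C1_on_surface M \<phi> q" and pos: "\<And>x. x \<in> M \<Longrightarrow> q x > 0"
  shows "C1_on_surface M \<phi> (\<lambda>x. p x / q x)"
  unfolding C1_on_surface_def
proof (intro allI impI conjI)
  fix U h F assume lp: "local_param M \<phi> U h F"
  obtain p1 p2 where p12: "continuous_on (U \<inter> half_plane) p1" "continuous_on (U \<inter> half_plane) p2"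
    "\<And>z. z\<in>U \<inter> open_upper \<Longrightarrow> ((\<lambda>z. p (h z)) has_derivative (\<lambda>v. v $ 1 * p1 z + v $ 2 * p2 z)) (at z)"
    using C1_on_surfaceD(2)[OF assms(1) lp] by blast
  obtain q1 q2 where q12: "continuous_on (U \<inter> half_plane) q1" "continuous_on (U \<inter> half_plane) q2"
    "\<And>z. z\<in>U \<inter> open_upper \<Longrightarrow> ((\<lambda>z. q (h z)) has_derivative (\<lambda>v. v $ 1 * q1 z + v $ 2 * q2 z)) (at z)"
    using C1_on_surfaceD(2)[OF assms(2) lp] by blast
  note pq = p12 q12
  note cc = C1_on_surfaceD(1)[OF assms(1) lp] C1_on_surfaceD(1)[OF assms(2) lp]
  have nz: "q (h z) \<noteq> 0" if "z \<in> U" "z \<in> half_plane" for z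
    using pos[OF local_paramD(6)[OF lp that]] by simp
  show "continuous_on (U \<inter> half_plane) (\<lambda>z. p (h z) / q (h z))"
    using nz cc by (intro continuous_intros) auto
  let ?r = "\<lambda>p1 q1 z. (p1 z * q (h z) - p (h z) * q1 z) / (q (h z) * q (h z))"
  show "\<exists>r1 r2. continuous_on (U \<inter> half_plane) r1 \<and> continuous_on (U \<inter> half_plane) r2 \<and>
        (\<forall>z\<in>U \<inter> open_upper. ((\<lambda>z. p (h z) / q (h z)) has_derivative (\<lambda>v. v $ 1 * r1 z + v $ 2 * r2 z)) (at z))"
  proof (rule exI[of _ "?r p1 q1"], rule exI[of _ "?r p2 q2"], intro conjI ballI)
    show "continuous_on (U \<inter> half_plane) (?r p1 q1)" "continuous_on (U \<inter> half_plane) (?r p2 q2)"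
      using nz pq cc by (intro continuous_intros; auto)+
    fix z assume z: "z \<in> U \<inter> open_upper"
    then have n: "q (h z) \<noteq> 0" using nz open_upper_subset by auto
    show "((\<lambda>z. p (h z) / q (h z)) has_derivative (\<lambda>v. v $ 1 * ?r p1 q1 z + v $ 2 * ?r p2 q2 z)) (at z)"
      by (rule has_derivative_eq_rhs[OF has_derivative_divide'[OF pq(3)[OF z] pq(6)[OF z] n]])
         (use n in \<open>simp add: fun_eq_iff field_simps\<close>)
  qed
qed

text \<open>Squaring removes the corner of the positive part: at 0 the difference quotient is
  bounded by |h|.\<close>

lemma pos_part_square_derivative: "((\<lambda>s::real. (max 0 s)\<^sup>2) has_real_derivative 2 * max 0 s) (at s)"
proof -
  consider "s > 0" | "s < 0" | "s = 0" by linarith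
  then show ?thesis
  proof cases
    case 1
    have "((\<lambda>s::real. s\<^sup>2) has_real_derivative 2 * max 0 s) (at s)"
      using 1 by (auto intro!: derivative_eq_intros)
    then show ?thesis
      by (rule has_field_derivative_transform_within_open[of _ _ _ "{0<..}"]) (use 1 in auto)
  next
    case 2
    have "((\<lambda>s::real. 0) has_real_derivative 2 * max 0 s) (at s)"
      using 2 by (auto intro!: derivative_eq_intros)
    then show ?thesis
      by (rule has_field_derivative_transform_within_open[of _ _ _ "{..<0}"]) (use 2 in auto)
  next
    case 3
    have "((\<lambda>h::real. (max 0 h)\<^sup>2 / h) \<longlongrightarrow> 0) (at 0)"
    proof (rule Lim_null_comparison)
      show "\<forall>\<^sub>F h::real in at 0. norm ((max 0 h)\<^sup>2 / h) \<le> \<bar>h\<bar>"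
        by (auto simp: eventually_at_filter max_def power2_eq_square)
    qed (auto intro!: tendsto_eq_intros)
    then show ?thesis using 3 by (simp add: DERIV_def)
  qed
qed

text \<open>The bump is a C1 function of \<open>\<phi>\<close>, so it is treated in every chart at
  once. Since \<open>\<phi>\<close> may come back near the same point on another sheet, the bump is
  cut off to the chart ball \<open>N0\<close>. The cut does no harm because the function already
  vanishes on \<open>N0\<close> outside a compact part \<open>C0\<close>.\<close>

lemma C1_bump:
  fixes M :: "'p::t2_space set" and \<phi> :: "'p \<Rightarrow> 'a::euclidean_space"
  assumes surf: "compact_immersed_surface M \<phi>" and p: "p \<in> M"
  shows "\<exists>U h F K \<beta> N. local_param M \<phi> U h F \<and> compact K \<and> K \<subseteq> U \<and> C1_on_surface M \<phi> \<beta> \<and>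
     (\<forall>x. \<beta> x \<ge> 0) \<and> (\<forall>x. \<beta> x \<noteq> 0 \<longrightarrow> x \<in> h ` (K \<inter> half_plane)) \<and>
     openin (top_of_set M) N \<and> p \<in> N \<and> (\<forall>x\<in>N. \<beta> x > 0)"
proof -
  obtain U h F where lp: "local_param M \<phi> U h F" and "p \<in> h ` (U \<inter> half_plane)"
    using surf p unfolding compact_immersed_surface_def by metis
  then obtain z0 where z0: "z0 \<in> U" "z0 \<in> half_plane" "p = h z0" by auto
  note lpD = local_paramD[OF lp]
  note sm = smooth_map_onD[OF lpD(1,2)]
  define c where "c = F z0"
  have Fd: "(F has_derivative frechet_derivative F (at z0)) (at z0)"
    using sm(1)[OF z0(1)] frechet_derivative_works by blast
  obtain B where B: "B > 0" "\<And>x. B * norm x \<le> norm (frechet_derivative F (at z0) x)"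
    using linear_inj_bounded_below_pos[OF has_derivative_linear[OF Fd] lpD(3)[OF z0(1)]] by blast
  obtain d where d: "d > 0" "\<And>y. norm (y - z0) < d \<Longrightarrow>
      norm (F y - F z0 - frechet_derivative F (at z0) (y - z0)) \<le> B / 2 * norm (y - z0)"
    using Fd[unfolded has_derivative_at_alt] B(1) by (metis half_gt_zero)
  \<comment> \<open>Injectivity of the derivative makes \<open>F\<close> move away from
    \<open>c\<close> at a linear rate near \<open>z0\<close>.\<close>
  have sep: "B / 2 * norm (y - z0) \<le> norm (F y - c)" if "norm (y - z0) < d" for y
  proof -
    have "B * norm (y - z0) \<le> norm (F y - F z0) + B / 2 * norm (y - z0)"
      using B(2)[of "y - z0"] d(2)[OF that]
        norm_triangle_sub[of "frechet_derivative F (at z0) (y - z0)" "F y - F z0"]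
      by (simp add: norm_minus_commute)
    then show ?thesis by (simp add: c_def)
  qed
  obtain e where e: "e > 0" "cball z0 e \<subseteq> U" using lpD(1) z0(1) open_contains_cball by blast
  define \<rho> where "\<rho> = min e (d / 2)"
  have \<rho>: "\<rho> > 0" "\<rho> < d" "cball z0 \<rho> \<subseteq> U" using e d by (auto simp: \<rho>_def)
  \<comment> \<open>Half of the lower bound B * \<rho> / 2 for |F y - c| on the circle of radius
    \<rho>, so the part \<open>S\<close> of the closed disc where |F y - c| \<le> r stays off that
    circle.\<close>
  define r where "r = B * \<rho> / 4"
  have r: "r > 0" using B \<rho> by (simp add: r_def)
  have far: "r < norm (F y - c)" if "norm (y - z0) = \<rho>" for y
    using sep[of y] that \<rho> B(1) by (simp add: r_def) (smt (verit) mult_pos_pos)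
  define g where "g = (\<lambda>x. (max 0 (r\<^sup>2 - (x - c) \<bullet> (x - c)))\<^sup>2)"
  define g' where "g' = (\<lambda>x v. 2 * max 0 (r\<^sup>2 - (x - c) \<bullet> (x - c)) * (- 2 * ((x - c) \<bullet> v)))"
  have gd: "(g has_derivative g' x) (at x)" for x
  proof -
    have 1: "((\<lambda>x. r\<^sup>2 - (x - c) \<bullet> (x - c)) has_derivative (\<lambda>v. - 2 * ((x - c) \<bullet> v))) (at x)"
      by (auto intro!: derivative_eq_intros simp: inner_commute)
    show ?thesis unfolding g_def g'_def
      by (rule has_derivative_eq_rhs[OF has_derivative_compose[OF 1
          pos_part_square_derivative[unfolded has_field_derivative_def]]]) simp
  qed
  have g0: "g x = 0" "g' x v = 0" if "r \<le> norm (x - c)" for x v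
    using that r power_mono[OF that, of 2] by (auto simp: g_def g'_def power2_norm_eq_inner)
  define N0 where "N0 = h ` (ball z0 \<rho> \<inter> half_plane)"
  define S where "S = cball z0 \<rho> \<inter> (\<lambda>z. norm (F z - c)) -` {..r}"
  define C0 where "C0 = h ` (S \<inter> half_plane)"
  define \<beta> where "\<beta> = (\<lambda>x. if x \<in> N0 then g (\<phi> x) else 0)"
  have bsub: "ball z0 \<rho> \<subseteq> U" using \<rho>(3) ball_subset_cball by blast
  have Sball: "S \<subseteq> ball z0 \<rho>"
  proof
    fix y assume y: "y \<in> S"
    then have "norm (y - z0) \<noteq> \<rho>" using far[of y] by (auto simp: S_def)
    then show "y \<in> ball z0 \<rho>" using y by (auto simp: S_def dist_norm norm_minus_commute)
  qed
  have "U \<inter> ball z0 \<rho> = ball z0 \<rho>" using bsub by blast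
  then have N0: "openin (top_of_set M) N0"
    using local_param_open_image[OF lp, of "ball z0 \<rho>"] by (simp add: N0_def)
  have "closed S" unfolding S_def
    by (intro continuous_closed_preimage continuous_intros continuous_on_subset[OF sm(3) \<rho>(3)]) auto
  then have "compact (S \<inter> half_plane)"
    using closed_half_plane compact_cball[of z0 \<rho>]
    by (metis S_def Int_lower1 closed_Int compact_Int_closed inf.absorb2)
  then have "compact C0" unfolding C0_def
    using Sball bsub by (intro compact_continuous_image continuous_on_subset[OF lpD(7)]) auto
  then have C0: "closed C0" by (rule compact_imp_closed)
  then have C0o: "openin (top_of_set M) (M - C0)" by (metis Diff_eq open_Compl openin_open_Int)
  have CN: "C0 \<subseteq> N0" using Sball by (auto simp: C0_def N0_def)
  have NC: "r \<le> norm (\<phi> x - c)" if "x \<in> N0" "x \<notin> C0" for x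
  proof -
    obtain y where y: "y \<in> ball z0 \<rho>" "y \<in> half_plane" "x = h y" using \<open>x \<in> N0\<close> by (auto simp: N0_def)
    then have "\<phi> x = F y" using lpD(4) bsub by auto
    moreover have "y \<notin> S" using y that by (auto simp: C0_def)
    ultimately show ?thesis using y by (auto simp: S_def)
  qed
  have "C1_on_surface M \<phi> \<beta>"
    unfolding C1_on_surface_def
  proof (intro allI impI conjI)
    fix U' h' F' assume lp': "local_param M \<phi> U' h' F'"
    note lpD' = local_paramD[OF lp']
    note sm' = smooth_map_onD[OF lpD'(1,2)]
    obtain W1 where W1: "open W1" "W1 \<subseteq> U'" "\<And>z. z \<in> U' \<Longrightarrow> z \<in> half_plane \<Longrightarrow> h' z \<in> N0 \<longleftrightarrow> z \<in> W1"
      using local_param_preimage[OF lp' N0] by metis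
    obtain W2 where W2: "open W2" "W2 \<subseteq> U'" "\<And>z. z \<in> U' \<Longrightarrow> z \<in> half_plane \<Longrightarrow> h' z \<in> M - C0 \<longleftrightarrow> z \<in> W2"
      using local_param_preimage[OF lp' C0o] by metis
    have cover: "z \<in> W1 \<or> z \<in> W2" if "z \<in> U'" "z \<in> half_plane" for z
      using W1(3) W2(3) CN lpD'(6) that by blast
    \<comment> \<open>\<open>W1\<close>, where \<open>h'\<close> meets \<open>N0\<close>, and
      \<open>W2\<close>, where it misses \<open>C0\<close>, cover the chart because
      \<open>C0 \<subseteq> N0\<close>. On \<open>W2\<close> the cut-off function is zero, so the
      two local pieces glue.\<close>
    have patch: "continuous_on (U' \<inter> half_plane) (\<lambda>z. if h' z \<in> N0 then k z else 0)"
      if k: "continuous_on U' k" "\<And>z. z \<in> U' \<Longrightarrow> r \<le> norm (F' z - c) \<Longrightarrow> k z = 0" for k :: "real^2 \<Rightarrow> real"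
    proof -
      let ?k = "\<lambda>z. if h' z \<in> N0 then k z else 0"
      have eq: "U' \<inter> half_plane = (U' \<inter> half_plane \<inter> W1) \<union> (U' \<inter> half_plane \<inter> W2)"
        using cover by auto
      have "continuous_on ((U' \<inter> half_plane \<inter> W1) \<union> (U' \<inter> half_plane \<inter> W2)) ?k"
      proof (rule continuous_on_Un_local_open)
        show "openin (top_of_set ((U' \<inter> half_plane \<inter> W1) \<union> (U' \<inter> half_plane \<inter> W2))) (U' \<inter> half_plane \<inter> W1)"
          "openin (top_of_set ((U' \<inter> half_plane \<inter> W1) \<union> (U' \<inter> half_plane \<inter> W2))) (U' \<inter> half_plane \<inter> W2)"
          unfolding eq[symmetric] using W1(1) W2(1) by (auto intro: openin_open_Int)
        show "continuous_on (U' \<inter> half_plane \<inter> W1) ?k"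
          by (rule continuous_on_eq[OF continuous_on_subset[OF k(1)]]) (use W1(3) in auto)
        show "continuous_on (U' \<inter> half_plane \<inter> W2) ?k"
          by (rule continuous_on_eq[OF continuous_on_const[of _ 0]])
             (use W2(3) NC k(2) lpD'(4) in \<open>force\<close>)
      qed
      then show ?thesis using eq by simp
    qed
    have gF: "((\<lambda>z. g (F' z)) has_derivative (\<lambda>v. v $ 1 * g' (F' z) (pderiv_at 1 F' z) + v $ 2 * g' (F' z) (pderiv_at 2 F' z))) (at z)"
      if "z \<in> U'" for z
      by (rule has_derivative_eq_rhs[OF has_derivative_compose[OF has_derivative_pderiv_at[OF sm'(1)[OF that]] gd]])
         (simp add: fun_eq_iff g'_def inner_add_right algebra_simps)
    have cg: "continuous_on U' (\<lambda>z. g (F' z))" "continuous_on U' (\<lambda>z. g' (F' z) (pderiv_at i F' z))" for i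
      unfolding g_def g'_def by (intro continuous_intros sm')+
    show "continuous_on (U' \<inter> half_plane) (\<lambda>z. \<beta> (h' z))"
      by (rule continuous_on_eq[OF patch[OF cg(1) g0(1)]]) (use lpD'(4) in \<open>auto simp: \<beta>_def\<close>)
    define k where "k = (\<lambda>i z. if h' z \<in> N0 then g' (F' z) (pderiv_at i F' z) else 0)"
    show "\<exists>q1 q2. continuous_on (U' \<inter> half_plane) q1 \<and> continuous_on (U' \<inter> half_plane) q2 \<and>
        (\<forall>z\<in>U' \<inter> open_upper. ((\<lambda>z. \<beta> (h' z)) has_derivative (\<lambda>v. v $ 1 * q1 z + v $ 2 * q2 z)) (at z))"
    proof (rule exI[of _ "k 1"], rule exI[of _ "k 2"], intro conjI ballI)
      show "continuous_on (U' \<inter> half_plane) (k 1)" "continuous_on (U' \<inter> half_plane) (k 2)"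
        unfolding k_def by (intro patch cg g0(2); assumption)+
      fix z assume z: "z \<in> U' \<inter> open_upper"
      then have zH: "z \<in> U'" "z \<in> half_plane" using open_upper_subset by auto
      consider "z \<in> W1" | "z \<notin> W1" "z \<in> W2" using cover[OF zH] by blast
      then show "((\<lambda>z. \<beta> (h' z)) has_derivative (\<lambda>v. v $ 1 * k 1 z + v $ 2 * k 2 z)) (at z)"
      proof cases
        case 1
        then have "h' z \<in> N0" using W1(3) zH by auto
        then have kk: "k i z = g' (F' z) (pderiv_at i F' z)" for i by (simp add: k_def)
        show ?thesis unfolding kk
          by (rule has_derivative_transform_within_open[OF gF[OF zH(1)], of "W1 \<inter> open_upper"])
             (use 1 z W1 open_upper_subset lpD'(4) in \<open>auto simp: \<beta>_def subset_iff\<close>)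
      next
        case 2
        then have kk: "k i z = 0" for i using W1(3) zH by (simp add: k_def)
        have z0: "\<beta> (h' x) = 0" if "x \<in> W2 \<inter> open_upper" for x
        proof -
          have x: "x \<in> U'" "x \<in> half_plane" "h' x \<notin> C0"
            using that W2(2,3) open_upper_subset by auto
          then show ?thesis using NC[of "h' x"] g0(1)[of "\<phi> (h' x)"] by (auto simp: \<beta>_def)
        qed
        have "((\<lambda>z. \<beta> (h' z)) has_derivative (\<lambda>v. 0)) (at z)"
          by (rule has_derivative_transform_within_open[OF has_derivative_const[of 0], of "W2 \<inter> open_upper"])
             (use 2 z W2(1) z0 in auto)
        then show ?thesis unfolding kk by simp
      qed
    qed
  qed
  moreover have "\<beta> x \<ge> 0" for x by (simp add: \<beta>_def g_def)
  moreover have "x \<in> h ` (cball z0 \<rho> \<inter> half_plane)" if "\<beta> x \<noteq> 0" for x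
    using that ball_subset_cball[of z0 \<rho>] by (auto simp: \<beta>_def N0_def split: if_splits)
  moreover obtain N1 where "openin (top_of_set M) N1" "p \<in> N1" "\<forall>x\<in>N1. \<beta> x > 0"
  proof -
    define W where "W = {z \<in> U. norm (F z - c) < r} \<inter> ball z0 \<rho>"
    have "open {z \<in> U. norm (F z - c) < r}"
    proof -
      have "open (U \<inter> (\<lambda>z. norm (F z - c)) -` {..<r})"
        by (intro continuous_open_preimage continuous_intros sm(3) lpD(1) open_lessThan)
      moreover have "U \<inter> (\<lambda>z. norm (F z - c)) -` {..<r} = {z \<in> U. norm (F z - c) < r}" by auto
      ultimately show ?thesis by simp
    qed
    then have "open W" unfolding W_def by (rule open_Int) simp
    from local_param_open_image[OF lp this]
    have "openin (top_of_set M) (h ` (U \<inter> W \<inter> half_plane))" .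
    moreover have "p \<in> h ` (U \<inter> W \<inter> half_plane)"
      using z0 \<rho>(1) r by (auto simp: W_def c_def)
    moreover have "\<beta> x > 0" if x: "x \<in> h ` (U \<inter> W \<inter> half_plane)" for x
    proof -
      obtain y where y: "y \<in> U" "y \<in> W" "y \<in> half_plane" "x = h y" using x by auto
      then have xN: "x \<in> N0" by (auto simp: W_def N0_def)
      have "norm (\<phi> x - c) < r" using y lpD(4) by (auto simp: W_def)
      then have "(norm (\<phi> x - c))\<^sup>2 < r\<^sup>2" by (intro power_strict_mono) auto
      then show ?thesis using xN by (simp add: \<beta>_def g_def power2_norm_eq_inner)
    qed
    ultimately show ?thesis using that by blast
  qed
  ultimately show ?thesis
    using lp \<rho>(3) compact_cball[of z0 \<rho>] by metis
qed

text \<open>Finitely many bumps divided by their sum. Their centres index the family, which is why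
  \<open>I\<close> is a set of points of the surface.\<close>

lemma partition_of_unity:
  fixes M :: "'p::t2_space set" and \<phi> :: "'p \<Rightarrow> 'a::euclidean_space"
  assumes surf: "compact_immersed_surface M \<phi>"
  shows "\<exists>(I :: 'p set) U h F K \<psi>. finite I \<and>
     (\<forall>i\<in>I. local_param M \<phi> (U i) (h i) (F i) \<and> compact (K i) \<and> K i \<subseteq> U i \<and> C1_on_surface M \<phi> (\<psi> i) \<and>
        (\<forall>x\<in>M. \<psi> i x \<ge> 0) \<and> (\<forall>x\<in>M. \<psi> i x \<noteq> 0 \<longrightarrow> x \<in> h i ` (K i \<inter> half_plane))) \<and>
     (\<forall>x\<in>M. (\<Sum>i\<in>I. \<psi> i x) = 1)"
proof -
  obtain U h F K \<beta> N where *: "\<forall>p\<in>M. local_param M \<phi> (U p) (h p) (F p) \<and> compact (K p) \<and> K p \<subseteq> U p \<and>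
     C1_on_surface M \<phi> (\<beta> p) \<and> (\<forall>x. \<beta> p x \<ge> 0) \<and> (\<forall>x. \<beta> p x \<noteq> 0 \<longrightarrow> x \<in> h p ` (K p \<inter> half_plane)) \<and>
     openin (top_of_set M) (N p) \<and> p \<in> N p \<and> (\<forall>x\<in>N p. \<beta> p x > 0)"
    using C1_bump[OF surf] by metis
  have "compact M" using surf by (simp add: compact_immersed_surface_def)
  have "\<exists>D\<subseteq>N ` M. finite D \<and> M \<subseteq> \<Union>D"
  proof (rule \<open>compact M\<close>[unfolded compact_eq_openin_cover, rule_format])
    show "(\<forall>c\<in>N ` M. openin (top_of_set M) c) \<and> M \<subseteq> \<Union> (N ` M)" using * by auto
  qed
  then obtain I where I: "I \<subseteq> M" "finite I" "M \<subseteq> (\<Union>p\<in>I. N p)"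
    by (metis finite_subset_image)
  define s where "s = (\<lambda>x. \<Sum>p\<in>I. \<beta> p x)"
  have pos: "s x > 0" if xM: "x \<in> M" for x
  proof -
    obtain p where "p \<in> I" "x \<in> N p" using I(3) xM by blast
    moreover from this have "\<beta> p x > 0" using I(1) * by blast
    ultimately have "\<exists>p\<in>I. \<beta> p x > 0" by blast
    then obtain p where "p \<in> I" "\<beta> p x > 0" by blast
    then show ?thesis unfolding s_def using I * by (intro sum_pos2[of I p]) auto
  qed
  have "C1_on_surface M \<phi> (\<lambda>x. \<beta> p x / s x)" if "p \<in> I" for p
    unfolding s_def using pos[unfolded s_def] * I that
    by (intro C1_on_surface_divide C1_on_surface_sum) auto
  moreover have "(\<Sum>p\<in>I. \<beta> p x / s x) = 1" if "x \<in> M" for x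
    using pos[OF that] unfolding sum_divide_distrib[symmetric] by (simp add: s_def)
  ultimately show ?thesis
    using * I pos less_imp_le[OF pos]
    by - (rule exI[of _ I], rule exI[of _ U], rule exI[of _ h], rule exI[of _ F], rule exI[of _ K],
        rule exI[of _ "\<lambda>p x. \<beta> p x / s x"], auto simp: divide_nonneg_nonneg subset_iff)
qed


subsection \<open>Green's identity in a chart\<close>

definition C1_map :: "(real^2) set \<Rightarrow> (real^2 \<Rightarrow> 'a::euclidean_space) \<Rightarrow> bool" where
  "C1_map U f \<longleftrightarrow> (\<forall>z\<in>U. f differentiable (at z)) \<and> (\<forall>i. continuous_on U (pderiv_at i f))"

lemma C1_mapD:
  assumes "C1_map U f"
  shows "z \<in> U \<Longrightarrow> f differentiable (at z)" "continuous_on U (pderiv_at i f)" "continuous_on U f"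
proof -
  show 1: "z \<in> U \<Longrightarrow> f differentiable (at z)" for z using assms by (auto simp: C1_map_def)
  show "continuous_on U (pderiv_at i f)" using assms by (auto simp: C1_map_def)
  show "continuous_on U f"
    using 1 differentiable_imp_continuous_within by (intro continuous_at_imp_continuous_on) blast
qed

lemma C1_mapI:
  assumes "\<And>z. z \<in> U \<Longrightarrow> (f has_derivative D z) (at z)" "\<And>i. continuous_on U (\<lambda>z. D z (axis i 1))"
  shows "C1_map U f"
  unfolding C1_map_def
proof (intro conjI ballI allI)
  show "f differentiable (at z)" if "z \<in> U" for z using assms(1) that differentiable_def by blast
  show "continuous_on U (pderiv_at i f)" for i
    by (rule continuous_on_eq[OF assms(2)[of i]]) (use assms(1) pderiv_at_eq in metis)
qed

lemma C1_map_bilinear: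
  assumes f: "C1_map U f" and g: "C1_map U g" and b: "bounded_bilinear b"
  shows "C1_map U (\<lambda>z. b (f z) (g z))"
proof (rule C1_mapI)
  interpret bounded_bilinear b by fact
  let ?d = "\<lambda>f z. frechet_derivative f (at z)"
  show "((\<lambda>z. b (f z) (g z)) has_derivative (\<lambda>v. b (f z) (?d g z v) + b (?d f z v) (g z))) (at z)"
    if "z \<in> U" for z
    by (intro FDERIV frechet_derivative_works[THEN iffD1] C1_mapD(1)[OF f] C1_mapD(1)[OF g] that)
  show "continuous_on U (\<lambda>z. b (f z) (?d g z (axis i 1)) + b (?d f z (axis i 1)) (g z))" for i
    using C1_mapD(2)[OF f, of i] C1_mapD(2)[OF g, of i] C1_mapD(3)[OF f] C1_mapD(3)[OF g]
    unfolding pderiv_at_def by (intro continuous_intros continuous_on)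
qed

lemma C1_map_diff:
  assumes f: "C1_map U f" and g: "C1_map U g"
  shows "C1_map U (\<lambda>z. f z - g z)"
proof (rule C1_mapI)
  let ?d = "\<lambda>f z. frechet_derivative f (at z)"
  show "((\<lambda>z. f z - g z) has_derivative (\<lambda>v. ?d f z v - ?d g z v)) (at z)"
    if "z \<in> U" for z
    by (intro has_derivative_diff frechet_derivative_works[THEN iffD1] C1_mapD(1)[OF f] C1_mapD(1)[OF g] that)
  show "continuous_on U (\<lambda>z. ?d f z (axis i 1) - ?d g z (axis i 1))" for i
    using C1_mapD(2)[OF f, of i] C1_mapD(2)[OF g, of i]
    unfolding pderiv_at_def by (intro continuous_intros)
qed

lemma C1_map_inverse_sqrt:
  assumes f: "C1_map U f" and pos: "\<And>z. z \<in> U \<Longrightarrow> f z > 0"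
  shows "C1_map U (\<lambda>z. 1 / sqrt (f z))"
proof (rule C1_mapI)
  let ?d = "\<lambda>z. frechet_derivative f (at z)"
  show "((\<lambda>z. 1 / sqrt (f z)) has_derivative (\<lambda>v. - ?d z v / (2 * f z * sqrt (f z)))) (at z)"
    if z: "z \<in> U" for z
  proof -
    have fd: "(f has_derivative ?d z) (at z)" using C1_mapD(1)[OF f z] frechet_derivative_works by blast
    have "((\<lambda>s. 1 / sqrt s) has_real_derivative - 1 / (2 * f z * sqrt (f z))) (at (f z))"
      using pos[OF z] by (auto intro!: derivative_eq_intros simp: field_simps)
    from has_derivative_compose[OF fd this[unfolded has_field_derivative_def]]
    show ?thesis by (simp add: field_simps)
  qed
  show "continuous_on U (\<lambda>z. - ?d z (axis i 1) / (2 * f z * sqrt (f z)))" for i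
    using C1_mapD(2)[OF f, of i] C1_mapD(3)[OF f] pos unfolding pderiv_at_def
    by (intro continuous_intros) (auto simp: less_imp_neq[symmetric])
qed

lemma C1_map_cofield:
  assumes U: "open U" "smooth_map_on U F" and inj: "\<And>z. z \<in> U \<Longrightarrow> inj (frechet_derivative F (at z))"
  shows "C1_map U (cofield1 F)" "C1_map U (cofield2 F)"
proof -
  note s = smooth_map_onD[OF U]
  have p: "C1_map U (pderiv_at i F)" for i using s by (auto simp: C1_map_def)
  note c = C1_map_bilinear[OF _ _ bounded_bilinear_scaleR] C1_map_bilinear[OF _ _ bounded_bilinear_inner]
    C1_map_bilinear[OF _ _ bounded_bilinear_mult] C1_map_diff C1_map_inverse_sqrt p
  have gram: "(pderiv_at 1 F z \<bullet> pderiv_at 1 F z) * (pderiv_at 2 F z \<bullet> pderiv_at 2 F z) -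
           (pderiv_at 1 F z \<bullet> pderiv_at 2 F z) * (pderiv_at 1 F z \<bullet> pderiv_at 2 F z) > 0" if "z \<in> U" for z
    using gram_pos(3)[OF s(1)[OF that] inj[OF that]] by (simp add: power2_eq_square)
  show "C1_map U (cofield1 F)"
    unfolding cofield1_def[abs_def] area_density_def power2_eq_square by (intro c gram)
  show "C1_map U (cofield2 F)"
    unfolding cofield2_def[abs_def] area_density_def power2_eq_square by (intro c gram)
qed

text \<open>Area density times the inner product of V with the surface gradient of \<open>q\<close>.
  It is the part of the divergence of q V in which \<open>q\<close> is differentiated.\<close>

definition dirichlet_density ::
  "('a::euclidean_space \<Rightarrow> 'a) \<Rightarrow> (real^2 \<Rightarrow> 'p) \<Rightarrow> (real^2 \<Rightarrow> 'a) \<Rightarrow> ('p \<Rightarrow> real) \<Rightarrow> real^2 \<Rightarrow> real" where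
  "dirichlet_density V h F q z =
     pderiv_at 1 (\<lambda>z. q (h z)) z * (V (F z) \<bullet> cofield1 F z) + pderiv_at 2 (\<lambda>z. q (h z)) z * (V (F z) \<bullet> cofield2 F z)"

lemma pderiv_at_C1:
  assumes "(f has_derivative (\<lambda>v. v $ 1 * a + v $ 2 * b)) (at z)"
  shows "pderiv_at 1 f z = a" "pderiv_at 2 f z = b"
  using pderiv_at_eq[OF assms] by (simp_all add: axis_def)

text \<open>The inner product of V with a surface gradient is intrinsic, so only the area density
  produces a determinant. After multiplication by the area densities the claim is a polynomial
  identity in the Jacobian entries \<open>p\<close>, \<open>r\<close>, \<open>s\<close>,
  \<open>u\<close>, the Gram entries of \<open>F'\<close>, and the coordinates of V and of the
  derivative of \<open>q\<close>.\<close>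

lemma dirichlet_density_change:
  fixes F F' :: "real^2 \<Rightarrow> 'a::euclidean_space"
  assumes F: "F differentiable (at z)" "inj (frechet_derivative F (at z))"
    and F': "F' differentiable (at w)" "inj (frechet_derivative F' (at w))"
    and w: "w = t z" and A: "(t has_derivative A) (at z)"
    and FA: "\<And>v. frechet_derivative F' (at w) (A v) = frechet_derivative F (at z) v"
    and FF: "F' w = F z"
    and q: "(\<lambda>z. q (h' z)) differentiable (at w)"
    and S: "open S" "z \<in> S" "\<And>x. x \<in> S \<Longrightarrow> h' (t x) = h x"
  shows "dirichlet_density V h F q z = \<bar>det (matrix A)\<bar> * dirichlet_density V h' F' q w"
proof -
  define a b a' b' where "a = pderiv_at 1 F z" and "b = pderiv_at 2 F z"
    and "a' = pderiv_at 1 F' w" and "b' = pderiv_at 2 F' w"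
  define p r s u where "p = A (axis 1 1) $ 1" and "r = A (axis 1 1) $ 2" and "s = A (axis 2 1) $ 1" and "u = A (axis 2 1) $ 2"
  have det: "det (matrix A) = p * u - r * s"
    by (simp add: det_2 matrix_def p_def r_def s_def u_def mult.commute)
  have ab: "a = p *\<^sub>R a' + r *\<^sub>R b'" "b = s *\<^sub>R a' + u *\<^sub>R b'"
    using FA[of "axis 1 1"] FA[of "axis 2 1"] unfolding frechet_pderiv[OF F'(1)]
    by (simp_all add: a_def b_def pderiv_at_def[of _ F] a'_def b'_def p_def r_def s_def u_def)
  define c1 c2 d1 d2 where "c1 = pderiv_at 1 (\<lambda>z. q (h z)) z" and "c2 = pderiv_at 2 (\<lambda>z. q (h z)) z"
    and "d1 = pderiv_at 1 (\<lambda>z. q (h' z)) w" and "d2 = pderiv_at 2 (\<lambda>z. q (h' z)) w"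
  have "((\<lambda>x. q (h' (t x))) has_derivative (\<lambda>v. (A v) $ 1 *\<^sub>R d1 + (A v) $ 2 *\<^sub>R d2)) (at z)"
    using has_derivative_compose[OF A has_derivative_pderiv_at[OF q, unfolded w]]
    by (simp add: d1_def d2_def w)
  then have "((\<lambda>x. q (h x)) has_derivative (\<lambda>v. (A v) $ 1 *\<^sub>R d1 + (A v) $ 2 *\<^sub>R d2)) (at z)"
    by (rule has_derivative_transform_within_open[OF _ S(1,2)]) (simp add: S(3))
  from pderiv_at_eq[OF this]
  have c: "c1 = p * d1 + r * d2" "c2 = s * d1 + u * d2"
    by (simp_all add: c1_def c2_def p_def r_def s_def u_def)
  define W W' where "W = area_density F z" and "W' = area_density F' w"
  have W: "W > 0" "W' > 0" using area_density_pos F F' by (auto simp: W_def W'_def)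
  have W2: "W * W = (a \<bullet> a) * (b \<bullet> b) - (a \<bullet> b)\<^sup>2" "W' * W' = (a' \<bullet> a') * (b' \<bullet> b') - (a' \<bullet> b')\<^sup>2"
    using area_density_sq F F' by (auto simp: W_def W'_def a_def b_def a'_def b'_def)
  define E G m where "E = a' \<bullet> a'" and "G = b' \<bullet> b'" and "m = a' \<bullet> b'"
  have aa: "a \<bullet> a = p * p * E + 2 * p * r * m + r * r * G" "b \<bullet> b = s * s * E + 2 * s * u * m + u * u * G"
    "a \<bullet> b = p * s * E + (p * u + r * s) * m + r * u * G"
    unfolding ab E_def G_def m_def
    by (simp_all add: inner_add_left inner_add_right inner_commute[of b' a'] distrib_left distrib_right)
  \<comment> \<open>The Gram determinant is multiplied by the square of the Jacobian determinant;
    both area densities being positive, the root may be taken.\<close>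
  have "(\<bar>p * u - r * s\<bar> * W') * (\<bar>p * u - r * s\<bar> * W') = (\<bar>p * u - r * s\<bar> * \<bar>p * u - r * s\<bar>) * (W' * W')"
    by (simp only: mult_ac)
  also have "\<dots> = (p * u - r * s) * (p * u - r * s) * (W' * W')" by (simp only: abs_mult_self_eq)
  also have "\<dots> = W * W"
    unfolding W2 aa E_def[symmetric] G_def[symmetric] m_def[symmetric] power2_eq_square by algebra
  finally have "W * W = (\<bar>p * u - r * s\<bar> * W') * (\<bar>p * u - r * s\<bar> * W')" ..
  then have WW: "W = \<bar>p * u - r * s\<bar> * W'"
    using W by (metis abs_ge_zero less_imp_le mult_nonneg_nonneg power2_eq_imp_eq power2_eq_square)
  define v \<alpha> \<beta> where "v = V (F z)" and "\<alpha> = v \<bullet> a'" and "\<beta> = v \<bullet> b'"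
  have va: "v \<bullet> a = p * \<alpha> + r * \<beta>" "v \<bullet> b = s * \<alpha> + u * \<beta>"
    by (simp_all add: ab \<alpha>_def \<beta>_def inner_add_right)
  have L: "W * dirichlet_density V h F q z = c1 * ((b \<bullet> b) * (v \<bullet> a) - (a \<bullet> b) * (v \<bullet> b)) + c2 * ((a \<bullet> a) * (v \<bullet> b) - (a \<bullet> b) * (v \<bullet> a))"
    using W(1) unfolding dirichlet_density_def cofield1_def cofield2_def W_def[symmetric] c1_def[symmetric] c2_def[symmetric]
      a_def[symmetric] b_def[symmetric] v_def[symmetric]
    by (simp add: inner_diff_right distrib_left mult.left_commute[of W])
  have R: "W' * dirichlet_density V h' F' q w = d1 * (G * \<alpha> - m * \<beta>) + d2 * (E * \<beta> - m * \<alpha>)"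
    using W(2) unfolding dirichlet_density_def cofield1_def cofield2_def W'_def[symmetric] d1_def[symmetric] d2_def[symmetric]
      a'_def[symmetric] b'_def[symmetric] FF v_def[symmetric] E_def G_def m_def \<alpha>_def \<beta>_def
    by (simp add: inner_diff_right distrib_left mult.left_commute[of W'])
  have "W * dirichlet_density V h F q z = (p * u - r * s) * (p * u - r * s) * (W' * dirichlet_density V h' F' q w)"
    unfolding L R va aa c by algebra
  also have "\<dots> = (\<bar>p * u - r * s\<bar> * \<bar>p * u - r * s\<bar>) * (W' * dirichlet_density V h' F' q w)"
    by (simp only: abs_mult_self_eq)
  also have "\<dots> = W * (\<bar>p * u - r * s\<bar> * dirichlet_density V h' F' q w)"
    unfolding WW by (simp only: mult_ac)
  finally show ?thesis using W(1) unfolding det by simp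
qed

lemma continuous_on_unit_inv:
  assumes "\<And>x. x \<in> S \<Longrightarrow> f x \<noteq> c" "continuous_on S f"
  shows "continuous_on S (\<lambda>x. unit_inv c (f x))"
  unfolding unit_inv_def using assms by (intro continuous_intros) auto

context
  fixes M :: "'p::t2_space set" and \<phi> :: "'p \<Rightarrow> 'a::euclidean_space" and c :: 'a
  assumes ball: "\<phi> ` M \<subseteq> cball 0 1" and c: "norm c > 1"
begin

lemma chart_neq_pole:
  assumes "local_param M \<phi> U h F" "z \<in> U" "z \<in> half_plane"
  shows "F z \<noteq> c"
proof -
  have "norm (F z) \<le> 1"
    using local_paramD(4,6)[OF assms(1)] assms(2,3) ball by (metis image_subset_iff mem_cball_0)
  then show ?thesis using c by auto
qed

text \<open>The density involves derivatives of \<open>q o h\<close>, which are controlled only in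
  \<open>open_upper\<close>; \<open>T\<close> is a continuous extension up to the boundary
  line.\<close>

lemma dirichlet_density_C1:
  assumes lp: "local_param M \<phi> U h F" and q: "C1_on_surface M \<phi> q"
  shows "\<exists>T. continuous_on (U \<inter> half_plane) T \<and> (\<forall>z\<in>U \<inter> open_upper. dirichlet_density (unit_inv c) h F q z = T z)"
proof -
  note lpD = local_paramD[OF lp]
  note cf = C1_map_cofield[OF lpD(1-3)]
  obtain q1 q2 where q12: "continuous_on (U \<inter> half_plane) q1" "continuous_on (U \<inter> half_plane) q2"
    "\<And>z. z\<in>U \<inter> open_upper \<Longrightarrow> ((\<lambda>z. q (h z)) has_derivative (\<lambda>v. v $ 1 * q1 z + v $ 2 * q2 z)) (at z)"
    using C1_on_surfaceD(2)[OF q lp] by blast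
  have cF: "continuous_on (U \<inter> half_plane) F"
    by (rule continuous_on_subset[OF smooth_map_onD(3)[OF lpD(1,2)]]) auto
  have cX: "continuous_on (U \<inter> half_plane) (cofield1 F)" "continuous_on (U \<inter> half_plane) (cofield2 F)"
    using cf[THEN C1_mapD(3)] by (auto intro: continuous_on_subset)
  show ?thesis
    by (rule exI[of _ "\<lambda>z. q1 z * (unit_inv c (F z) \<bullet> cofield1 F z) + q2 z * (unit_inv c (F z) \<bullet> cofield2 F z)"])
       (use chart_neq_pole[OF lp] in \<open>auto intro!: continuous_intros q12(1,2) cX cF continuous_on_unit_inv
         simp: dirichlet_density_def pderiv_at_C1[OF q12(3)]\<close>)
qed

text \<open>\<open>half_plane_divergence\<close> is applied to the products of \<open>q\<close> with
  the inner products of V and the two cofields. The relevant partial derivatives add up to the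
  density, plus \<open>q\<close> times the nonnegative divergence of V along the surface, plus a
  term that vanishes because the cofields are divergence free. Dropping the nonnegative term makes
  the flux an upper bound.\<close>

lemma chart_green:
  assumes lp: "local_param M \<phi> U h F" and q: "C1_on_surface M \<phi> q" and q0: "\<And>x. x \<in> M \<Longrightarrow> q x \<ge> 0"
    and K: "compact K" "K \<subseteq> U" and supp: "\<And>x. x \<in> M \<Longrightarrow> q x \<noteq> 0 \<Longrightarrow> x \<in> h ` (K \<inter> half_plane)"
    and H: "\<And>z. z \<in> U \<Longrightarrow> z \<in> half_plane \<Longrightarrow> mean_curvature_vector F z = 0"
    and orth: "\<And>z. z \<in> U \<Longrightarrow> z $ 2 = 0 \<Longrightarrow> outward_unit_conormal F z (F z)"
  shows "(LINT z:U \<inter> open_upper|lborel. dirichlet_density (unit_inv c) h F q z) \<le>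
      (LINT x|lborel. indicator {x. axis_pt x \<in> U} x *
         (q (h (axis_pt x)) * norm (pderiv_at 1 F (axis_pt x)) * (unit_inv c (F (axis_pt x)) \<bullet> F (axis_pt x))))"
proof -
  let ?T = "dirichlet_density (unit_inv c) h F q"
  note lpD = local_paramD[OF lp]
  note sm = smooth_map_onD[OF lpD(1,2)]
  note cf = C1_map_cofield[OF lpD(1-3)]
  obtain q1 q2 where q12: "continuous_on (U \<inter> half_plane) q1" "continuous_on (U \<inter> half_plane) q2"
    "\<And>z. z\<in>U \<inter> open_upper \<Longrightarrow> ((\<lambda>z. q (h z)) has_derivative (\<lambda>v. v $ 1 * q1 z + v $ 2 * q2 z)) (at z)"
    using C1_on_surfaceD(2)[OF q lp] by blast
  note cq = C1_on_surfaceD(1)[OF q lp]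
  have qz: "q (h z) = 0" if "z \<in> U" "z \<in> half_plane" "z \<notin> K" for z
  proof (rule ccontr)
    assume "q (h z) \<noteq> 0"
    then have "h z \<in> h ` (K \<inter> half_plane)" using supp lpD(6) that by blast
    then obtain y where y: "y \<in> K" "y \<in> half_plane" "h y = h z" by auto
    then have "y = z" using inj_onD[OF lpD(8) y(3)] K(2) that by blast
    then show False using y that by simp
  qed
  define V where "V = (\<lambda>z. unit_inv c (F z))"
  define DV where "DV = (\<lambda>z v. (1 / (norm (F z - c))\<^sup>2) *\<^sub>R v
      - (2 * ((F z - c) \<bullet> v) / ((norm (F z - c))\<^sup>2)\<^sup>2) *\<^sub>R (F z - c))"
  have sub: "U \<inter> half_plane \<subseteq> U" by auto
  have nc: "F z \<noteq> c" if "z \<in> U \<inter> half_plane" for z using chart_neq_pole[OF lp] that by auto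
  have cF: "continuous_on (U \<inter> half_plane) F" by (rule continuous_on_subset[OF sm(3) sub])
  have cF1: "continuous_on (U \<inter> half_plane) (pderiv_at i F)" for i by (rule continuous_on_subset[OF sm(4) sub])
  have cV: "continuous_on (U \<inter> half_plane) V" unfolding V_def by (intro continuous_on_unit_inv nc cF)
  have cDV: "continuous_on (U \<inter> half_plane) (\<lambda>z. DV z (pderiv_at i F z))" for i
    unfolding DV_def using nc by (intro continuous_intros cF cF1) auto
  have dV: "(V has_derivative (\<lambda>v. v $ 1 *\<^sub>R DV z (pderiv_at 1 F z) + v $ 2 *\<^sub>R DV z (pderiv_at 2 F z))) (at z)"
    if "z \<in> U \<inter> open_upper" for z
  proof -
    have "F z \<noteq> c" using nc that open_upper_subset by auto
    from has_derivative_compose[OF has_derivative_pderiv_at[OF sm(1)] has_derivative_unit_inv[OF this]] that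
    have "(V has_derivative (\<lambda>v. DV z (v $ 1 *\<^sub>R pderiv_at 1 F z + v $ 2 *\<^sub>R pderiv_at 2 F z))) (at z)"
      by (simp add: V_def DV_def)
    moreover have "linear (DV z)"
      using has_derivative_linear[OF has_derivative_unit_inv[OF \<open>F z \<noteq> c\<close>]] by (simp add: DV_def)
    ultimately show ?thesis by (simp add: linear_add linear_scale)
  qed
  \<comment> \<open>Stated for any C1 field \<open>X\<close>, since it serves
    \<open>cofield1\<close> in the first and \<open>cofield2\<close> in the second
    coordinate.\<close>
  have div: "set_integrable lborel (U \<inter> open_upper) (f i) \<and>
      (i = 1 \<longrightarrow> (LINT z:U \<inter> open_upper|lborel. f i z) = 0) \<and>
      (i = 2 \<longrightarrow> (LINT z:U \<inter> open_upper|lborel. f i z) =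
          - (LINT x|lborel. indicator {x. axis_pt x \<in> U} x * (q (h (axis_pt x)) * (V (axis_pt x) \<bullet> X (axis_pt x)))))"
    if X: "C1_map U X" and f: "f = (\<lambda>j z. (if j = 1 then q1 z else q2 z) * (V z \<bullet> X z) +
        q (h z) * (DV z (pderiv_at j F z) \<bullet> X z + V z \<bullet> pderiv_at j X z))" for X f and i :: 2
  proof -
    have cX: "continuous_on (U \<inter> half_plane) X" "continuous_on (U \<inter> half_plane) (pderiv_at j X)" for j
      using C1_mapD(2,3)[OF X] continuous_on_subset[OF _ sub] by auto
    have cont: "continuous_on (U \<inter> half_plane) (f 1)" "continuous_on (U \<inter> half_plane) (f 2)"
      unfolding f by (simp_all, (intro continuous_intros q12(1,2) cV cX cq cDV)+)
    have cg: "continuous_on (U \<inter> half_plane) (\<lambda>z. q (h z) * (V z \<bullet> X z))"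
      by (intro continuous_intros cV cX cq)
    have der: "((\<lambda>z. q (h z) * (V z \<bullet> X z)) has_derivative (\<lambda>v. v $ 1 * f 1 z + v $ 2 * f 2 z)) (at z)"
      if "z \<in> U" "z \<in> open_upper" for z
    proof -
      have z: "z \<in> U \<inter> open_upper" using that by auto
      have dX: "(X has_derivative (\<lambda>v. v $ 1 *\<^sub>R pderiv_at 1 X z + v $ 2 *\<^sub>R pderiv_at 2 X z)) (at z)"
        by (rule has_derivative_pderiv_at[OF C1_mapD(1)[OF X that(1)]])
      show ?thesis
        by (rule has_derivative_eq_rhs[OF has_derivative_mult[OF q12(3)[OF z] has_derivative_inner[OF dV[OF z] dX]]])
           (simp add: f fun_eq_iff inner_add_left inner_add_right algebra_simps)
    qed
    have van: "q (h z) * (V z \<bullet> X z) = 0" if "z \<in> U" "z \<in> half_plane" "z \<notin> K" for z using qz that by simp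
    note hd = half_plane_divergence[OF lpD(1) K cg cont der van]
    show ?thesis using hd exhaust_2[of i] by auto
  qed
  \<comment> \<open>Only \<open>f 1\<close> and \<open>g 2\<close> enter the divergence: the field
    paired with \<open>cofield1\<close> is differentiated in the first direction, the one paired
    with \<open>cofield2\<close> in the second.\<close>
  define f g where "f = (\<lambda>j z. (if j = (1::2) then q1 z else q2 z) * (V z \<bullet> cofield1 F z) +
        q (h z) * (DV z (pderiv_at j F z) \<bullet> cofield1 F z + V z \<bullet> pderiv_at j (cofield1 F) z))"
    and "g = (\<lambda>j z. (if j = (1::2) then q1 z else q2 z) * (V z \<bullet> cofield2 F z) +
        q (h z) * (DV z (pderiv_at j F z) \<bullet> cofield2 F z + V z \<bullet> pderiv_at j (cofield2 F) z))"
  note d1 = div[OF cf(1) f_def, of 1] and d2 = div[OF cf(2) g_def, of 2]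
  have T: "?T z = q1 z * (V z \<bullet> cofield1 F z) + q2 z * (V z \<bullet> cofield2 F z)" if "z \<in> U \<inter> open_upper" for z
    unfolding dirichlet_density_def pderiv_at_C1[OF q12(3)[OF that]] V_def ..
  have le: "?T z \<le> f 1 z + g 2 z" if z: "z \<in> U \<inter> open_upper" for z
  proof -
    have zH: "z \<in> U" "z \<in> half_plane" using z open_upper_subset by auto
    have "f 1 z + g 2 z = ?T z + q (h z) * (DV z (pderiv_at 1 F z) \<bullet> cofield1 F z + DV z (pderiv_at 2 F z) \<bullet> cofield2 F z)
       + q (h z) * (V z \<bullet> (pderiv_at 1 (cofield1 F) z + pderiv_at 2 (cofield2 F) z))"
      unfolding T[OF z] by (simp add: f_def g_def inner_add_right algebra_simps)
    also have "pderiv_at 1 (cofield1 F) z + pderiv_at 2 (cofield2 F) z = 0"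
      by (rule cofield_divergence_free[OF lpD(1-3) zH(1) H[OF zH]])
    finally show ?thesis
      using surface_divergence_unit_inv_nonneg[OF sm(1)[OF zH(1)] lpD(3)[OF zH(1)] nc] zH q0[OF lpD(6)[OF zH]]
      by (simp add: DV_def)
  qed
  \<comment> \<open>Integrability is proved for the extension \<open>T'\<close>, with which the
    density agrees on \<open>open_upper\<close>.\<close>
  obtain T' where T': "continuous_on (U \<inter> half_plane) T'" "\<forall>z\<in>U \<inter> open_upper. ?T z = T' z"
    using dirichlet_density_C1[OF lp q] by blast
  have T0: "T' z = 0" if z: "z \<in> U" "z \<in> open_upper" "z \<notin> K" for z
  proof -
    have "((\<lambda>z. q (h z)) has_derivative (\<lambda>v. 0)) (at z)"
      by (rule has_derivative_transform_within_open[OF has_derivative_const[of 0], of "(U \<inter> open_upper) - K"])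
         (use z qz open_upper_subset lpD(1) K(1) in \<open>auto intro!: open_Diff compact_imp_closed\<close>)
    then have "pderiv_at i (\<lambda>z. q (h z)) z = 0" for i using pderiv_at_eq by fastforce
    then have "?T z = 0" by (simp add: dirichlet_density_def)
    then show ?thesis using T' z by simp
  qed
  have "set_integrable lborel (U \<inter> open_upper) T'"
    by (rule set_integrable_compact_support[OF lpD(1) K T'(1) T0])
  then have Ti: "set_integrable lborel (U \<inter> open_upper) ?T"
    using set_integrable_cong[OF refl refl, of "U \<inter> open_upper" ?T T' lborel] T'(2) by blast
  have "(LINT z:U \<inter> open_upper|lborel. ?T z) \<le> (LINT z:U \<inter> open_upper|lborel. f 1 z + g 2 z)"
    using d1 d2 le by (intro set_integral_mono Ti set_integral_add) auto
  also have "\<dots> = - (LINT x|lborel. indicator {x. axis_pt x \<in> U} x * (q (h (axis_pt x)) * (V (axis_pt x) \<bullet> cofield2 F (axis_pt x))))"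
    using d1 d2 by (simp add: set_integral_add)
  also have "\<dots> = (LINT x|lborel. indicator {x. axis_pt x \<in> U} x *
         (q (h (axis_pt x)) * norm (pderiv_at 1 F (axis_pt x)) * (unit_inv c (F (axis_pt x)) \<bullet> F (axis_pt x))))"
    unfolding Bochner_Integration.integral_minus[symmetric]
  proof (rule Bochner_Integration.integral_cong[OF refl])
    fix x
    show "- (indicator {x. axis_pt x \<in> U} x * (q (h (axis_pt x)) * (V (axis_pt x) \<bullet> cofield2 F (axis_pt x)))) =
      indicator {x. axis_pt x \<in> U} x * (q (h (axis_pt x)) * norm (pderiv_at 1 F (axis_pt x)) * (unit_inv c (F (axis_pt x)) \<bullet> F (axis_pt x)))"
    proof (cases "axis_pt x \<in> U")
      case True
      \<comment> \<open>The minus sign of the flux through the boundary line cancels against this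
        one.\<close>
      have "cofield2 F (axis_pt x) = - norm (pderiv_at 1 F (axis_pt x)) *\<^sub>R F (axis_pt x)"
        by (rule cofield2_conormal[OF sm(1)[OF True] lpD(3)[OF True] orth[OF True]]) simp
      then show ?thesis by (simp add: V_def)
    qed simp
  qed
  finally show "(LINT z:U \<inter> open_upper|lborel. ?T z) \<le>
      (LINT x|lborel. indicator {x. axis_pt x \<in> U} x *
         (q (h (axis_pt x)) * norm (pderiv_at 1 F (axis_pt x)) * (unit_inv c (F (axis_pt x)) \<bullet> F (axis_pt x))))" .
qed

end


subsection \<open>Green's identity on the surface\<close>

lemma chart_compact_image_closed:
  assumes lp: "local_param M \<phi> U h F" and K: "compact K" "K \<subseteq> U"
  shows "closed (h ` (K \<inter> half_plane))"
proof -
  have "compact (K \<inter> half_plane)" using K closed_half_plane by (simp add: compact_Int_closed)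
  then show ?thesis
    using K by (intro compact_imp_closed compact_continuous_image continuous_on_subset[OF local_paramD(7)[OF lp]]) auto
qed

lemma chart_support:
  assumes lp: "local_param M \<phi> U h F" and K: "K \<subseteq> U"
    and z: "z \<in> U" "z \<in> half_plane" "h z \<in> h ` (K \<inter> half_plane)"
  shows "z \<in> K"
proof -
  obtain y where y: "y \<in> K" "y \<in> half_plane" "h y = h z" using z by auto
  then have "y = z" using inj_onD[OF local_paramD(8)[OF lp] y(3)] K z by blast
  then show ?thesis using y by simp
qed

lemma set_integral_support:
  fixes f :: "'b::euclidean_space \<Rightarrow> real"
  assumes "S \<subseteq> T" "\<And>x. x \<in> T \<Longrightarrow> x \<notin> S \<Longrightarrow> f x = 0"
  shows "set_integrable lborel T f \<longleftrightarrow> set_integrable lborel S f" "(LINT x:T|lborel. f x) = (LINT x:S|lborel. f x)"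
proof -
  have "(\<lambda>x. indicator T x *\<^sub>R f x) = (\<lambda>x. indicator S x *\<^sub>R f x)"
    using assms by (auto simp: fun_eq_iff indicator_def)
  then show "set_integrable lborel T f \<longleftrightarrow> set_integrable lborel S f" "(LINT x:T|lborel. f x) = (LINT x:S|lborel. f x)"
    by (simp_all only: set_integrable_def set_lebesgue_integral_def)
qed

lemma set_integral_finite_sum:
  fixes f :: "'i \<Rightarrow> 'b::euclidean_space \<Rightarrow> real"
  assumes "\<And>i. i \<in> I \<Longrightarrow> set_integrable lborel S (f i)"
  shows "(LINT x:S|lborel. (\<Sum>i\<in>I. f i x)) = (\<Sum>i\<in>I. LINT x:S|lborel. f i x)"
  using assms unfolding set_lebesgue_integral_def set_integrable_def
  by (simp add: sum_distrib_left)

context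
  fixes M :: "'p::t2_space set" and \<phi> :: "'p \<Rightarrow> 'a::euclidean_space" and c :: 'a
  assumes ball: "\<phi> ` M \<subseteq> cball 0 1" and c: "norm c > 1"
begin

text \<open>Since \<open>C\<close> is closed, \<open>q o h\<close> vanishes in a whole neighbourhood
  of \<open>z\<close>, and so do its partial derivatives.\<close>

lemma dirichlet_density_zero:
  assumes lp: "local_param M \<phi> U h F" and C: "closed C" and q: "\<And>x. x \<in> M \<Longrightarrow> q x \<noteq> 0 \<Longrightarrow> x \<in> C"
    and z: "z \<in> U" "z \<in> open_upper" "h z \<notin> C"
  shows "dirichlet_density (unit_inv c) h F q z = 0"
proof -
  have "openin (top_of_set M) (M - C)" using C by (metis Diff_eq open_Compl openin_open_Int)
  then obtain W where W: "open W" "W \<subseteq> U" "\<And>z. z \<in> U \<Longrightarrow> z \<in> half_plane \<Longrightarrow> h z \<in> M - C \<longleftrightarrow> z \<in> W"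
    using local_param_preimage[OF lp] by metis
  have qz: "q (h x) = 0" if "x \<in> W \<inter> open_upper" for x
    using that W(2) W(3)[of x] q[of "h x"] open_upper_subset by auto
  have "z \<in> W" using W(3) z open_upper_subset local_paramD(6)[OF lp] by auto
  then have "((\<lambda>z. q (h z)) has_derivative (\<lambda>v. 0)) (at z)"
    by (intro has_derivative_transform_within_open[OF has_derivative_const[of 0], of "W \<inter> open_upper"])
       (use W z qz in auto)
  then have "pderiv_at i (\<lambda>z. q (h z)) z = 0" for i using pderiv_at_eq by fastforce
  then show ?thesis by (simp add: dirichlet_density_def)
qed

lemma dirichlet_density_weighted:
  assumes lp: "local_param M \<phi> U h F" and p: "C1_on_surface M \<phi> p" and q: "C1_on_surface M \<phi> q"
  shows "continuous_on (U \<inter> open_upper) (\<lambda>z. p (h z) * dirichlet_density (unit_inv c) h F q z)"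
    and "compact K \<Longrightarrow> K \<subseteq> U \<Longrightarrow> (\<And>z. z \<in> U \<Longrightarrow> z \<in> open_upper \<Longrightarrow> z \<notin> K \<Longrightarrow> p (h z) * dirichlet_density (unit_inv c) h F q z = 0)
      \<Longrightarrow> set_integrable lborel (U \<inter> open_upper) (\<lambda>z. p (h z) * dirichlet_density (unit_inv c) h F q z)"
proof -
  obtain T where T: "continuous_on (U \<inter> half_plane) T" "\<And>z. z\<in>U \<inter> open_upper \<Longrightarrow> dirichlet_density (unit_inv c) h F q z = T z"
    using dirichlet_density_C1[OF ball c lp q] by blast
  have cont: "continuous_on (U \<inter> half_plane) (\<lambda>z. p (h z) * T z)"
    by (intro continuous_intros T C1_on_surfaceD(1)[OF p lp])
  show "continuous_on (U \<inter> open_upper) (\<lambda>z. p (h z) * dirichlet_density (unit_inv c) h F q z)"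
    by (rule continuous_on_eq[OF continuous_on_subset[OF cont]]) (use T(2) open_upper_subset in auto)
  assume K: "compact K" "K \<subseteq> U" "\<And>z. z \<in> U \<Longrightarrow> z \<in> open_upper \<Longrightarrow> z \<notin> K \<Longrightarrow> p (h z) * dirichlet_density (unit_inv c) h F q z = 0"
  have "set_integrable lborel (U \<inter> open_upper) (\<lambda>z. p (h z) * T z)"
    by (rule set_integrable_compact_support[OF local_paramD(1)[OF lp] K(1,2) cont]) (use K(3) T(2) in auto)
  then show "set_integrable lborel (U \<inter> open_upper) (\<lambda>z. p (h z) * dirichlet_density (unit_inv c) h F q z)"
    by (rule set_integrable_cong[THEN iffD2, rotated -1]) (use T(2) in auto)
qed

text \<open>Weighted by \<open>p\<close>, the gradient of \<open>q\<close> lives in the overlap of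
  the two charts: \<open>p\<close> confines it to the image of \<open>U'\<close>, and the support of
  \<open>q\<close> to the image of \<open>U\<close>. There the density transforms with the Jacobian
  determinant, and the change of variables applies.\<close>

lemma dirichlet_density_swap:
  assumes lp: "local_param M \<phi> U h F" and lp': "local_param M \<phi> U' h' F'"
    and p: "C1_on_surface M \<phi> p" and q: "C1_on_surface M \<phi> q"
    and K: "compact K" "K \<subseteq> U" and K': "compact K'" "K' \<subseteq> U'"
    and sq: "\<And>x. x \<in> M \<Longrightarrow> q x \<noteq> 0 \<Longrightarrow> x \<in> h ` (K \<inter> half_plane)"
    and sp: "\<And>x. x \<in> M \<Longrightarrow> p x \<noteq> 0 \<Longrightarrow> x \<in> h' ` (K' \<inter> half_plane)"
  shows "(LINT z:U \<inter> open_upper|lborel. p (h z) * dirichlet_density (unit_inv c) h F q z) =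
         (LINT z:U' \<inter> open_upper|lborel. p (h' z) * dirichlet_density (unit_inv c) h' F' q z)"
    and "set_integrable lborel (U \<inter> open_upper) (\<lambda>z. p (h z) * dirichlet_density (unit_inv c) h F q z)"
    and "set_integrable lborel (U' \<inter> open_upper) (\<lambda>z. p (h' z) * dirichlet_density (unit_inv c) h' F' q z)"
proof -
  note lpD = local_paramD[OF lp] and lpD' = local_paramD[OF lp']
  note cl = chart_compact_image_closed[OF lp K] and cl' = chart_compact_image_closed[OF lp' K']
  let ?t = "transition U' h' h"
  define S where "S = {z \<in> U \<inter> open_upper. h z \<in> h' ` (U' \<inter> half_plane)}"
  define S' where "S' = {z \<in> U' \<inter> open_upper. h' z \<in> h ` (U \<inter> half_plane)}"
  note td = transition_derivative[OF lp lp', folded S_def S'_def]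
  have opS': "open S'" using transition_derivative(1)[OF lp' lp] by (simp add: S'_def)
  let ?f = "\<lambda>z. p (h z) * dirichlet_density (unit_inv c) h F q z" and ?g = "\<lambda>z. p (h' z) * dirichlet_density (unit_inv c) h' F' q z"
  show fi: "set_integrable lborel (U \<inter> open_upper) ?f"
  proof (rule dirichlet_density_weighted(2)[OF lp p q K])
    fix z assume z: "z \<in> U" "z \<in> open_upper" "z \<notin> K"
    then have "h z \<notin> h ` (K \<inter> half_plane)" using chart_support[OF lp K(2)] open_upper_subset by blast
    then show "?f z = 0" using dirichlet_density_zero[OF lp cl sq z(1,2)] by simp
  qed
  show gi: "set_integrable lborel (U' \<inter> open_upper) ?g"
  proof (rule dirichlet_density_weighted(2)[OF lp' p q K'])
    fix z assume z: "z \<in> U'" "z \<in> open_upper" "z \<notin> K'"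
    then have "h' z \<notin> h' ` (K' \<inter> half_plane)" using chart_support[OF lp' K'(2)] open_upper_subset by blast
    then show "?g z = 0" using sp lpD'(6) z open_upper_subset by auto
  qed
  have SU: "S \<subseteq> U \<inter> open_upper" and SU': "S' \<subseteq> U' \<inter> open_upper" by (auto simp: S_def S'_def)
  have f0: "?f z = 0" if "z \<in> U \<inter> open_upper" "z \<notin> S" for z
  proof -
    have "h z \<notin> h' ` (K' \<inter> half_plane)" using that K'(2) by (auto simp: S_def)
    then show ?thesis using sp lpD(6) that open_upper_subset by auto
  qed
  have g0: "?g z = 0" if "z \<in> U' \<inter> open_upper" "z \<notin> S'" for z
  proof -
    have "h' z \<notin> h ` (K \<inter> half_plane)" using that K(2) by (auto simp: S'_def)
    then show ?thesis using dirichlet_density_zero[OF lp' cl sq] that by simp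
  qed
  obtain A where A: "\<And>z. z \<in> S \<Longrightarrow> (?t has_derivative A z) (at z)"
    "\<And>z v. z \<in> S \<Longrightarrow> frechet_derivative F' (at (?t z)) (A z v) = frechet_derivative F (at z) v"
    using td(2) by metis
  have "(LINT z:S|lborel. ?f z) = (LINT z:?t ` S|lborel. ?g z)"
  proof (rule set_integral_change_of_variables[OF td(1) _ _ _ _ A(1) td(3)])
    show "continuous_on S ?f"
      by (rule continuous_on_subset[OF dirichlet_density_weighted(1)[OF lp p q] SU])
    show "set_integrable lborel S ?f" using fi set_integral_support(1)[OF SU, of ?f] f0 by blast
    show "open (?t ` S)" using opS' td(4) by simp
    show "continuous_on (?t ` S) ?g" unfolding td(4)
      by (rule continuous_on_subset[OF dirichlet_density_weighted(1)[OF lp' p q] SU'])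
    fix z assume z: "z \<in> S"
    then have zU: "z \<in> U" "z \<in> open_upper" "z \<in> half_plane" "h z \<in> h' ` (U' \<inter> half_plane)"
      using open_upper_subset by (auto simp: S_def)
    have hh: "h' (?t x) = h x" if "x \<in> S" for x using that transition(1)[OF lp'] by (auto simp: S_def)
    note tz = transition[OF lp', of h z, OF zU(4)]
    have tzS: "?t z \<in> S'" using z td(4) by blast
    obtain q1 q2 where "((\<lambda>z. q (h' z)) has_derivative (\<lambda>v. v $ 1 * q1 (?t z) + v $ 2 * q2 (?t z))) (at (?t z))"
      using C1_on_surfaceD(2)[OF q lp'] tzS SU' by blast
    then have qd: "(\<lambda>z. q (h' z)) differentiable (at (?t z))" by (auto simp: differentiable_def)
    have "F' (?t z) = F z" using lpD(4)[OF zU(1,3)] lpD'(4)[OF tz(2,3)] tz(1) by simp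
    from dirichlet_density_change[OF smooth_map_onD(1)[OF lpD(1,2) zU(1)] lpD(3)[OF zU(1)]
        smooth_map_onD(1)[OF lpD'(1,2) tz(2)] lpD'(3)[OF tz(2)] refl A(1)[OF z] A(2)[OF z] this qd td(1) z hh]
    show "?f z = \<bar>det (matrix (A z))\<bar> * ?g (?t z)"
      using tz(1) by simp
  qed
  then show "(LINT z:U \<inter> open_upper|lborel. ?f z) = (LINT z:U' \<inter> open_upper|lborel. ?g z)"
    unfolding td(4)
    using set_integral_support(2)[OF SU, of ?f, OF f0] set_integral_support(2)[OF SU', of ?g, OF g0] by simp
qed

end

locale surface_partition =
  fixes M :: "'p::t2_space set" and \<phi> :: "'p \<Rightarrow> 'a::euclidean_space"
    and I :: "'p set" and U :: "'p \<Rightarrow> (real^2) set" and h :: "'p \<Rightarrow> real^2 \<Rightarrow> 'p"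
    and F :: "'p \<Rightarrow> real^2 \<Rightarrow> 'a" and K :: "'p \<Rightarrow> (real^2) set" and \<psi> :: "'p \<Rightarrow> 'p \<Rightarrow> real"
  assumes fin: "finite I" and lp: "\<And>i. i \<in> I \<Longrightarrow> local_param M \<phi> (U i) (h i) (F i)"
    and K: "\<And>i. i \<in> I \<Longrightarrow> compact (K i)" "\<And>i. i \<in> I \<Longrightarrow> K i \<subseteq> U i"
    and C1: "\<And>i. i \<in> I \<Longrightarrow> C1_on_surface M \<phi> (\<psi> i)"
    and nonneg: "\<And>i x. i \<in> I \<Longrightarrow> x \<in> M \<Longrightarrow> \<psi> i x \<ge> 0"
    and supp: "\<And>i x. i \<in> I \<Longrightarrow> x \<in> M \<Longrightarrow> \<psi> i x \<noteq> 0 \<Longrightarrow> x \<in> h i ` (K i \<inter> half_plane)"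
    and sum1: "\<And>x. x \<in> M \<Longrightarrow> (\<Sum>i\<in>I. \<psi> i x) = 1"
begin

text \<open>Each integral is split by inserting the sum of all \<psi> j, and its (i, j) term is
  moved from chart \<open>i\<close> to chart \<open>j\<close>. In the fixed chart \<open>j\<close>,
  the sum over \<open>i\<close> then contains the derivative of the constant function 1.\<close>

lemma dirichlet_density_total_zero:
  assumes ball: "\<phi> ` M \<subseteq> cball 0 1" and c: "norm c > 1"
  shows "(\<Sum>i\<in>I. LINT z:U i \<inter> open_upper|lborel. dirichlet_density (unit_inv c) (h i) (F i) (\<psi> i) z) = 0"
proof -
  define T where "T = (\<lambda>j i. dirichlet_density (unit_inv c) (h j) (F j) (\<psi> i))"
  have sw: "(LINT z:U i \<inter> open_upper|lborel. \<psi> j (h i z) * T i i z) = (LINT z:U j \<inter> open_upper|lborel. \<psi> j (h j z) * T j i z)"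
    "set_integrable lborel (U i \<inter> open_upper) (\<lambda>z. \<psi> j (h i z) * T i i z)"
    "set_integrable lborel (U j \<inter> open_upper) (\<lambda>z. \<psi> j (h j z) * T j i z)"
    if i: "i \<in> I" and j: "j \<in> I" for i j
    unfolding T_def
    by (rule dirichlet_density_swap[OF ball c lp[OF i] lp[OF j] C1[OF j] C1[OF i]
          K(1)[OF i] K(2)[OF i] K(1)[OF j] K(2)[OF j] supp[OF i] supp[OF j]]; assumption)+
  have M: "h i z \<in> M" if "i \<in> I" "z \<in> U i \<inter> open_upper" for i z
    using local_paramD(6)[OF lp] that open_upper_subset by blast
  have "(\<Sum>i\<in>I. LINT z:U i \<inter> open_upper|lborel. T i i z) =
      (\<Sum>i\<in>I. LINT z:U i \<inter> open_upper|lborel. (\<Sum>j\<in>I. \<psi> j (h i z) * T i i z))"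
  proof (intro sum.cong refl set_lebesgue_integral_cong)
    fix i assume i: "i \<in> I"
    then have "U i \<inter> open_upper \<in> sets borel" using local_paramD(1)[OF lp] by auto
    then show "U i \<inter> open_upper \<in> sets lborel" by simp
    show "\<forall>z. z \<in> U i \<inter> open_upper \<longrightarrow> T i i z = (\<Sum>j\<in>I. \<psi> j (h i z) * T i i z)"
      using M[OF i] sum1 by (simp flip: sum_distrib_right)
  qed
  also have "\<dots> = (\<Sum>i\<in>I. \<Sum>j\<in>I. LINT z:U i \<inter> open_upper|lborel. \<psi> j (h i z) * T i i z)"
    by (intro sum.cong refl set_integral_finite_sum sw(2))
  also have "\<dots> = (\<Sum>i\<in>I. \<Sum>j\<in>I. LINT z:U j \<inter> open_upper|lborel. \<psi> j (h j z) * T j i z)"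
    by (intro sum.cong refl sw(1))
  also have "\<dots> = (\<Sum>j\<in>I. \<Sum>i\<in>I. LINT z:U j \<inter> open_upper|lborel. \<psi> j (h j z) * T j i z)"
    by (rule sum.swap)
  also have "\<dots> = (\<Sum>j\<in>I. LINT z:U j \<inter> open_upper|lborel. (\<Sum>i\<in>I. \<psi> j (h j z) * T j i z))"
    by (intro sum.cong refl set_integral_finite_sum[symmetric] sw(3))
  also have "\<dots> = (\<Sum>j\<in>I. LINT z:U j \<inter> open_upper|lborel. 0)"
  proof (intro sum.cong refl set_lebesgue_integral_cong)
    fix j assume j: "j \<in> I"
    then have "U j \<inter> open_upper \<in> sets borel" using local_paramD(1)[OF lp] by auto
    then show "U j \<inter> open_upper \<in> sets lborel" by simp
    show "\<forall>z. z \<in> U j \<inter> open_upper \<longrightarrow> (\<Sum>i\<in>I. \<psi> j (h j z) * T j i z) = 0"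
    proof (intro allI impI)
      fix z assume z: "z \<in> U j \<inter> open_upper"
      have d: "((\<lambda>z. \<psi> i (h j z)) has_derivative frechet_derivative (\<lambda>z. \<psi> i (h j z)) (at z)) (at z)"
        if i: "i \<in> I" for i
      proof -
        obtain q1 q2 where "((\<lambda>z. \<psi> i (h j z)) has_derivative (\<lambda>v. v $ 1 * q1 z + v $ 2 * q2 z)) (at z)"
          using C1_on_surfaceD(2)[OF C1[OF i] lp[OF j]] z by blast
        then have "(\<lambda>z. \<psi> i (h j z)) differentiable (at z)" by (auto simp: differentiable_def)
        then show ?thesis by (simp add: frechet_derivative_works)
      qed
      have "((\<lambda>z. \<Sum>i\<in>I. \<psi> i (h j z)) has_derivative
          (\<lambda>v. \<Sum>i\<in>I. frechet_derivative (\<lambda>z. \<psi> i (h j z)) (at z) v)) (at z)"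
        by (rule has_derivative_sum[OF d])
      moreover have "((\<lambda>z. \<Sum>i\<in>I. \<psi> i (h j z)) has_derivative (\<lambda>v. 0)) (at z)"
        by (rule has_derivative_transform_within_open[OF has_derivative_const[of 1], of "U j \<inter> open_upper"])
           (use z local_paramD(1)[OF lp[OF j]] M[OF j] sum1 in auto)
      ultimately have "(\<lambda>v. \<Sum>i\<in>I. frechet_derivative (\<lambda>z. \<psi> i (h j z)) (at z) v) = (\<lambda>v. 0)"
        by (rule has_derivative_unique)
      then have p: "(\<Sum>i\<in>I. pderiv_at k (\<lambda>z. \<psi> i (h j z)) z) = 0" for k
        unfolding pderiv_at_def by meson
      show "(\<Sum>i\<in>I. \<psi> j (h j z) * T j i z) = 0"
        unfolding T_def dirichlet_density_def sum_distrib_left[symmetric] sum.distrib sum_distrib_right[symmetric] p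
        by simp
    qed
  qed
  finally show ?thesis by (simp add: T_def)
qed

lemma boundary_in:
  assumes "local_param M \<phi> U' h' F'" "axis_pt x \<in> U'"
  shows "h' (axis_pt x) \<in> surface_boundary M \<phi>"
  using assms unfolding surface_boundary_def by force

lemma boundary_integrable:
  assumes i: "i \<in> I" and g: "continuous_on (U i \<inter> half_plane) g"
  shows "integrable lborel (\<lambda>x. indicator {x. axis_pt x \<in> U i} x * (\<psi> i (h i (axis_pt x)) * g (axis_pt x)))"
proof -
  let ?k = "\<lambda>x. \<psi> i (h i (axis_pt x)) * g (axis_pt x)"
  \<comment> \<open>The boundary parameters inside \<open>K i\<close>: a compact set outside which
    \<psi> i vanishes along the boundary line.\<close>
  define B where "B = (\<lambda>z::real^2. z $ 1) ` (K i \<inter> {z. z $ 2 = 0})"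
  have "closed {z::real^2. z $ 2 = 0}" by (intro closed_Collect_eq continuous_intros)
  then have B: "compact B" unfolding B_def using K[OF i]
    by (intro compact_continuous_image continuous_intros) (simp add: compact_Int_closed)
  have BK: "x \<in> B \<longleftrightarrow> axis_pt x \<in> K i" for x
    unfolding B_def by (auto simp: axis_pt_eq intro!: image_eqI[of _ _ "axis_pt x"])
  have "continuous_on B ?k"
    using BK K(2)[OF i] by (intro continuous_intros continuous_on_compose2[OF g]
        continuous_on_compose2[OF C1_on_surfaceD(1)[OF C1[OF i] lp[OF i]]]) auto
  then have "integrable lborel (\<lambda>x. indicator B x *\<^sub>R ?k x)"
    by (rule borel_integrable_compact[OF B])
  moreover have "indicator B x *\<^sub>R ?k x = indicator {x. axis_pt x \<in> U i} x * ?k x" for x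
  proof (cases "axis_pt x \<in> U i")
    case True
    have "\<psi> i (h i (axis_pt x)) = 0" if "axis_pt x \<notin> K i"
      using chart_support[OF lp[OF i] K(2)[OF i] True] supp[OF i local_paramD(6)[OF lp[OF i] True]] that by auto
    then show ?thesis using True BK by (auto simp: indicator_def)
  next
    case False
    then show ?thesis using BK K(2)[OF i] by (auto simp: indicator_def)
  qed
  ultimately show ?thesis by (simp only:)
qed

text \<open>By \<open>chart_green\<close> and 1 - u = 2 V . x, each gradient term is at most half
  the difference of the two boundary integrals in its chart, and the gradient terms add up to
  zero.\<close>

lemma boundary_integral_inequality:
  assumes ball: "\<phi> ` M \<subseteq> cball 0 1" and c: "norm c > 1" and min: "minimal_surface M \<phi>"
    and sph: "\<phi> ` surface_boundary M \<phi> \<subseteq> sphere 0 1" and orth: "meets_sphere_orthogonally M \<phi>"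
  shows "(\<Sum>i\<in>I. LINT x|lborel. indicator {x. axis_pt x \<in> U i} x *
         (\<psi> i (h i (axis_pt x)) * (((norm c)\<^sup>2 - 1) / (norm (F i (axis_pt x) - c))\<^sup>2 * norm (pderiv_at 1 (F i) (axis_pt x)))))
    \<le> (\<Sum>i\<in>I. LINT x|lborel. indicator {x. axis_pt x \<in> U i} x * (\<psi> i (h i (axis_pt x)) * norm (pderiv_at 1 (F i) (axis_pt x))))"
proof -
  let ?u = "\<lambda>i x. ((norm c)\<^sup>2 - 1) / (norm (F i (axis_pt x) - c))\<^sup>2"
  let ?d = "\<lambda>i x. norm (pderiv_at 1 (F i) (axis_pt x))"
  let ?A = "\<lambda>i. (\<lambda>x. indicator {x. axis_pt x \<in> U i} x * (\<psi> i (h i (axis_pt x)) * ?d i x))"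
  let ?B = "\<lambda>i. (\<lambda>x. indicator {x. axis_pt x \<in> U i} x * (\<psi> i (h i (axis_pt x)) * (?u i x * ?d i x)))"
  have cont: "continuous_on (U i \<inter> half_plane) (F i)" "continuous_on (U i \<inter> half_plane) (pderiv_at j (F i))"
    if "i \<in> I" for i j
    using smooth_map_onD(3,4)[OF local_paramD(1,2)[OF lp[OF that]]] by (auto intro: continuous_on_subset)
  have iA: "integrable lborel (?A i)" if "i \<in> I" for i
    by (rule boundary_integrable[OF that]) (intro continuous_intros cont that)
  have iB: "integrable lborel (?B i)" if "i \<in> I" for i
    by (rule boundary_integrable[OF that, of "\<lambda>z. ((norm c)\<^sup>2 - 1) / (norm (F i z - c))\<^sup>2 * norm (pderiv_at 1 (F i) z)"])
       (use chart_neq_pole[OF ball c lp[OF that]] in \<open>auto intro!: continuous_intros cont that\<close>)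
  have chart: "(LINT z:U i \<inter> open_upper|lborel. dirichlet_density (unit_inv c) (h i) (F i) (\<psi> i) z) \<le>
       ((LINT x|lborel. ?A i x) - (LINT x|lborel. ?B i x)) / 2" if i: "i \<in> I" for i
  proof -
    have "(LINT z:U i \<inter> open_upper|lborel. dirichlet_density (unit_inv c) (h i) (F i) (\<psi> i) z) \<le>
      (LINT x|lborel. indicator {x. axis_pt x \<in> U i} x *
         (\<psi> i (h i (axis_pt x)) * norm (pderiv_at 1 (F i) (axis_pt x)) * (unit_inv c (F i (axis_pt x)) \<bullet> F i (axis_pt x))))"
      using min orth lp[OF i] unfolding minimal_surface_def meets_sphere_orthogonally_def
      by (intro chart_green[OF ball c lp[OF i] C1[OF i] nonneg[OF i] K(1)[OF i] K(2)[OF i] supp[OF i]]) blast+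
    also have "\<dots> = (LINT x|lborel. (?A i x - ?B i x) / 2)"
    proof (rule Bochner_Integration.integral_cong[OF refl])
      fix x
      show "indicator {x. axis_pt x \<in> U i} x *
         (\<psi> i (h i (axis_pt x)) * norm (pderiv_at 1 (F i) (axis_pt x)) * (unit_inv c (F i (axis_pt x)) \<bullet> F i (axis_pt x))) = (?A i x - ?B i x) / 2"
      proof (cases "axis_pt x \<in> U i")
        case True
        have "h i (axis_pt x) \<in> surface_boundary M \<phi>" by (rule boundary_in[OF lp[OF i] True])
        then have "norm (F i (axis_pt x)) = 1"
          using sph local_paramD(4)[OF lp[OF i] True] by (metis axis_pt_in_half_plane image_subset_iff mem_sphere_0)
        note eq = unit_inv_inner_sphere[OF this c]
        have "p * d * ((1 - u) / 2) = (p * d - p * (u * d)) / 2" for p d u :: real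
          by (simp add: algebra_simps)
        then show ?thesis using True unfolding eq by simp
      qed simp
    qed
    also have "\<dots> = ((LINT x|lborel. ?A i x) - (LINT x|lborel. ?B i x)) / 2"
      using iA[OF i] iB[OF i] by simp
    finally show ?thesis .
  qed
  have "0 \<le> (\<Sum>i\<in>I. ((LINT x|lborel. ?A i x) - (LINT x|lborel. ?B i x)) / 2)"
    unfolding dirichlet_density_total_zero[OF ball c, symmetric] by (rule sum_mono) (rule chart)
  then show ?thesis by (simp add: sum_subtractf flip: sum_divide_distrib)
qed

end


subsection \<open>Lengths of curves\<close>

lemma nn_integral_Icc:
  fixes k :: "real \<Rightarrow> real"
  assumes "continuous_on {a..b} k" "\<And>x. k x \<ge> 0"
  shows "(\<integral>\<^sup>+ x. ennreal (k x) * indicator {a..b} x \<partial>lborel) = ennreal (integral {a..b} k)"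
proof -
  have i: "integrable lborel (\<lambda>x. indicator {a..b} x *\<^sub>R k x)"
    using assms by (intro borel_integrable_compact) auto
  have "(\<integral>\<^sup>+ x. ennreal (k x) * indicator {a..b} x \<partial>lborel) = (\<integral>\<^sup>+ x. ennreal (indicator {a..b} x *\<^sub>R k x) \<partial>lborel)"
    by (intro nn_integral_cong) (auto simp: indicator_def)
  also have "\<dots> = ennreal (LINT x|lborel. indicator {a..b} x *\<^sub>R k x)"
    using i assms(2) by (intro nn_integral_eq_integral) auto
  also have "(LINT x|lborel. indicator {a..b} x *\<^sub>R k x) = integral {a..b} k"
    using set_borel_integral_eq_integral(2)[of "{a..b}" k] i
    by (simp add: set_integrable_def set_lebesgue_integral_def)
  finally show ?thesis .
qed

lemma dist_compose_le_integral:
  fixes \<gamma> :: "real \<Rightarrow> 'a::euclidean_space" and J :: "'a \<Rightarrow> 'b::euclidean_space"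
  assumes "a \<le> b" and \<gamma>: "\<And>x. x \<in> {a..b} \<Longrightarrow> (\<gamma> has_vector_derivative \<gamma>' x) (at x)"
    and c: "continuous_on {a..b} \<gamma>'" "continuous_on {a..b} (\<lambda>x. \<rho> (\<gamma> x))"
    and J: "\<And>x. x \<in> {a..b} \<Longrightarrow> (J has_derivative DJ x) (at (\<gamma> x))"
    and n: "\<And>x v. x \<in> {a..b} \<Longrightarrow> norm (DJ x v) \<le> \<rho> (\<gamma> x) * norm v"
  shows "dist (J (\<gamma> a)) (J (\<gamma> b)) \<le> integral {a..b} (\<lambda>x. \<rho> (\<gamma> x) * norm (\<gamma>' x))"
proof -
  have "((\<lambda>x. J (\<gamma> x)) has_vector_derivative DJ x (\<gamma>' x)) (at x within {a..b})" if x: "x \<in> {a..b}" for x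
  proof -
    have "((\<lambda>x. J (\<gamma> x)) has_derivative (\<lambda>h. DJ x (h *\<^sub>R \<gamma>' x))) (at x)"
      by (rule has_derivative_compose[OF \<gamma>[OF x, unfolded has_vector_derivative_def] J[OF x]])
    then have "((\<lambda>x. J (\<gamma> x)) has_vector_derivative DJ x (\<gamma>' x)) (at x)"
      unfolding has_vector_derivative_def
      by (rule has_derivative_eq_rhs) (simp add: fun_eq_iff linear_scale[OF has_derivative_linear[OF J[OF x]]])
    then show ?thesis by (rule has_vector_derivative_at_within)
  qed
  then have i: "((\<lambda>x. DJ x (\<gamma>' x)) has_integral (J (\<gamma> b) - J (\<gamma> a))) {a..b}"
    by (rule fundamental_theorem_of_calculus[OF assms(1)])
  have "norm (integral {a..b} (\<lambda>x. DJ x (\<gamma>' x))) \<le> integral {a..b} (\<lambda>x. \<rho> (\<gamma> x) * norm (\<gamma>' x))"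
  proof (rule integral_norm_bound_integral)
    show "(\<lambda>x. DJ x (\<gamma>' x)) integrable_on {a..b}" using i by blast
    show "(\<lambda>x. \<rho> (\<gamma> x) * norm (\<gamma>' x)) integrable_on {a..b}"
      by (intro integrable_continuous_interval continuous_on_mult continuous_on_norm c)
  qed (use n in auto)
  then show ?thesis using i by (simp add: integral_unique dist_norm norm_minus_commute)
qed

text \<open>Chord and length integral both differ from (y - x) |\<gamma>' x| by at most e (y - x),
  hence the factor 2.\<close>

lemma chord_ge_integral:
  fixes \<gamma> :: "real \<Rightarrow> 'a::euclidean_space"
  assumes "x \<le> y" and \<gamma>: "\<And>t. t \<in> {x..y} \<Longrightarrow> (\<gamma> has_vector_derivative \<gamma>' t) (at t)"
    and c: "continuous_on {x..y} \<gamma>'" and near: "\<And>t. t \<in> {x..y} \<Longrightarrow> norm (\<gamma>' t - \<gamma>' x) \<le> e" 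
  shows "integral {x..y} (\<lambda>t. norm (\<gamma>' t)) - 2 * e * (y - x) \<le> dist (\<gamma> x) (\<gamma> y)"
proof -
  have e: "e \<ge> 0" using near[of x] \<open>x \<le> y\<close> by simp
  have "(\<gamma>' has_integral (\<gamma> y - \<gamma> x)) {x..y}"
    using \<gamma> by (intro fundamental_theorem_of_calculus \<open>x \<le> y\<close>) (auto intro: has_vector_derivative_at_within)
  from has_integral_diff[OF this has_integral_const_real[of "\<gamma>' x" x y]]
  have i: "((\<lambda>t. \<gamma>' t - \<gamma>' x) has_integral (\<gamma> y - \<gamma> x - (y - x) *\<^sub>R \<gamma>' x)) {x..y}"
    using \<open>x \<le> y\<close> by simp
  have "norm (integral {x..y} (\<lambda>t. \<gamma>' t - \<gamma>' x)) \<le> integral {x..y} (\<lambda>t. e)"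
    using i near by (intro integral_norm_bound_integral) (auto simp: has_integral_integrable)
  then have 1: "norm (\<gamma> y - \<gamma> x - (y - x) *\<^sub>R \<gamma>' x) \<le> e * (y - x)"
    using i \<open>x \<le> y\<close> by (simp add: integral_unique mult.commute)
  have "integral {x..y} (\<lambda>t. norm (\<gamma>' t)) \<le> integral {x..y} (\<lambda>t. norm (\<gamma>' x) + e)"
  proof (intro integral_le integrable_continuous_interval continuous_intros c)
    fix t assume "t \<in> {x..y}"
    then show "norm (\<gamma>' t) \<le> norm (\<gamma>' x) + e"
      using near[of t] norm_triangle_sub[of "\<gamma>' t" "\<gamma>' x"] by linarith
  qed
  then have 2: "integral {x..y} (\<lambda>t. norm (\<gamma>' t)) \<le> (y - x) * norm (\<gamma>' x) + e * (y - x)"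
    using \<open>x \<le> y\<close> by (simp add: algebra_simps)
  have "(y - x) * norm (\<gamma>' x) = norm ((y - x) *\<^sub>R \<gamma>' x)" using \<open>x \<le> y\<close> by simp
  also have "\<dots> \<le> norm (\<gamma> y - \<gamma> x) + norm (\<gamma> y - \<gamma> x - (y - x) *\<^sub>R \<gamma>' x)"
    using norm_triangle_sub[of "(y - x) *\<^sub>R \<gamma>' x" "\<gamma> y - \<gamma> x"] by (simp add: norm_minus_commute)
  finally show ?thesis using 1 2 by (simp add: dist_norm norm_minus_commute algebra_simps)
qed

text \<open>On a fine equidistant subdivision, uniform continuity of \<open>\<gamma>'\<close> makes
  each chord almost as long as its piece of the curve. The affine substitution brings the curve to
  the unit interval, on which \<open>path_length\<close> is defined.\<close>

lemma integral_le_path_length: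
  fixes \<gamma> :: "real \<Rightarrow> 'a::euclidean_space"
  assumes ab: "a < b" and \<gamma>: "\<And>x. x \<in> {a..b} \<Longrightarrow> (\<gamma> has_vector_derivative \<gamma>' x) (at x)"
    and c: "continuous_on {a..b} \<gamma>'"
  shows "ennreal (integral {a..b} (\<lambda>x. norm (\<gamma>' x))) \<le> path_length (\<lambda>s. \<gamma> (a + s * (b - a)))"
proof (rule ennreal_le_epsilon)
  fix e :: real assume e: "e > 0"
  \<comment> \<open>The losses in \<open>chord_ge_integral\<close> add up to 2 * \<epsilon> * (b -
    a) = e.\<close>
  define \<epsilon> where "\<epsilon> = e / (b - a) / 2"
  have \<epsilon>: "\<epsilon> > 0" using e ab by (simp add: \<epsilon>_def)
  obtain d where d: "d > 0" "\<And>x y. x \<in> {a..b} \<Longrightarrow> y \<in> {a..b} \<Longrightarrow> dist y x < d \<Longrightarrow> dist (\<gamma>' y) (\<gamma>' x) < \<epsilon>"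
    using compact_uniformly_continuous[OF c] \<epsilon> unfolding uniformly_continuous_on_def by (metis compact_Icc)
  obtain N :: nat where N: "(b - a) / d < real N" using reals_Archimedean2 by blast
  then have N0: "N > 0" using ab d(1) by (metis divide_pos_pos diff_gt_0_iff_gt not_gr_zero of_nat_0 not_less_iff_gr_or_eq order.strict_trans)
  have Nd: "(b - a) / real N < d" using N d(1) N0 by (simp add: field_simps)
  define p where "p = (\<lambda>k::nat. a + (real k / real N) * (b - a))"
  have pm: "p k \<in> {a..b}" if "k \<le> N" for k
  proof -
    have "0 \<le> real k / real N" "real k / real N \<le> 1" using that N0 by auto
    then show ?thesis using ab mult_right_mono[of "real k / real N" 1 "b - a"] by (simp add: p_def)
  qed
  have pstep: "p (Suc k) - p k = (b - a) / real N" for k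
  proof -
    have "p (Suc k) - p k = (real (Suc k) / real N - real k / real N) * (b - a)"
      by (simp add: p_def left_diff_distrib)
    also have "real (Suc k) / real N - real k / real N = 1 / real N"
      by (simp add: diff_divide_distrib[symmetric])
    finally show ?thesis by simp
  qed
  \<comment> \<open>Length as a function of the endpoint, so that the sum over the pieces
    telescopes.\<close>
  define l where "l = (\<lambda>x. integral {a..x} (\<lambda>t. norm (\<gamma>' t)))"
  have int: "(\<lambda>t. norm (\<gamma>' t)) integrable_on {a..b}"
    by (intro integrable_continuous_interval continuous_intros c)
  have step: "l (p (Suc k)) - l (p k) - 2 * \<epsilon> * (p (Suc k) - p k) \<le> dist (\<gamma> (p k)) (\<gamma> (p (Suc k)))"
    if k: "k < N" for k
  proof -
    have m: "p k \<in> {a..b}" "p (Suc k) \<in> {a..b}" using pm k by auto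
    have le: "p k \<le> p (Suc k)" using pstep[of k] ab by (smt (verit) divide_nonneg_nonneg of_nat_0_le_iff)
    have sub: "{p k..p (Suc k)} \<subseteq> {a..b}" using m by auto
    have "l (p (Suc k)) - l (p k) = integral {p k..p (Suc k)} (\<lambda>t. norm (\<gamma>' t))"
      using Henstock_Kurzweil_Integration.integral_combine[of a "p k" "p (Suc k)" "\<lambda>t. norm (\<gamma>' t)"] m le
        integrable_on_subinterval[OF int, of a "p (Suc k)"] by (simp add: l_def)
    moreover have "norm (\<gamma>' t - \<gamma>' (p k)) \<le> \<epsilon>" if "t \<in> {p k..p (Suc k)}" for t
    proof -
      have "dist t (p k) < d" using that pstep[of k] Nd by (auto simp: dist_real_def)
      then show ?thesis using d(2)[of "p k" t] m sub that by (auto simp: dist_norm)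
    qed
    ultimately show ?thesis
      using chord_ge_integral[OF le, of \<gamma> \<gamma>' \<epsilon>] \<gamma> sub continuous_on_subset[OF c sub] by (simp add: subset_iff)
  qed
  have p0: "p 0 = a" "p N = b" using N0 by (auto simp: p_def)
  have "integral {a..b} (\<lambda>x. norm (\<gamma>' x)) - e = l (p N) - l (p 0) - 2 * \<epsilon> * (p N - p 0)"
  proof -
    have half: "2 * (x / 2) = x" for x :: real by simp
    have "2 * \<epsilon> = e / (b - a)" unfolding \<epsilon>_def by (rule half)
    then have "2 * \<epsilon> * (b - a) = e" using ab by simp
    then show ?thesis by (simp add: p0 l_def)
  qed
  also have "\<dots> = (\<Sum>k<N. l (p (Suc k)) - l (p k) - 2 * \<epsilon> * (p (Suc k) - p k))"
    unfolding sum_subtractf[of "\<lambda>k. l (p (Suc k)) - l (p k)"] sum_distrib_left[symmetric]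
      sum_lessThan_telescope[of "\<lambda>k. l (p k)"] sum_lessThan_telescope[of p] ..
  also have "\<dots> \<le> (\<Sum>k<N. dist (\<gamma> (p k)) (\<gamma> (p (Suc k))))"
    by (rule sum_mono) (use step in auto)
  finally have main: "integral {a..b} (\<lambda>x. norm (\<gamma>' x)) \<le> (\<Sum>k<N. dist (\<gamma> (p k)) (\<gamma> (p (Suc k)))) + e" by simp
  define ts where "ts = map (\<lambda>k. real k / real N) [0..<Suc N]"
  have ts: "sorted ts" "set ts \<subseteq> {0..1}" "length ts - 1 = N"
    using N0 by (auto simp: ts_def sorted_map divide_right_mono simp del: upt_Suc intro!: sorted_wrt_mono_rel[OF _ sorted_upt])
  have nth: "ts ! k = real k / real N" if "k \<le> N" for k
    using that by (simp add: ts_def del: upt_Suc)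
  have "ennreal (\<Sum>k<N. dist (\<gamma> (p k)) (\<gamma> (p (Suc k)))) = (\<Sum>k<N. ennreal (dist (\<gamma> (p k)) (\<gamma> (p (Suc k)))))"
    by (simp add: sum_ennreal)
  also have "\<dots> = (\<Sum>i<length ts - 1. ennreal (dist (\<gamma> (a + ts ! i * (b - a))) (\<gamma> (a + ts ! Suc i * (b - a)))))"
    unfolding ts(3) by (intro sum.cong refl) (simp add: nth p_def)
  also have "\<dots> \<le> path_length (\<lambda>s. \<gamma> (a + s * (b - a)))"
    unfolding path_length_def by (rule SUP_upper) (use ts in auto)
  finally have "ennreal (\<Sum>k<N. dist (\<gamma> (p k)) (\<gamma> (p (Suc k)))) \<le> path_length (\<lambda>s. \<gamma> (a + s * (b - a)))" .
  moreover have "ennreal (integral {a..b} (\<lambda>x. norm (\<gamma>' x))) \<le> ennreal (\<Sum>k<N. dist (\<gamma> (p k)) (\<gamma> (p (Suc k)))) + ennreal e"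
    using main e by (subst ennreal_plus[symmetric]) (auto intro!: ennreal_leI sum_nonneg)
  ultimately show "ennreal (integral {a..b} (\<lambda>x. norm (\<gamma>' x))) \<le> path_length (\<lambda>s. \<gamma> (a + s * (b - a))) + ennreal e"
    by (meson add_right_mono order_trans)
qed

section \<open>Transition maps along the boundary line\<close>

lemma chart_boundary_derivative:
  assumes "F differentiable (at (axis_pt x))"
  shows "((\<lambda>x. F (axis_pt x)) has_vector_derivative pderiv_at 1 F (axis_pt x)) (at x)"
proof -
  have "(axis_pt has_derivative (\<lambda>h. h *\<^sub>R axis 1 1)) (at x)"
    unfolding axis_pt_def by (auto intro!: derivative_eq_intros)
  from has_derivative_compose[OF this has_derivative_pderiv_at[OF assms]]
  show ?thesis by (simp add: has_vector_derivative_def axis_def)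
qed

lemma open_axis_pt: "open U \<Longrightarrow> open {x. axis_pt x \<in> U}"
  using open_vimage[of U axis_pt] continuous_on_axis_pt[OF continuous_on_id] by (simp add: vimage_def)

lemma boundary_preimage_open:
  assumes lp: "local_param M \<phi> U h F" and N: "openin (top_of_set M) N"
  shows "open {x. axis_pt x \<in> U \<and> h (axis_pt x) \<in> N}"
proof -
  obtain W where W: "open W" "W \<subseteq> U" "\<And>z. z \<in> U \<Longrightarrow> z \<in> half_plane \<Longrightarrow> h z \<in> N \<longleftrightarrow> z \<in> W"
    using local_param_preimage[OF lp N] by metis
  have "{x. axis_pt x \<in> U \<and> h (axis_pt x) \<in> N} = {x. axis_pt x \<in> W}" using W by auto
  then show ?thesis using open_axis_pt[OF W(1)] by simp
qed

definition boundary_transition ::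
  "(real^2) set \<Rightarrow> (real^2 \<Rightarrow> 'p) \<Rightarrow> (real^2 \<Rightarrow> 'p) \<Rightarrow> real \<Rightarrow> real" where
  "boundary_transition U' h' h x = transition U' h' h (axis_pt x) $ 1"

text \<open>If a boundary point had an interior parameter in the other chart,
  \<open>transition_upper\<close> for the reverse transition would give it an interior parameter in
  the first chart as well.\<close>

lemma boundary_transition_eq:
  assumes lp: "local_param M \<phi> U h F" and lp': "local_param M \<phi> U' h' F'"
    and x: "axis_pt x \<in> U" "h (axis_pt x) \<in> h' ` (U' \<inter> half_plane)"
  shows "transition U' h' h (axis_pt x) = axis_pt (boundary_transition U' h' h x)"
proof -
  define w where "w = transition U' h' h (axis_pt x)"
  note w = transition[OF lp', of h "axis_pt x", OF x(2), folded w_def]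
  have "w \<notin> open_upper"
  proof
    assume up: "w \<in> open_upper"
    have m: "h' w \<in> h ` (U \<inter> half_plane)" using w(1) x(1) by auto
    have "transition U h h' w \<in> open_upper" by (rule transition_upper[OF lp' lp w(2) up m])
    moreover have "transition U h h' w = axis_pt x"
      using the_inv_into_f_f[OF local_paramD(8)[OF lp], of "axis_pt x"] x(1) w(1) by (simp add: transition_def)
    ultimately show False by (simp add: open_upper_def)
  qed
  then have "w $ 2 = 0" using w(3) by (auto simp: open_upper_def half_plane_def)
  then show ?thesis using axis_pt_eq[of w] by (simp add: boundary_transition_def w_def)
qed

lemma boundary_transition:
  assumes lp: "local_param M \<phi> U h F" and lp': "local_param M \<phi> U' h' F'"
    and x: "axis_pt x \<in> U" "h (axis_pt x) \<in> h' ` (U' \<inter> half_plane)"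
  shows "axis_pt (boundary_transition U' h' h x) \<in> U'" "h' (axis_pt (boundary_transition U' h' h x)) = h (axis_pt x)"
    "boundary_transition U h h' (boundary_transition U' h' h x) = x"
proof -
  note w = transition[OF lp', of h "axis_pt x", OF x(2), unfolded boundary_transition_eq[OF assms]]
  show "axis_pt (boundary_transition U' h' h x) \<in> U'" "h' (axis_pt (boundary_transition U' h' h x)) = h (axis_pt x)" using w by auto
  then show "boundary_transition U h h' (boundary_transition U' h' h x) = x"
    using the_inv_into_f_f[OF local_paramD(8)[OF lp], of "axis_pt x"] x(1)
    by (simp add: boundary_transition_def[of U] transition_def)
qed

lemma continuous_bd_transition:
  assumes lp: "local_param M \<phi> U h F" and lp': "local_param M \<phi> U' h' F'"
  shows "continuous_on {x. axis_pt x \<in> U \<and> h (axis_pt x) \<in> h' ` (U' \<inter> half_plane)} (boundary_transition U' h' h)"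
proof -
  have "continuous_on {x. axis_pt x \<in> U \<and> h (axis_pt x) \<in> h' ` (U' \<inter> half_plane)} (\<lambda>x. transition U' h' h (axis_pt x))"
    by (rule continuous_on_compose2[OF transition_continuous[OF lp lp']])
       (auto intro!: continuous_intros)
  then show ?thesis unfolding boundary_transition_def[abs_def] by (intro continuous_intros)
qed

text \<open>The parameters in the overlap form an open subset of the line, so
  \<open>has_derivative_factor\<close> works there with the boundary curves in place of the
  immersions. The relation between the speeds is the chain rule along the boundary.\<close>

lemma boundary_transition_derivative:
  assumes lp: "local_param M \<phi> U h F" and lp': "local_param M \<phi> U' h' F'"
    and x: "axis_pt x \<in> U" "h (axis_pt x) \<in> h' ` (U' \<inter> half_plane)"
  shows "\<exists>d. (boundary_transition U' h' h has_real_derivative d) (at x) \<and>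
    norm (pderiv_at 1 F (axis_pt x)) = \<bar>d\<bar> * norm (pderiv_at 1 F' (axis_pt (boundary_transition U' h' h x)))"
proof -
  let ?t = "boundary_transition U' h' h"
  define S where "S = {x. axis_pt x \<in> U \<and> h (axis_pt x) \<in> h' ` (U' \<inter> half_plane)}"
  have S: "open S" unfolding S_def by (rule boundary_preimage_open[OF lp local_paramD(5)[OF lp']])
  have xS: "x \<in> S" using x by (simp add: S_def)
  note bt = boundary_transition[OF lp lp']
  have FF: "F' (axis_pt (?t y)) = F (axis_pt y)" if "y \<in> S" for y
    using that bt[of y] local_paramD(4)[OF lp, of "axis_pt y"] local_paramD(4)[OF lp', of "axis_pt (?t y)"] by (auto simp: S_def)
  note F = smooth_map_onD(1)[OF local_paramD(1,2)[OF lp] x(1)]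
  note F' = smooth_map_onD(1)[OF local_paramD(1,2)[OF lp'] bt(1)[OF x]]
  let ?a = "pderiv_at 1 F (axis_pt x)" and ?b = "pderiv_at 1 F' (axis_pt (?t x))"
  have dF: "((\<lambda>y. F (axis_pt y)) has_derivative (\<lambda>r. r *\<^sub>R ?a)) (at x)"
    using chart_boundary_derivative[OF F] by (simp add: has_vector_derivative_def)
  have dF': "((\<lambda>y. F' (axis_pt y)) has_derivative (\<lambda>r. r *\<^sub>R ?b)) (at (?t x))"
    using chart_boundary_derivative[OF F'] by (simp add: has_vector_derivative_def)
  have "?b \<noteq> 0" using gram_pos(1)[OF F' local_paramD(3)[OF lp' bt(1)[OF x]]] by auto
  then have inj: "inj (\<lambda>r. r *\<^sub>R ?b)" by (auto simp: inj_on_def)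
  have cont: "continuous (at x within S) ?t"
    using continuous_bd_transition[OF lp lp'] xS unfolding S_def continuous_on_eq_continuous_within by blast
  obtain A where "(?t has_derivative A) (at x within S)"
    using has_derivative_factor[OF dF' inj has_derivative_at_withinI[OF dF] cont FF xS] by blast
  then have A: "(?t has_derivative A) (at x)" using S xS at_within_open by metis
  then obtain d where d: "(?t has_real_derivative d) (at x)"
    using has_derivative_linear[OF A] by (metis differentiable_def real_differentiable_def)
  have "((\<lambda>y. F' (axis_pt (?t y))) has_derivative (\<lambda>r. (d * r) *\<^sub>R ?b)) (at x)"
    using has_derivative_compose[OF d[unfolded has_field_derivative_def] dF'] by simp
  then have "((\<lambda>y. F (axis_pt y)) has_derivative (\<lambda>r. (d * r) *\<^sub>R ?b)) (at x)"
    by (rule has_derivative_transform_within_open[OF _ S xS FF])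
  then have "(\<lambda>r. r *\<^sub>R ?a) = (\<lambda>r. (d * r) *\<^sub>R ?b)" using dF has_derivative_unique by blast
  from fun_cong[OF this, of 1] have "?a = d *\<^sub>R ?b" by simp
  then show ?thesis using d by (intro exI[of _ d]) simp
qed


subsection \<open>Integration along the boundary\<close>

definition weight_on :: "'a::euclidean_space set \<Rightarrow> ('a \<Rightarrow> real) \<Rightarrow> bool" where
  "weight_on S \<rho> \<longleftrightarrow> (\<forall>x. \<rho> x \<ge> 0) \<and> continuous_on S \<rho>"

lemma borel_measurable_if_continuous_open:
  fixes f :: "real \<Rightarrow> real"
  assumes "open S" "continuous_on S f"
  shows "(\<lambda>x. if x \<in> S then f x else 0) \<in> borel_measurable borel"
  using assms by (intro borel_measurable_continuous_on_if) auto

lemma borel_preimage_continuous_open: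
  fixes f :: "real \<Rightarrow> real"
  assumes "open S" "continuous_on S f" "B \<in> sets borel"
  shows "{x \<in> S. f x \<in> B} \<in> sets borel"
proof -
  have [measurable]: "(\<lambda>x. if x \<in> S then f x else 0) \<in> borel_measurable borel"
    by (rule borel_measurable_if_continuous_open[OF assms(1,2)])
  have "(\<lambda>x. if x \<in> S then f x else 0) -` B \<inter> space borel \<in> sets borel"
    using assms(3) by (intro measurable_sets[of _ borel borel]) auto
  moreover have "{x \<in> S. f x \<in> B} = S \<inter> ((\<lambda>x. if x \<in> S then f x else 0) -` B \<inter> space borel)" by auto
  ultimately show ?thesis using assms(1) by auto
qed

lemma weight_on_chart:
  assumes lp: "local_param M \<phi> U h F" and w: "weight_on (\<phi> ` M) \<rho>"
  shows "continuous_on {x. axis_pt x \<in> U} (\<lambda>x. \<rho> (F (axis_pt x)))"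
    and "continuous_on {x. axis_pt x \<in> U} (\<lambda>x. norm (pderiv_at 1 F (axis_pt x)))"
    and "continuous_on {x. axis_pt x \<in> U} (\<lambda>x. F (axis_pt x))"
proof -
  note sm = smooth_map_onD[OF local_paramD(1,2)[OF lp]]
  have b: "continuous_on {x. axis_pt x \<in> U} axis_pt" by (intro continuous_intros)
  show F: "continuous_on {x. axis_pt x \<in> U} (\<lambda>x. F (axis_pt x))"
    by (rule continuous_on_compose2[OF sm(3) b]) auto
  have "F (axis_pt x) \<in> \<phi> ` M" if "axis_pt x \<in> U" for x
    using local_paramD(4,6)[OF lp that] by (metis axis_pt_in_half_plane imageI)
  then show "continuous_on {x. axis_pt x \<in> U} (\<lambda>x. \<rho> (F (axis_pt x)))"
    using w by (intro continuous_on_compose2[OF _ F, of "\<phi> ` M" \<rho>]) (auto simp: weight_on_def)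
  show "continuous_on {x. axis_pt x \<in> U} (\<lambda>x. norm (pderiv_at 1 F (axis_pt x)))"
    by (intro continuous_on_norm continuous_on_compose2[OF sm(4) b]) auto
qed

text \<open>\<open>surface_boundary\<close> refers to some chart around \<open>p\<close>; transition
  maps preserve the boundary line, so every chart around \<open>p\<close> shows it there.\<close>

lemma boundary_point_in_chart:
  assumes lp: "local_param M \<phi> U h F" and p: "p \<in> surface_boundary M \<phi>" "p \<in> h ` (U \<inter> half_plane)"
  obtains x where "axis_pt x \<in> U" "p = h (axis_pt x)"
proof -
  obtain U' h' F' z' where lp': "local_param M \<phi> U' h' F'" and z': "z' \<in> U'" "z' $ 2 = 0" "p = h' z'"
    using p(1) unfolding surface_boundary_def by blast
  define x' where "x' = z' $ 1"
  have x': "axis_pt x' = z'" using axis_pt_eq[OF z'(2)] by (simp add: x'_def)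
  note bt = boundary_transition[OF lp' lp, of x', unfolded x', OF z'(1)]
  have "h' z' \<in> h ` (U \<inter> half_plane)" using p(2) z'(3) by simp
  then show thesis using bt(1,2) z'(3) that by metis
qed

context surface_partition
begin

definition local_weight :: "('a \<Rightarrow> real) \<Rightarrow> 'p \<Rightarrow> real \<Rightarrow> real" where
  "local_weight \<rho> i x = (if x \<in> {x. axis_pt x \<in> U i} then
     \<psi> i (h i (axis_pt x)) * (\<rho> (F i (axis_pt x)) * norm (pderiv_at 1 (F i) (axis_pt x))) else 0)"

definition trace :: "'p \<Rightarrow> 'p set \<Rightarrow> real set" where
  "trace i A = {x. axis_pt x \<in> U i \<and> h i (axis_pt x) \<in> A}"

text \<open>Integration with respect to arc length; independent of the partition of unity by
  \<open>boundary_integral_chart\<close>.\<close>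

definition boundary_integral :: "('a \<Rightarrow> real) \<Rightarrow> 'p set \<Rightarrow> ennreal" where
  "boundary_integral \<rho> A = (\<Sum>i\<in>I. \<integral>\<^sup>+ x. ennreal (local_weight \<rho> i x) * indicator (trace i A) x \<partial>lborel)"

text \<open>Stands in for Borel sets of \<open>M\<close>, with measurability tested in the charts of
  the partition. Closed sets qualify, and as differences of closed sets so do half-open
  subarcs.\<close>

definition trace_borel :: "'p set \<Rightarrow> bool" where
  "trace_borel A \<longleftrightarrow> (\<forall>i\<in>I. trace i A \<in> sets borel)"

lemma psi_continuous_chart:
  assumes "i \<in> I" "local_param M \<phi> U' h' F'"
  shows "continuous_on {x. axis_pt x \<in> U'} (\<lambda>x. \<psi> i (h' (axis_pt x)))"
  by (rule continuous_on_compose2[OF C1_on_surfaceD(1)[OF C1[OF assms(1)] assms(2)]])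
     (auto intro!: continuous_intros)

lemma local_weight_measurable:
  assumes "i \<in> I" "weight_on (\<phi> ` M) \<rho>"
  shows "local_weight \<rho> i \<in> borel_measurable borel"
  unfolding local_weight_def[abs_def]
  using local_paramD(1)[OF lp[OF assms(1)]]
  by (intro borel_measurable_if_continuous_open open_axis_pt continuous_on_mult
      psi_continuous_chart[OF assms(1) lp[OF assms(1)]] weight_on_chart(1,2)[OF lp[OF assms(1)] assms(2)])

lemma local_weight_nonneg:
  assumes "i \<in> I" "weight_on (\<phi> ` M) \<rho>"
  shows "local_weight \<rho> i x \<ge> 0"
  using nonneg[OF assms(1)] local_paramD(6)[OF lp[OF assms(1)]] assms(2)
  by (auto simp: local_weight_def weight_on_def)

lemma trace_borel_closed: "closed A \<Longrightarrow> trace_borel A"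
  unfolding trace_borel_def
proof
  fix i assume i: "i \<in> I" and A: "closed A"
  have "openin (top_of_set M) (M - A)" using A by (metis Diff_eq open_Compl openin_open_Int)
  from boundary_preimage_open[OF lp[OF i] this]
  have o: "open {x. axis_pt x \<in> U i \<and> h i (axis_pt x) \<in> M - A}" .
  have "trace i A = {x. axis_pt x \<in> U i} - {x. axis_pt x \<in> U i \<and> h i (axis_pt x) \<in> M - A}"
    using local_paramD(6)[OF lp[OF i]] by (auto simp: trace_def)
  then show "trace i A \<in> sets borel"
    using o open_axis_pt[OF local_paramD(1)[OF lp[OF i]]] by auto
qed

lemma trace_borel_Diff: "trace_borel A \<Longrightarrow> trace_borel B \<Longrightarrow> trace_borel (A - B)"
  unfolding trace_borel_def
proof
  fix i assume "\<forall>i\<in>I. trace i A \<in> sets borel" "\<forall>i\<in>I. trace i B \<in> sets borel" "i \<in> I"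
  then have "trace i A - trace i B \<in> sets borel" by blast
  moreover have "trace i (A - B) = trace i A - trace i B" by (auto simp: trace_def)
  ultimately show "trace i (A - B) \<in> sets borel" by simp
qed

lemma boundary_integral_mono: "A \<subseteq> B \<Longrightarrow> boundary_integral \<rho> A \<le> boundary_integral \<rho> B"
  unfolding boundary_integral_def
  by (intro sum_mono nn_integral_mono mult_left_mono) (auto simp: trace_def indicator_def)

lemma boundary_integral_Un:
  assumes "trace_borel A" "trace_borel B" "A \<inter> B = {}" and w: "weight_on (\<phi> ` M) \<rho>"
  shows "boundary_integral \<rho> (A \<union> B) = boundary_integral \<rho> A + boundary_integral \<rho> B"
  unfolding boundary_integral_def sum.distrib[symmetric]
proof (intro sum.cong refl)
  fix i assume i: "i \<in> I"
  note [measurable] = local_weight_measurable[OF i w]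
  have [measurable]: "trace i A \<in> sets borel" "trace i B \<in> sets borel" using assms i by (auto simp: trace_borel_def)
  have "ennreal (local_weight \<rho> i x) * indicator (trace i (A \<union> B)) x =
     ennreal (local_weight \<rho> i x) * indicator (trace i A) x + ennreal (local_weight \<rho> i x) * indicator (trace i B) x" for x
    using assms(3) by (auto simp: trace_def indicator_def)
  then show "(\<integral>\<^sup>+ x. ennreal (local_weight \<rho> i x) * indicator (trace i (A \<union> B)) x \<partial>lborel) =
     (\<integral>\<^sup>+ x. ennreal (local_weight \<rho> i x) * indicator (trace i A) x \<partial>lborel) +
     (\<integral>\<^sup>+ x. ennreal (local_weight \<rho> i x) * indicator (trace i B) x \<partial>lborel)"
    by (simp add: nn_integral_add)
qed

lemma boundary_integral_disjoint:
  assumes "finite G" "\<And>g. g \<in> G \<Longrightarrow> trace_borel (A g)" "pairwise (\<lambda>g g'. disjnt (A g) (A g')) G"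
    and w: "weight_on (\<phi> ` M) \<rho>"
  shows "trace_borel (\<Union>g\<in>G. A g) \<and> boundary_integral \<rho> (\<Union>g\<in>G. A g) = (\<Sum>g\<in>G. boundary_integral \<rho> (A g))"
  using assms(1-3)
proof (induction G)
  case empty
  show ?case by (simp add: trace_borel_def trace_def boundary_integral_def)
next
  case (insert g G)
  then have IH: "trace_borel (\<Union>g\<in>G. A g)" "boundary_integral \<rho> (\<Union>g\<in>G. A g) = (\<Sum>g\<in>G. boundary_integral \<rho> (A g))"
    by (auto simp: pairwise_insert)
  have d: "A g \<inter> (\<Union>g\<in>G. A g) = {}"
    using insert.prems(2) insert.hyps(2) by (fastforce simp: pairwise_insert disjnt_def)
  have tb: "trace_borel (A g)" using insert.prems by auto
  have "trace i (A g \<union> (\<Union>g\<in>G. A g)) = trace i (A g) \<union> trace i (\<Union>g\<in>G. A g)" for i by (auto simp: trace_def)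
  then have "trace_borel (A g \<union> (\<Union>g\<in>G. A g))" using tb IH(1) by (simp add: trace_borel_def)
  then show ?case using boundary_integral_Un[OF tb IH(1) d w] IH(2) insert.hyps by simp
qed

text \<open>The summand of chart \<open>i\<close> is carried to the chart \<open>h'\<close> by the
  boundary transition, where the weights \<psi> i add up to 1. So arc length integrals may be
  computed in any single chart that contains the set.\<close>

lemma boundary_integral_chart:
  assumes lp': "local_param M \<phi> U' h' F'" and B: "B \<in> sets borel" "B \<subseteq> {x. axis_pt x \<in> U'}"
    and w: "weight_on (\<phi> ` M) \<rho>"
  shows "boundary_integral \<rho> ((\<lambda>x. h' (axis_pt x)) ` B) =
    (\<integral>\<^sup>+ x. ennreal (\<rho> (F' (axis_pt x)) * norm (pderiv_at 1 F' (axis_pt x))) * indicator B x \<partial>lborel)"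
proof -
  let ?A = "(\<lambda>x. h' (axis_pt x)) ` B"
  define f where "f = (\<lambda>i x. if x \<in> {x. axis_pt x \<in> U'} then
     \<psi> i (h' (axis_pt x)) * (\<rho> (F' (axis_pt x)) * norm (pderiv_at 1 F' (axis_pt x))) else 0)"
  note [measurable] = B(1)
  have fm [measurable]: "f i \<in> borel_measurable borel" if "i \<in> I" for i
    unfolding f_def using local_paramD(1)[OF lp']
    by (intro borel_measurable_if_continuous_open open_axis_pt continuous_on_mult
        psi_continuous_chart[OF that lp'] weight_on_chart(1,2)[OF lp' w])
  have f0: "f i x \<ge> 0" if "i \<in> I" for i x
    using nonneg[OF that] local_paramD(6)[OF lp'] w by (auto simp: f_def weight_on_def)
  have loc: "(\<integral>\<^sup>+ x. ennreal (local_weight \<rho> i x) * indicator (trace i ?A) x \<partial>lborel) =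
      (\<integral>\<^sup>+ x. ennreal (f i x) * indicator B x \<partial>lborel)" if i: "i \<in> I" for i
  proof -
    define O1 where "O1 = {x. axis_pt x \<in> U' \<and> h' (axis_pt x) \<in> h i ` (U i \<inter> half_plane)}"
    define O2 where "O2 = {x. axis_pt x \<in> U i \<and> h i (axis_pt x) \<in> h' ` (U' \<inter> half_plane)}"
    have op: "open O1" "open O2" unfolding O1_def O2_def
      using boundary_preimage_open[OF lp' local_paramD(5)[OF lp[OF i]]]
        boundary_preimage_open[OF lp[OF i] local_paramD(5)[OF lp']] by auto
    let ?t = "boundary_transition (U i) (h i) h'" and ?s = "boundary_transition U' h' (h i)"
    note t = boundary_transition[OF lp' lp[OF i]] and s = boundary_transition[OF lp[OF i] lp']
    \<comment> \<open>The part of \<open>B\<close> lying in chart \<open>i\<close>; the transition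
      maps it onto the trace of the set in that chart.\<close>
    define S where "S = B \<inter> O1"
    have S: "S \<in> sets borel" using B op by (auto simp: S_def)
    have tr: "trace i ?A = {x \<in> O2. ?s x \<in> B}"
    proof (intro set_eqI iffI)
      fix y assume "y \<in> trace i ?A"
      then obtain x where x: "axis_pt y \<in> U i" "x \<in> B" "h i (axis_pt y) = h' (axis_pt x)" by (auto simp: trace_def)
      then have xU: "axis_pt x \<in> U'" using B by auto
      have yO: "y \<in> O2" using x xU by (auto simp: O2_def)
      have "h' (axis_pt (?s y)) = h' (axis_pt x)" "axis_pt (?s y) \<in> U'" using s[of y] yO x by (auto simp: O2_def)
      then have "axis_pt (?s y) = axis_pt x" using inj_onD[OF local_paramD(8)[OF lp']] xU by auto
      then have "?s y = x" by (metis axis_pt_nth(1))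
      then show "y \<in> {x \<in> O2. ?s x \<in> B}" using yO x by auto
    next
      fix y assume y: "y \<in> {x \<in> O2. ?s x \<in> B}"
      then have "h i (axis_pt y) = h' (axis_pt (?s y))" using s[of y] by (auto simp: O2_def)
      then show "y \<in> trace i ?A" using y by (auto simp: trace_def O2_def)
    qed
    have tS: "?t ` S = trace i ?A"
      unfolding tr
    proof (intro set_eqI iffI)
      fix y assume "y \<in> ?t ` S"
      then obtain x where x: "x \<in> B" "x \<in> O1" "y = ?t x" by (auto simp: S_def)
      then have xx: "axis_pt x \<in> U'" "h' (axis_pt x) \<in> h i ` (U i \<inter> half_plane)" by (auto simp: O1_def)
      have "h i (axis_pt y) \<in> h' ` (U' \<inter> half_plane)" using t(2)[OF xx] xx(1) x(3) by auto
      then show "y \<in> {x \<in> O2. ?s x \<in> B}" using t(1,3)[OF xx] x by (auto simp: O2_def)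
    next
      fix y assume "y \<in> {x \<in> O2. ?s x \<in> B}"
      then have y: "axis_pt y \<in> U i" "h i (axis_pt y) \<in> h' ` (U' \<inter> half_plane)" "?s y \<in> B" by (auto simp: O2_def)
      have "?s y \<in> O1" using s(1,2)[OF y(1,2)] y(1) by (auto simp: O1_def)
      moreover have "?t (?s y) = y" using s(3)[OF y(1,2)] .
      ultimately show "y \<in> ?t ` S" using y(3) by (metis S_def IntI image_eqI)
    qed
    have tb: "?t ` S \<in> sets borel" unfolding tS tr
      using continuous_bd_transition[OF lp[OF i] lp'] op B(1)
      by (intro borel_preimage_continuous_open) (auto simp: O2_def)
    have xS: "axis_pt x \<in> U'" "h' (axis_pt x) \<in> h i ` (U i \<inter> half_plane)" if "x \<in> S" for x
      using that by (auto simp: S_def O1_def)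
    obtain d where d: "\<And>x. x \<in> S \<Longrightarrow> (?t has_real_derivative d x) (at x)"
      "\<And>x. x \<in> S \<Longrightarrow> norm (pderiv_at 1 F' (axis_pt x)) = \<bar>d x\<bar> * norm (pderiv_at 1 (F i) (axis_pt (?t x)))"
      using boundary_transition_derivative[OF lp' lp[OF i]] xS by metis
    have inj: "inj_on ?t S" using t(3) xS by (metis inj_on_inverseI)
    have "(\<integral>\<^sup>+ x. ennreal (f i x) * indicator S x \<partial>lborel) =
        (\<integral>\<^sup>+ x. ennreal (local_weight \<rho> i x) * indicator (?t ` S) x \<partial>lborel)"
    proof (rule nn_integral_change_of_variables_real[OF S tb fm[OF i] local_weight_measurable[OF i w] f0[OF i]
          local_weight_nonneg[OF i w] d(1) inj])
      fix x assume x: "x \<in> S"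
      note tx = t(1,2)[OF xS[OF x]]
      have "F' (axis_pt x) = F i (axis_pt (?t x))"
        using local_paramD(4)[OF lp' xS(1)[OF x]] local_paramD(4)[OF lp[OF i] tx(1)] tx(2) by simp
      then show "f i x = \<bar>d x\<bar> * local_weight \<rho> i (?t x)"
        using d(2)[OF x] tx xS(1)[OF x] by (simp add: f_def local_weight_def)
    qed
    also have "(\<integral>\<^sup>+ x. ennreal (f i x) * indicator S x \<partial>lborel) = (\<integral>\<^sup>+ x. ennreal (f i x) * indicator B x \<partial>lborel)"
    proof (intro nn_integral_cong)
      fix x
      \<comment> \<open>Outside the overlap the support condition makes \<psi> i zero, so
        \<open>S\<close> may be replaced by \<open>B\<close>.\<close>
      have "f i x = 0" if "x \<in> B" "x \<notin> O1"
        using that B(2) supp[OF i local_paramD(6)[OF lp', of "axis_pt x"]] K(2)[OF i] by (auto simp: f_def O1_def)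
      then show "ennreal (f i x) * indicator S x = ennreal (f i x) * indicator B x"
        by (auto simp: S_def indicator_def)
    qed
    finally show ?thesis unfolding tS by simp
  qed
  have "boundary_integral \<rho> ?A = (\<Sum>i\<in>I. \<integral>\<^sup>+ x. ennreal (f i x) * indicator B x \<partial>lborel)"
    unfolding boundary_integral_def by (intro sum.cong refl loc)
  also have "\<dots> = (\<integral>\<^sup>+ x. (\<Sum>i\<in>I. ennreal (f i x) * indicator B x) \<partial>lborel)"
    by (rule nn_integral_sum[symmetric]) simp
  also have "\<dots> = (\<integral>\<^sup>+ x. ennreal (\<rho> (F' (axis_pt x)) * norm (pderiv_at 1 F' (axis_pt x))) * indicator B x \<partial>lborel)"
  proof (intro nn_integral_cong)
    fix x
    show "(\<Sum>i\<in>I. ennreal (f i x) * indicator B x) = ennreal (\<rho> (F' (axis_pt x)) * norm (pderiv_at 1 F' (axis_pt x))) * indicator B x"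
    proof (cases "x \<in> B")
      case True
      then have U: "axis_pt x \<in> U'" using B by auto
      have "(\<Sum>i\<in>I. ennreal (f i x) * indicator B x) = ennreal (\<Sum>i\<in>I. f i x)"
        using True f0 by (simp add: sum_ennreal)
      also have "(\<Sum>i\<in>I. f i x) = \<rho> (F' (axis_pt x)) * norm (pderiv_at 1 F' (axis_pt x))"
        using U sum1[OF local_paramD(6)[OF lp' U]] by (simp add: f_def flip: sum_distrib_right)
      finally show ?thesis using True by simp
    qed simp
  qed
  finally show ?thesis .
qed

end

section \<open>Filling the boundary with disjoint segments\<close>

lemma nn_integral_indicator_mono:
  "A \<subseteq> B \<Longrightarrow> (\<integral>\<^sup>+ x. w x * indicator A x \<partial>M) \<le> (\<integral>\<^sup>+ x. w x * indicator B x \<partial>M)"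
  by (intro nn_integral_mono mult_left_mono) (auto simp: indicator_def)

lemma nn_integral_negligible:
  fixes w :: "real \<Rightarrow> ennreal"
  assumes "N \<in> sets borel" "negligible N"
  shows "(\<integral>\<^sup>+ x. w x * indicator N x \<partial>lborel) = 0"
proof -
  have "emeasure lebesgue N = 0" using assms(2) by (auto simp: negligible_iff_null_sets null_sets_def)
  then have "emeasure lborel N = 0" using assms(1) by simp
  then have "N \<in> null_sets lborel" using assms(1) by auto
  then show ?thesis by (rule nn_integral_null_set)
qed

text \<open>The Vitali covering theorem gives countably many disjoint closed intervals that fill
  \<open>X\<close> up to a null set. The weight has finite total integral, so continuity from above
  of its measure \<open>\<nu>\<close> leaves at most \<open>e\<close> after finitely many of
  them.\<close>

lemma finite_disjoint_intervals:
  fixes w :: "real \<Rightarrow> ennreal"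
  assumes X: "open X" and w[measurable]: "w \<in> borel_measurable borel" and fin: "(\<integral>\<^sup>+ x. w x \<partial>lborel) < \<infinity>" and e: "e > 0"
  shows "\<exists>C :: (real \<times> real) set. finite C \<and> (\<forall>p\<in>C. snd p > 0 \<and> cball (fst p) (snd p) \<subseteq> X) \<and>
    pairwise (\<lambda>p q. disjnt (cball (fst p) (snd p)) (cball (fst q) (snd q))) C \<and>
    (\<integral>\<^sup>+ x. w x * indicator (X - (\<Union>p\<in>C. cball (fst p) (snd p))) x \<partial>lborel) \<le> ennreal e"
proof -
  define K where "K = {p :: real \<times> real. snd p > 0 \<and> cball (fst p) (snd p) \<subseteq> X}"
  have cov: "\<exists>p. p \<in> K \<and> x \<in> cball (fst p) (snd p) \<and> snd p < d" if "x \<in> X" "d > 0" for x d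
  proof -
    obtain r where r: "r > 0" "cball x r \<subseteq> X" using X \<open>x \<in> X\<close> open_contains_cball by blast
    define r' where "r' = min r (d / 2)"
    have "r' > 0" "r' < d" "cball x r' \<subseteq> cball x r" using r that by (auto simp: r'_def)
    then have "(x, r') \<in> K \<and> x \<in> cball (fst (x, r')) (snd (x, r')) \<and> snd (x, r') < d"
      using r(2) by (simp add: K_def subset_trans)
    then show ?thesis by blast
  qed
  obtain C where C: "countable C" "C \<subseteq> K"
    "pairwise (\<lambda>p q. disjnt (cball (fst p) (snd p)) (cball (fst q) (snd q))) C"
    "negligible (X - (\<Union>p\<in>C. cball (fst p) (snd p)))"
  proof (rule Vitali_covering_theorem_cballs[of K snd X fst])
    show "0 < snd p" if "p \<in> K" for p using that by (simp add: K_def)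
  qed (use cov in blast)+
  show ?thesis
  proof (cases "C = {}")
    case True
    then have "(\<integral>\<^sup>+ x. w x * indicator X x \<partial>lborel) = 0"
      using C(4) X by (intro nn_integral_negligible) auto
    then show ?thesis by (intro exI[of _ "{}"]) auto
  next
    case False
    define c where "c = from_nat_into C"
    \<comment> \<open>What the first \<open>n\<close> intervals of the enumeration leave over.
      Repetitions in the enumeration do no harm, because the selection \<open>C'\<close> is a
      set.\<close>
    define A where "A = (\<lambda>n. X - (\<Union>k<n. cball (fst (c k)) (snd (c k))))"
    have A: "A n \<in> sets borel" for n using X by (auto simp: A_def)
    have Aint: "(\<Inter>n. A n) = X - (\<Union>p\<in>C. cball (fst p) (snd p))"
    proof -
      have rc: "range c = C" unfolding c_def by (rule range_from_nat_into[OF False C(1)])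
      have "(\<Inter>n. A n) = X - (\<Union>k. cball (fst (c k)) (snd (c k)))" by (auto simp: A_def)
      also have "(\<Union>k. cball (fst (c k)) (snd (c k))) = (\<Union>p\<in>range c. cball (fst p) (snd p))" by auto
      finally show ?thesis unfolding rc .
    qed
    define \<nu> where "\<nu> = density lborel w"
    have em: "emeasure \<nu> B = (\<integral>\<^sup>+ x. w x * indicator B x \<partial>lborel)" if "B \<in> sets borel" for B
      using that by (simp add: \<nu>_def emeasure_density)
    have finB: "emeasure \<nu> B \<noteq> \<infinity>" if "B \<in> sets borel" for B
    proof -
      have "emeasure \<nu> B \<le> (\<integral>\<^sup>+ x. w x \<partial>lborel)"
        unfolding em[OF that] by (intro nn_integral_mono) (auto simp: indicator_def)
      then show ?thesis using fin by (auto simp: top_unique)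
    qed
    have "(\<lambda>n. emeasure \<nu> (A n)) \<longlonglongrightarrow> emeasure \<nu> (\<Inter>n. A n)"
      using A finB by (intro Lim_emeasure_decseq) (auto simp: \<nu>_def decseq_def A_def)
    moreover have "emeasure \<nu> (\<Inter>n. A n) = 0"
      using C(4) A by (subst em) (auto simp: Aint[symmetric] intro!: nn_integral_negligible)
    ultimately have "(\<lambda>n. emeasure \<nu> (A n)) \<longlonglongrightarrow> 0" by simp
    then have "eventually (\<lambda>n. emeasure \<nu> (A n) < ennreal e) sequentially"
      using e by (intro order_tendstoD(2)) auto
    then obtain n where n: "emeasure \<nu> (A n) < ennreal e" by (auto simp: eventually_sequentially)
    define C' where "C' = c ` {..<n}"
    have sub: "C' \<subseteq> C" unfolding C'_def c_def using from_nat_into[OF False] by auto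
    have "A n = X - (\<Union>p\<in>C'. cball (fst p) (snd p))" by (auto simp: A_def C'_def)
    then have "(\<integral>\<^sup>+ x. w x * indicator (X - (\<Union>p\<in>C'. cball (fst p) (snd p))) x \<partial>lborel) \<le> ennreal e"
      using n em[OF A[of n]] by simp
    then show ?thesis
      using sub C(2) pairwise_subset[OF C(3) sub] by (intro exI[of _ C']) (auto simp: C'_def K_def)
  qed
qed

context surface_partition
begin

lemma local_weight_integral:
  assumes i: "i \<in> I" and w: "weight_on (\<phi> ` M) \<rho>"
  shows "integrable lborel (local_weight \<rho> i)"
    and "(\<integral>\<^sup>+ x. ennreal (local_weight \<rho> i x) \<partial>lborel) = ennreal (LINT x|lborel. local_weight \<rho> i x)"
proof -
  note sm = smooth_map_onD(3,4)[OF local_paramD(1,2)[OF lp[OF i]]]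
  have F: "continuous_on (U i \<inter> half_plane) (F i)" "continuous_on (U i \<inter> half_plane) (pderiv_at 1 (F i))"
    using sm by (auto intro: continuous_on_subset)
  have "F i z \<in> \<phi> ` M" if "z \<in> U i \<inter> half_plane" for z
    using local_paramD(4,6)[OF lp[OF i]] that by (metis IntD1 IntD2 imageI)
  then have "continuous_on (U i \<inter> half_plane) (\<lambda>z. \<rho> (F i z))"
    using w by (intro continuous_on_compose2[OF _ F(1), of "\<phi> ` M" \<rho>]) (auto simp: weight_on_def)
  then have "continuous_on (U i \<inter> half_plane) (\<lambda>z. \<rho> (F i z) * norm (pderiv_at 1 (F i) z))"
    by (intro continuous_on_mult continuous_on_norm F(2))
  from boundary_integrable[OF i this]
  have "integrable lborel (\<lambda>x. indicator {x. axis_pt x \<in> U i} x * (\<psi> i (h i (axis_pt x)) * (\<rho> (F i (axis_pt x)) * norm (pderiv_at 1 (F i) (axis_pt x)))))" .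
  moreover have "(\<lambda>x. indicator {x. axis_pt x \<in> U i} x * (\<psi> i (h i (axis_pt x)) * (\<rho> (F i (axis_pt x)) * norm (pderiv_at 1 (F i) (axis_pt x))))) = local_weight \<rho> i"
    by (auto simp: local_weight_def fun_eq_iff)
  ultimately show 1: "integrable lborel (local_weight \<rho> i)" by simp
  show "(\<integral>\<^sup>+ x. ennreal (local_weight \<rho> i x) \<partial>lborel) = ennreal (LINT x|lborel. local_weight \<rho> i x)"
    by (rule nn_integral_eq_integral[OF 1]) (simp add: local_weight_nonneg[OF i w])
qed

lemma boundary_integral_UNIV:
  assumes w: "weight_on (\<phi> ` M) \<rho>"
  shows "boundary_integral \<rho> UNIV = ennreal (\<Sum>i\<in>I. LINT x|lborel. local_weight \<rho> i x)"
proof -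
  have "boundary_integral \<rho> UNIV = (\<Sum>i\<in>I. \<integral>\<^sup>+ x. ennreal (local_weight \<rho> i x) \<partial>lborel)"
    unfolding boundary_integral_def
    by (intro sum.cong refl nn_integral_cong) (auto simp: trace_def local_weight_def indicator_def)
  also have "\<dots> = (\<Sum>i\<in>I. ennreal (LINT x|lborel. local_weight \<rho> i x))"
    by (intro sum.cong refl local_weight_integral(2) w)
  also have "\<dots> = ennreal (\<Sum>i\<in>I. LINT x|lborel. local_weight \<rho> i x)"
    using local_weight_nonneg[OF _ w] by (intro sum_ennreal Bochner_Integration.integral_nonneg) auto
  finally show ?thesis .
qed

definition segment_arc :: "'p \<Rightarrow> real \<Rightarrow> real \<Rightarrow> real \<Rightarrow> 'p" where
  "segment_arc i a b s = h i (axis_pt (a + s * (b - a)))"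

text \<open>For the last claim the boundary integral is computed in the chart of the segment, where
  it is the integral of the speed.\<close>

lemma segment_arc:
  assumes i: "i \<in> I" and ab: "a < b" and sub: "axis_pt ` {a..b} \<subseteq> U i"
  shows "path_image (segment_arc i a b) = (\<lambda>x. h i (axis_pt x)) ` {a..b}" "arc (segment_arc i a b)"
    "path_image (segment_arc i a b) \<subseteq> surface_boundary M \<phi>"
    "boundary_integral (\<lambda>x. 1) (path_image (segment_arc i a b)) \<le> path_length (\<phi> \<circ> segment_arc i a b)"
proof -
  note lpD = local_paramD[OF lp[OF i]]
  have im: "(\<lambda>s. a + s * (b - a)) ` {0..1} = {a..b}"
  proof (intro set_eqI iffI)
    fix x assume "x \<in> (\<lambda>s. a + s * (b - a)) ` {0..1}"
    then obtain s where s: "0 \<le> s" "s \<le> 1" "x = a + s * (b - a)" by auto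
    define k where "k = s * (b - a)"
    have "k \<le> 1 * (b - a)" unfolding k_def using s ab by (intro mult_right_mono) auto
    moreover have "0 \<le> k" using s ab by (simp add: k_def)
    ultimately have "a \<le> x" "x \<le> b" using s(3) by (simp_all add: k_def[symmetric])
    then show "x \<in> {a..b}" by simp
  next
    fix x assume "x \<in> {a..b}"
    then show "x \<in> (\<lambda>s. a + s * (b - a)) ` {0..1}"
      using ab by (intro image_eqI[of _ _ "(x - a) / (b - a)"]) auto
  qed
  show pi: "path_image (segment_arc i a b) = (\<lambda>x. h i (axis_pt x)) ` {a..b}"
    unfolding path_image_def segment_arc_def im[symmetric] by (simp add: image_image)
  have sub': "axis_pt x \<in> U i" if "x \<in> {a..b}" for x using sub that by auto
  have inU: "axis_pt (a + s * (b - a)) \<in> U i" if "s \<in> {0..1}" for s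
    using sub' im that by blast
  have "continuous_on {0..1} (\<lambda>s. h i (axis_pt (a + s * (b - a))))"
    using inU by (intro continuous_on_compose2[OF lpD(7)] continuous_intros) auto
  moreover have "inj_on (\<lambda>s. h i (axis_pt (a + s * (b - a)))) {0..1}"
  proof (rule inj_onI)
    fix s t assume st: "s \<in> {0..1}" "t \<in> {0..1}" "h i (axis_pt (a + s * (b - a))) = h i (axis_pt (a + t * (b - a)))"
    then have "axis_pt (a + s * (b - a)) = axis_pt (a + t * (b - a))"
      using inj_onD[OF lpD(8) st(3)] inU by auto
    then have "a + s * (b - a) = a + t * (b - a)" by (metis axis_pt_nth(1))
    then show "s = t" using ab by simp
  qed
  ultimately show "arc (segment_arc i a b)"
    by (simp add: arc_def path_def segment_arc_def[abs_def])
  show "path_image (segment_arc i a b) \<subseteq> surface_boundary M \<phi>"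
    unfolding pi using boundary_in[OF lp[OF i]] sub' by auto
  have w: "weight_on (\<phi> ` M) (\<lambda>x. 1)" by (simp add: weight_on_def)
  have "boundary_integral (\<lambda>x. 1) (path_image (segment_arc i a b)) =
      (\<integral>\<^sup>+ x. ennreal (norm (pderiv_at 1 (F i) (axis_pt x))) * indicator {a..b} x \<partial>lborel)"
    unfolding pi by (subst boundary_integral_chart[OF lp[OF i] _ _ w]) (use sub' in auto)
  also have "\<dots> = ennreal (integral {a..b} (\<lambda>x. norm (pderiv_at 1 (F i) (axis_pt x))))"
    using sub' by (intro nn_integral_Icc continuous_on_subset[OF weight_on_chart(2)[OF lp[OF i] w]]) auto
  also have "\<dots> \<le> path_length (\<lambda>s. F i (axis_pt (a + s * (b - a))))"
  proof (rule integral_le_path_length[OF ab])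
    fix x assume x: "x \<in> {a..b}"
    show "((\<lambda>x. F i (axis_pt x)) has_vector_derivative pderiv_at 1 (F i) (axis_pt x)) (at x)"
      by (rule chart_boundary_derivative[OF smooth_map_onD(1)[OF lpD(1,2) sub'[OF x]]])
  next
    show "continuous_on {a..b} (\<lambda>x. pderiv_at 1 (F i) (axis_pt x))"
      by (rule continuous_on_compose2[OF smooth_map_onD(4)[OF lpD(1,2)]]) (use sub' in \<open>auto intro!: continuous_intros\<close>)
  qed
  also have "\<dots> = path_length (\<phi> \<circ> segment_arc i a b)"
    unfolding path_length_def
  proof (rule SUP_cong[OF refl], rule sum.cong[OF refl])
    fix ts k assume ts: "ts \<in> {ts. sorted ts \<and> set ts \<subseteq> {0..1::real}}" and k: "k \<in> {..<length ts - 1}"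
    then have "ts ! k \<in> set ts" "ts ! Suc k \<in> set ts" by (auto intro!: nth_mem)
    then have "ts ! k \<in> {0..1}" "ts ! Suc k \<in> {0..1}" using ts by auto
    then show "ennreal (dist (F i (axis_pt (a + ts ! k * (b - a)))) (F i (axis_pt (a + ts ! Suc k * (b - a))))) =
        ennreal (dist ((\<phi> \<circ> segment_arc i a b) (ts ! k)) ((\<phi> \<circ> segment_arc i a b) (ts ! Suc k)))"
      using lpD(4)[OF inU] by (simp add: segment_arc_def)
  qed
  finally show "boundary_integral (\<lambda>x. 1) (path_image (segment_arc i a b)) \<le> path_length (\<phi> \<circ> segment_arc i a b)" .
qed

definition segment_family :: "(real \<Rightarrow> 'p) set \<Rightarrow> bool" where
  "segment_family G \<longleftrightarrow> finite G \<and>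
     (\<forall>g\<in>G. \<exists>i\<in>I. \<exists>a b. a < b \<and> axis_pt ` {a..b} \<subseteq> U i \<and> g = segment_arc i a b) \<and>
     pairwise (\<lambda>g g'. disjnt (path_image g) (path_image g')) G"

text \<open>Induction over the charts. The set \<open>P\<close> filled so far is a finite union of
  compact arcs, so what it leaves in chart \<open>i\<close> is open and can be filled by
  \<open>finite_disjoint_intervals\<close>. New segments avoid \<open>P\<close>, and the remainders
  in the charts already treated only shrink.\<close>

lemma exhaust_by_segments:
  assumes "finite J" "J \<subseteq> I" "e > 0"
  shows "\<exists>G. segment_family G \<and> (\<forall>i\<in>J. (\<integral>\<^sup>+ x. ennreal (local_weight (\<lambda>x. 1) i x) *
     indicator (trace i (- (\<Union>g\<in>G. path_image g))) x \<partial>lborel) \<le> ennreal e)"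
  using assms(1,2)
proof (induction J)
  case empty
  show ?case by (intro exI[of _ "{}"]) (simp add: segment_family_def)
next
  case (insert i J)
  then have i: "i \<in> I" by auto
  obtain G where G: "segment_family G" and GJ: "\<And>j. j \<in> J \<Longrightarrow> (\<integral>\<^sup>+ x. ennreal (local_weight (\<lambda>x. 1) j x) *
     indicator (trace j (- (\<Union>g\<in>G. path_image g))) x \<partial>lborel) \<le> ennreal e"
    using insert by auto
  note lpD = local_paramD[OF lp[OF i]]
  have w1: "weight_on (\<phi> ` M) (\<lambda>x. 1)" by (simp add: weight_on_def)
  define P where "P = (\<Union>g\<in>G. path_image g)"
  have "closed (path_image g)" if "g \<in> G" for g
  proof -
    have "arc g" using G that segment_arc(2) by (auto simp: segment_family_def)
    then show ?thesis by (metis arc_imp_path compact_path_image compact_imp_closed)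
  qed
  then have "closed P" using G unfolding P_def segment_family_def by (intro closed_UN) auto
  then have "openin (top_of_set M) (M - P)" by (metis Diff_eq open_Compl openin_open_Int)
  from boundary_preimage_open[OF lp[OF i] this]
  have "open {x. axis_pt x \<in> U i \<and> h i (axis_pt x) \<in> M - P}" .
  moreover have "{x. axis_pt x \<in> U i \<and> h i (axis_pt x) \<in> M - P} = trace i (- P)"
    using lpD(6) by (auto simp: trace_def)
  ultimately have op: "open (trace i (- P))" by simp
  have [measurable]: "local_weight (\<lambda>x. 1) i \<in> borel_measurable borel"
    by (rule local_weight_measurable[OF i w1])
  obtain C where C: "finite C" "\<And>p. p \<in> C \<Longrightarrow> snd p > 0 \<and> cball (fst p) (snd p) \<subseteq> trace i (- P)"
    "pairwise (\<lambda>p q. disjnt (cball (fst p) (snd p)) (cball (fst q) (snd q))) C"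
    "(\<integral>\<^sup>+ x. ennreal (local_weight (\<lambda>x. 1) i x) * indicator (trace i (- P) - (\<Union>p\<in>C. cball (fst p) (snd p))) x \<partial>lborel) \<le> ennreal e"
    using finite_disjoint_intervals[OF op, of "\<lambda>x. ennreal (local_weight (\<lambda>x. 1) i x)" e]
      local_weight_integral(2)[OF i w1] assms(3) by auto
  define s where "s = (\<lambda>p. segment_arc i (fst p - snd p) (fst p + snd p))"
  have cb: "cball (fst p) (snd p) = {fst p - snd p..fst p + snd p}" for p :: "real \<times> real"
    by (simp add: cball_eq_atLeastAtMost)
  have sp: "fst p - snd p < fst p + snd p" "axis_pt ` {fst p - snd p..fst p + snd p} \<subseteq> U i" if "p \<in> C" for p
    using C(2)[OF that] unfolding cb by (auto simp: trace_def)
  have ps: "path_image (s p) = (\<lambda>x. h i (axis_pt x)) ` cball (fst p) (snd p)" if "p \<in> C" for p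
    unfolding s_def cb by (rule segment_arc(1)[OF i sp[OF that]])
  have psP: "path_image (s p) \<inter> P = {}" if "p \<in> C" for p
    unfolding ps[OF that] using C(2)[OF that] by (auto simp: trace_def)
  have psd: "disjnt (path_image (s p)) (path_image (s q))" if "p \<in> C" "q \<in> C" "p \<noteq> q" for p q
  proof -
    have d: "disjnt (cball (fst p) (snd p)) (cball (fst q) (snd q))" using C(3) that by (simp add: pairwise_def)
    have False if "x \<in> cball (fst p) (snd p)" "y \<in> cball (fst q) (snd q)" "h i (axis_pt x) = h i (axis_pt y)" for x y
    proof -
      have "x \<in> trace i (- P)" "y \<in> trace i (- P)"
        using subsetD[OF conjunct2[OF C(2)[OF \<open>p \<in> C\<close>]] that(1)] subsetD[OF conjunct2[OF C(2)[OF \<open>q \<in> C\<close>]] that(2)] by auto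
      then have "axis_pt x \<in> U i" "axis_pt y \<in> U i" by (auto simp: trace_def)
      then have "axis_pt x = axis_pt y" using inj_onD[OF lpD(8) that(3)] by auto
      then have "x = y" by (metis axis_pt_nth(1))
      then show False using d that by (auto simp: disjnt_def)
    qed
    then show ?thesis unfolding ps[OF that(1)] ps[OF that(2)] disjnt_def by blast
  qed
  define G' where "G' = G \<union> s ` C"
  have P': "(\<Union>g\<in>G'. path_image g) = P \<union> (\<Union>p\<in>C. path_image (s p))" by (auto simp: G'_def P_def)
  have "segment_family G'"
    unfolding segment_family_def
  proof (intro conjI ballI)
    show "finite G'" using G C(1) by (auto simp: G'_def segment_family_def)
    fix g assume "g \<in> G'"
    then show "\<exists>i\<in>I. \<exists>a b. a < b \<and> axis_pt ` {a..b} \<subseteq> U i \<and> g = segment_arc i a b"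
    proof (unfold G'_def, elim UnE imageE)
      assume "g \<in> G" then show ?thesis using G by (auto simp: segment_family_def)
    next
      fix p assume "g = s p" "p \<in> C"
      then show ?thesis using i sp[of p] unfolding s_def by blast
    qed
  next
    show "pairwise (\<lambda>g g'. disjnt (path_image g) (path_image g')) G'"
    proof (rule pairwiseI)
      fix g g' assume gg: "g \<in> G'" "g' \<in> G'" "g \<noteq> g'"
      consider "g \<in> G" "g' \<in> G" | p where "g \<in> G" "p \<in> C" "g' = s p" | p where "g' \<in> G" "p \<in> C" "g = s p"
        | p q where "p \<in> C" "q \<in> C" "g = s p" "g' = s q"
        using gg unfolding G'_def by blast
      then show "disjnt (path_image g) (path_image g')"
      proof cases
        case 1 then show ?thesis using G gg(3) by (simp add: segment_family_def pairwise_def)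
      next
        case 2 then show ?thesis using psP[OF 2(2)] unfolding P_def disjnt_def by blast
      next
        case 3 then show ?thesis using psP[OF 3(2)] unfolding P_def disjnt_def by blast
      next
        case 4 then show ?thesis using psd gg(3) by metis
      qed
    qed
  qed
  moreover have "(\<integral>\<^sup>+ x. ennreal (local_weight (\<lambda>x. 1) j x) *
     indicator (trace j (- (\<Union>g\<in>G'. path_image g))) x \<partial>lborel) \<le> ennreal e" if j: "j \<in> insert i J" for j
  proof (cases "j = i")
    case True
    have "trace i (- (\<Union>g\<in>G'. path_image g)) \<subseteq> trace i (- P) - (\<Union>p\<in>C. cball (fst p) (snd p))"
      unfolding P' using ps by (auto simp: trace_def)
    then have "(\<integral>\<^sup>+ x. ennreal (local_weight (\<lambda>x. 1) i x) * indicator (trace i (- (\<Union>g\<in>G'. path_image g))) x \<partial>lborel)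
      \<le> (\<integral>\<^sup>+ x. ennreal (local_weight (\<lambda>x. 1) i x) * indicator (trace i (- P) - (\<Union>p\<in>C. cball (fst p) (snd p))) x \<partial>lborel)"
      by (rule nn_integral_indicator_mono)
    then show ?thesis using C(4) True order_trans by blast
  next
    case False
    have "trace j (- (\<Union>g\<in>G'. path_image g)) \<subseteq> trace j (- P)"
      unfolding P' by (auto simp: trace_def)
    then have "(\<integral>\<^sup>+ x. ennreal (local_weight (\<lambda>x. 1) j x) * indicator (trace j (- (\<Union>g\<in>G'. path_image g))) x \<partial>lborel)
      \<le> (\<integral>\<^sup>+ x. ennreal (local_weight (\<lambda>x. 1) j x) * indicator (trace j (- P)) x \<partial>lborel)"
      by (rule nn_integral_indicator_mono)
    then show ?thesis using GJ[of j] j False P_def order_trans by blast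
  qed
  ultimately show ?case by blast
qed

text \<open>The segments are admissible in the supremum that defines \<open>curve_length\<close>,
  and each is at least as long as its boundary integral; only the unfilled remainder is
  lost.\<close>

lemma boundary_integral_le_curve_length:
  "boundary_integral (\<lambda>x. 1) UNIV \<le> curve_length \<phi> (surface_boundary M \<phi>)"
proof (rule ennreal_le_epsilon)
  fix e :: real assume e: "e > 0"
  \<comment> \<open>The remainder is at most \<open>d\<close> in each chart; the summand 1 covers an
    empty \<open>I\<close>.\<close>
  define d where "d = e / (real (card I) + 1)"
  have d: "d > 0" using e by (simp add: d_def)
  have w1: "weight_on (\<phi> ` M) (\<lambda>x. 1)" by (simp add: weight_on_def)
  obtain G where G: "segment_family G" and GI: "\<And>i. i \<in> I \<Longrightarrow> (\<integral>\<^sup>+ x. ennreal (local_weight (\<lambda>x. 1) i x) *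
     indicator (trace i (- (\<Union>g\<in>G. path_image g))) x \<partial>lborel) \<le> ennreal d"
    using exhaust_by_segments[OF fin subset_refl d] by auto
  define P where "P = (\<Union>g\<in>G. path_image g)"
  have G1: "finite G" "pairwise (\<lambda>g g'. disjnt (path_image g) (path_image g')) G" using G by (auto simp: segment_family_def)
  have G2: "arc g" "path_image g \<subseteq> surface_boundary M \<phi>" "boundary_integral (\<lambda>x. 1) (path_image g) \<le> path_length (\<phi> \<circ> g)"
    if "g \<in> G" for g
  proof -
    obtain i a b where "i \<in> I" "a < b" "axis_pt ` {a..b} \<subseteq> U i" "g = segment_arc i a b"
      using G \<open>g \<in> G\<close> unfolding segment_family_def by blast
    then show "arc g" "path_image g \<subseteq> surface_boundary M \<phi>"
      "boundary_integral (\<lambda>x. 1) (path_image g) \<le> path_length (\<phi> \<circ> g)"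
      using segment_arc(2-4) by simp_all
  qed
  have tb: "trace_borel (path_image g)" if "g \<in> G" for g
    using G2(1)[OF that] by (intro trace_borel_closed compact_imp_closed compact_path_image arc_imp_path)
  have tbP: "trace_borel P" and biP: "boundary_integral (\<lambda>x. 1) P = (\<Sum>g\<in>G. boundary_integral (\<lambda>x. 1) (path_image g))"
    using boundary_integral_disjoint[OF G1(1) tb G1(2) w1] by (auto simp: P_def)
  have tU: "trace_borel UNIV" by (rule trace_borel_closed) simp
  have "boundary_integral (\<lambda>x. 1) UNIV = boundary_integral (\<lambda>x. 1) (P \<union> (UNIV - P))" by simp
  also have "\<dots> = boundary_integral (\<lambda>x. 1) P + boundary_integral (\<lambda>x. 1) (UNIV - P)"
    by (rule boundary_integral_Un[OF tbP trace_borel_Diff[OF tU tbP] _ w1]) auto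
  also have "boundary_integral (\<lambda>x. 1) (UNIV - P) \<le> (\<Sum>i\<in>I. ennreal d)"
    unfolding boundary_integral_def Compl_eq_Diff_UNIV[symmetric] P_def by (rule sum_mono[OF GI])
  also have "(\<Sum>i\<in>I. ennreal d) = ennreal (real (card I) * d)"
    using d by (simp add: ennreal_mult ennreal_of_nat_eq_real_of_nat)
  also have "\<dots> \<le> ennreal e"
    using e by (intro ennreal_leI) (simp add: d_def field_simps)
  also have "boundary_integral (\<lambda>x. 1) P \<le> (\<Sum>g\<in>G. path_length (\<phi> \<circ> g))"
    unfolding biP by (rule sum_mono[OF G2(3)])
  also have "\<dots> \<le> curve_length \<phi> (surface_boundary M \<phi>)"
    unfolding curve_length_def by (rule SUP_upper) (use G1 G2 in auto)
  finally show "boundary_integral (\<lambda>x. 1) UNIV \<le> curve_length \<phi> (surface_boundary M \<phi>) + ennreal e"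
    by (simp add: add_right_mono)
qed

end


subsection \<open>Comparison of lengths\<close>

text \<open>Up to the factor 1 / |x - c|^2 the derivative is the reflection along x - c, an
  isometry.\<close>

lemma norm_unit_inv_derivative:
  assumes "x \<noteq> c"
  shows "norm ((1 / (norm (x - c))\<^sup>2) *\<^sub>R v - (2 * ((x - c) \<bullet> v) / ((norm (x - c))\<^sup>2)\<^sup>2) *\<^sub>R (x - c))
    = 1 / (norm (x - c))\<^sup>2 * norm v"
proof -
  define y N where "y = x - c" and "N = (norm y)\<^sup>2"
  have N: "N > 0" "y \<bullet> y = N" using assms by (simp_all add: y_def N_def power2_norm_eq_inner)
  have "(norm ((1 / N) *\<^sub>R v - (2 * (y \<bullet> v) / N\<^sup>2) *\<^sub>R y))\<^sup>2 = (1 / N * norm v)\<^sup>2"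
    unfolding power_mult_distrib power2_norm_eq_inner using N
    by (simp add: inner_diff_left inner_diff_right inner_commute[of v y] field_simps power2_eq_square)
  then have "norm ((1 / N) *\<^sub>R v - (2 * (y \<bullet> v) / N\<^sup>2) *\<^sub>R y) = 1 / N * norm v"
    using N by (intro power2_eq_imp_eq[of "norm _"]) auto
  then show ?thesis by (simp add: y_def N_def)
qed

lemma surface_boundary_subset: "surface_boundary M \<phi> \<subseteq> M"
  using local_paramD(6) by (fastforce simp: surface_boundary_def half_plane_def)

lemma path_length_mono:
  assumes "\<And>s t. s \<in> {0..1} \<Longrightarrow> t \<in> {0..1} \<Longrightarrow> dist (c s) (c t) \<le> dist (d s) (d t)"
  shows "path_length c \<le> path_length d"
  unfolding path_length_def
proof (rule SUP_mono)
  fix ts :: "real list" assume ts: "ts \<in> {ts. sorted ts \<and> set ts \<subseteq> {0..1}}"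
  have "(\<Sum>i<length ts - 1. ennreal (dist (c (ts ! i)) (c (ts ! Suc i)))) \<le>
      (\<Sum>i<length ts - 1. ennreal (dist (d (ts ! i)) (d (ts ! Suc i))))"
  proof (intro sum_mono ennreal_leI assms)
    fix k assume k: "k \<in> {..<length ts - 1}"
    then have "ts ! k \<in> set ts" "ts ! Suc k \<in> set ts" by (auto intro!: nth_mem)
    then show "ts ! k \<in> {0..1}" "ts ! Suc k \<in> {0..1}" using ts by auto
  qed
  then show "\<exists>m\<in>{ts. sorted ts \<and> set ts \<subseteq> {0..1}}. (\<Sum>i<length ts - 1. ennreal (dist (c (ts ! i)) (c (ts ! Suc i))))
      \<le> (\<Sum>i<length m - 1. ennreal (dist (d (m ! i)) (d (m ! Suc i))))"
    using ts by blast
qed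

lemma curve_length_mono:
  assumes "\<And>g. arc g \<Longrightarrow> path_image g \<subseteq> C \<Longrightarrow> path_length (\<psi> \<circ> g) \<le> path_length (\<theta> \<circ> g)"
  shows "curve_length \<psi> C \<le> curve_length \<theta> C"
  unfolding curve_length_def
proof (rule SUP_mono)
  fix G assume G: "G \<in> {G. finite G \<and> (\<forall>g\<in>G. arc g \<and> path_image g \<subseteq> C) \<and>
      pairwise (\<lambda>g g'. disjnt (path_image g) (path_image g')) G}"
  then have "(\<Sum>g\<in>G. path_length (\<psi> \<circ> g)) \<le> (\<Sum>g\<in>G. path_length (\<theta> \<circ> g))"
    by (intro sum_mono assms) auto
  then show "\<exists>G'\<in>{G. finite G \<and> (\<forall>g\<in>G. arc g \<and> path_image g \<subseteq> C) \<and>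
      pairwise (\<lambda>g g'. disjnt (path_image g) (path_image g')) G}.
      (\<Sum>g\<in>G. path_length (\<psi> \<circ> g)) \<le> (\<Sum>g\<in>G'. path_length (\<theta> \<circ> g))"
    using G by blast
qed

context surface_partition
begin

lemma in_chart_image:
  assumes "p \<in> M"
  obtains i where "i \<in> I" "p \<in> h i ` (U i \<inter> half_plane)"
proof -
  obtain i where "i \<in> I" "\<psi> i p \<noteq> 0" using sum1[OF assms] by (metis sum.neutral zero_neq_one)
  then show thesis using supp[OF _ assms, of i] K(2)[of i] that by blast
qed

text \<open>\<open>g\<close> is merely continuous, so it has no speed to integrate. Its boundary
  coordinate \<open>y\<close> in a chart is continuous, and by connectedness covers the whole
  coordinate segment between its end values; the chord hypothesis on that segment bounds the chord
  of \<open>g\<close>. A bisection argument glues these local bounds by the triangle inequality and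
  additivity.\<close>

lemma chord_le_boundary_integral:
  fixes f :: "'a \<Rightarrow> 'b::metric_space"
  assumes w: "weight_on (\<phi> ` M) \<rho>"
    and chord: "\<And>i a b. i \<in> I \<Longrightarrow> a \<le> b \<Longrightarrow> axis_pt ` {a..b} \<subseteq> U i \<Longrightarrow>
      dist (f (F i (axis_pt a))) (f (F i (axis_pt b))) \<le> integral {a..b} (\<lambda>x. \<rho> (F i (axis_pt x)) * norm (pderiv_at 1 (F i) (axis_pt x)))"
    and g: "arc g" "path_image g \<subseteq> surface_boundary M \<phi>"
    and st: "0 \<le> s" "s \<le> t" "t \<le> 1"
  shows "trace_borel (g ` {s<..t})"
    and "ennreal (dist (f (\<phi> (g s))) (f (\<phi> (g t)))) \<le> boundary_integral \<rho> (g ` {s<..t})"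
proof -
  have cg: "continuous_on {0..1} g" and inj: "inj_on g {0..1}" using g(1) by (auto simp: arc_def path_def)
  have gB: "g r \<in> surface_boundary M \<phi>" if "r \<in> {0..1}" for r
    using g(2) that by (auto simp: path_image_def)
  \<comment> \<open>By injectivity a half-open subarc is a compact set minus a point.\<close>
  have tb: "trace_borel (g ` {s<..t})" if "0 \<le> s" "s \<le> t" "t \<le> 1" for s t
  proof -
    have "g ` {s<..t} = g ` {s..t} - {g s}"
    proof -
      have "g ` ({s..t} - {s}) = g ` {s..t} - g ` {s}"
        using inj that by (intro inj_on_image_set_diff[of g "{0..1}"]) auto
      moreover have "{s..t} - {s} = {s<..t}" by auto
      ultimately show ?thesis by simp
    qed
    moreover have "closed (g ` {s..t})"
      using that by (intro compact_imp_closed compact_continuous_image continuous_on_subset[OF cg]) auto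
    ultimately show ?thesis using trace_borel_Diff trace_borel_closed by simp
  qed
  show "trace_borel (g ` {s<..t})" by (rule tb[OF st])
  \<comment> \<open>Half-open subarcs make neighbouring pieces disjoint, as additivity of the
    boundary integral requires.\<close>
  define P where "P = (\<lambda>a b. 0 \<le> a \<longrightarrow> a \<le> b \<longrightarrow> b \<le> 1 \<longrightarrow>
    ennreal (dist (f (\<phi> (g a))) (f (\<phi> (g b)))) \<le> boundary_integral \<rho> (g ` {a<..b}))"
  have "P s t"
    using \<open>s \<le> t\<close>
  proof (rule Bolzano)
    fix a b c assume ab: "P a b" "P b c" "a \<le> b" "b \<le> c"
    show "P a c" unfolding P_def
    proof (intro impI)
      assume ac: "0 \<le> a" "a \<le> c" "c \<le> 1"
      have eq: "g ` {a<..c} = g ` {a<..b} \<union> g ` {b<..c}" using ab by (auto simp flip: image_Un)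
      have disj: "g ` {a<..b} \<inter> g ` {b<..c} = {}"
        using inj ab ac by (subst inj_on_image_Int[of g "{0..1}", symmetric]) auto
      have "ennreal (dist (f (\<phi> (g a))) (f (\<phi> (g c)))) \<le> ennreal (dist (f (\<phi> (g a))) (f (\<phi> (g b))) + dist (f (\<phi> (g b))) (f (\<phi> (g c))))"
        by (intro ennreal_leI dist_triangle)
      also have "\<dots> = ennreal (dist (f (\<phi> (g a))) (f (\<phi> (g b)))) + ennreal (dist (f (\<phi> (g b))) (f (\<phi> (g c))))"
        by (simp add: ennreal_plus)
      also have "\<dots> \<le> boundary_integral \<rho> (g ` {a<..b}) + boundary_integral \<rho> (g ` {b<..c})"
        using ab ac by (intro add_mono) (auto simp: P_def)
      also have "\<dots> = boundary_integral \<rho> (g ` {a<..c})"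
        unfolding eq using ab ac by (intro boundary_integral_Un[symmetric] tb disj w) auto
      finally show "ennreal (dist (f (\<phi> (g a))) (f (\<phi> (g c)))) \<le> boundary_integral \<rho> (g ` {a<..c})" .
    qed
  next
    fix x assume "s \<le> x" "x \<le> t"
    then have x: "x \<in> {0..1}" using st by auto
    obtain i where i: "i \<in> I" "g x \<in> h i ` (U i \<inter> half_plane)"
      using in_chart_image gB[OF x] surface_boundary_subset by blast
    note lpD = local_paramD[OF lp[OF i(1)]]
    let ?N = "h i ` (U i \<inter> half_plane)"
    have gM: "g ` {0..1} \<subseteq> M" using gB surface_boundary_subset by blast
    have "openin (top_of_set {0..1}) ({0..1} \<inter> g -` ?N)"
      using cg gM lpD(5) by (intro continuous_openin_preimage[of _ _ M]) auto
    then obtain d where d: "d > 0" "ball x d \<inter> {0..1} \<subseteq> {0..1} \<inter> g -` ?N"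
      using x i(2) unfolding openin_contains_ball by blast
    have "P a b" if ab: "a \<le> x" "x \<le> b" "b - a < d" for a b
      unfolding P_def
    proof (intro impI)
      assume a: "0 \<le> a" "a \<le> b" "b \<le> 1"
      have gN: "g r \<in> ?N" if "r \<in> {a..b}" for r
      proof -
        have "r \<in> ball x d \<inter> {0..1}" using that ab a by (auto simp: dist_real_def)
        then show ?thesis using d(2) by blast
      qed
      define y where "y = (\<lambda>r. the_inv_into (U i \<inter> half_plane) (h i) (g r) $ 1)"
      have y: "axis_pt (y r) \<in> U i" "g r = h i (axis_pt (y r))" if r: "r \<in> {a..b}" for r
      proof -
        have "r \<in> {0..1}" using r a by auto
        then obtain v where v: "axis_pt v \<in> U i" "g r = h i (axis_pt v)"
          using boundary_point_in_chart[OF lp[OF i(1)] gB gN[OF r]] by blast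
        then have "y r = v" using the_inv_into_f_f[OF lpD(8), of "axis_pt v"] by (simp add: y_def)
        then show "axis_pt (y r) \<in> U i" "g r = h i (axis_pt (y r))" using v by auto
      qed
      have cy: "continuous_on {a..b} y" unfolding y_def
        using gN a by (intro continuous_intros continuous_on_compose2[OF lpD(9)] continuous_on_subset[OF cg]) auto
      then have con: "connected (y ` {a..b})" by (intro connected_continuous_image) auto
      \<comment> \<open>The coordinate may run in either direction along the arc.\<close>
      define lo hi where "lo = min (y a) (y b)" and "hi = max (y a) (y b)"
      have lh: "lo \<le> hi" "lo \<in> y ` {a..b}" "hi \<in> y ` {a..b}"
        using a by (auto simp: lo_def hi_def min_def max_def)
      have seg: "{lo..hi} \<subseteq> y ` {a..b}" using connected_contains_Icc[OF con lh(2,3)] .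
      have sub: "axis_pt ` {lo..hi} \<subseteq> U i" using seg y(1) by auto
      \<comment> \<open>Removing the endpoint \<open>y a\<close> leaves the integral unchanged and
        keeps the segment inside the image of the half-open interval.\<close>
      define B where "B = {lo..hi} - {y a}"
      have By: "B \<subseteq> y ` {a<..b}"
      proof
        fix v assume "v \<in> B"
        then obtain r where "r \<in> {a..b}" "v = y r" "v \<noteq> y a" using seg by (auto simp: B_def)
        then show "v \<in> y ` {a<..b}" by (intro image_eqI[of _ _ r]) (auto simp: less_le)
      qed
      have F: "F i (axis_pt (y r)) = \<phi> (g r)" if "r \<in> {a..b}" for r
        using lpD(4)[OF y(1)[OF that]] y(2)[OF that] by simp
      have "dist (f (F i (axis_pt lo))) (f (F i (axis_pt hi))) = dist (f (\<phi> (g a))) (f (\<phi> (g b)))"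
        using F[of a] F[of b] a by (auto simp: lo_def hi_def min_def max_def dist_commute)
      then have "ennreal (dist (f (\<phi> (g a))) (f (\<phi> (g b)))) \<le>
          ennreal (integral {lo..hi} (\<lambda>x. \<rho> (F i (axis_pt x)) * norm (pderiv_at 1 (F i) (axis_pt x))))"
        using chord[OF i(1) lh(1) sub] by (intro ennreal_leI) simp
      also have "\<dots> = (\<integral>\<^sup>+ x. ennreal (\<rho> (F i (axis_pt x)) * norm (pderiv_at 1 (F i) (axis_pt x))) * indicator {lo..hi} x \<partial>lborel)"
        using w sub by (intro nn_integral_Icc[symmetric] continuous_on_mult
            continuous_on_subset[OF weight_on_chart(1)[OF lp[OF i(1)] w]]
            continuous_on_subset[OF weight_on_chart(2)[OF lp[OF i(1)] w]]) (auto simp: weight_on_def)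
      also have "\<dots> = (\<integral>\<^sup>+ x. ennreal (\<rho> (F i (axis_pt x)) * norm (pderiv_at 1 (F i) (axis_pt x))) * indicator B x \<partial>lborel)"
      proof (rule nn_integral_cong_AE)
        show "AE x in lborel. ennreal (\<rho> (F i (axis_pt x)) * norm (pderiv_at 1 (F i) (axis_pt x))) * indicator {lo..hi} x =
            ennreal (\<rho> (F i (axis_pt x)) * norm (pderiv_at 1 (F i) (axis_pt x))) * indicator B x"
          using AE_lborel_singleton[of "y a"] by eventually_elim (auto simp: B_def indicator_def)
      qed
      also have "\<dots> = boundary_integral \<rho> ((\<lambda>x. h i (axis_pt x)) ` B)"
        using sub by (intro boundary_integral_chart[OF lp[OF i(1)] _ _ w, symmetric]) (auto simp: B_def)
      also have "\<dots> \<le> boundary_integral \<rho> (g ` {a<..b})"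
      proof (rule boundary_integral_mono)
        have "h i (axis_pt (y r)) \<in> g ` {a<..b}" if r: "r \<in> {a<..b}" for r
        proof -
          have "r \<in> {a..b}" using r by auto
          from y(2)[OF this] show ?thesis using imageI[OF r, of g] by simp
        qed
        then show "(\<lambda>x. h i (axis_pt x)) ` B \<subseteq> g ` {a<..b}" using By by blast
      qed
      finally show "ennreal (dist (f (\<phi> (g a))) (f (\<phi> (g b)))) \<le> boundary_integral \<rho> (g ` {a<..b})" .
    qed
    then show "\<exists>d>0. \<forall>a b. a \<le> x \<and> x \<le> b \<and> b - a < d \<longrightarrow> P a b" using d(1) by blast
  qed
  then show "ennreal (dist (f (\<phi> (g s))) (f (\<phi> (g t)))) \<le> boundary_integral \<rho> (g ` {s<..t})"
    using st by (simp add: P_def)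
qed

text \<open>Consecutive half-open subarcs add up along a subdivision, so every polygon inscribed in
  the image of an arc is bounded by the boundary integral over that arc; disjoint arcs add up
  again.\<close>

lemma curve_length_le_boundary_integral:
  fixes f :: "'a \<Rightarrow> 'b::metric_space"
  assumes w: "weight_on (\<phi> ` M) \<rho>"
    and chord: "\<And>i a b. i \<in> I \<Longrightarrow> a \<le> b \<Longrightarrow> axis_pt ` {a..b} \<subseteq> U i \<Longrightarrow>
      dist (f (F i (axis_pt a))) (f (F i (axis_pt b))) \<le> integral {a..b} (\<lambda>x. \<rho> (F i (axis_pt x)) * norm (pderiv_at 1 (F i) (axis_pt x)))"
  shows "curve_length (f \<circ> \<phi>) (surface_boundary M \<phi>) \<le> boundary_integral \<rho> UNIV"
  unfolding curve_length_def
proof (rule SUP_least)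
  fix G assume "G \<in> {G. finite G \<and> (\<forall>g\<in>G. arc g \<and> path_image g \<subseteq> surface_boundary M \<phi>) \<and>
      pairwise (\<lambda>g g'. disjnt (path_image g) (path_image g')) G}"
  then have G: "finite G" "\<And>g. g \<in> G \<Longrightarrow> arc g" "\<And>g. g \<in> G \<Longrightarrow> path_image g \<subseteq> surface_boundary M \<phi>"
    "pairwise (\<lambda>g g'. disjnt (path_image g) (path_image g')) G" by auto
  have len: "path_length (f \<circ> \<phi> \<circ> g) \<le> boundary_integral \<rho> (path_image g)" if g: "arc g" "path_image g \<subseteq> surface_boundary M \<phi>" for g
    unfolding path_length_def
  proof (rule SUP_least)
    note step = chord_le_boundary_integral[OF w chord g]
    have inj: "inj_on g {0..1}" using g(1) by (simp add: arc_def)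
    have sum_le: "(\<Sum>i<length ts - 1. ennreal (dist (f (\<phi> (g (ts ! i)))) (f (\<phi> (g (ts ! Suc i))))))
        \<le> boundary_integral \<rho> (g ` {hd ts<..last ts})"
      if "sorted ts" "set ts \<subseteq> {0..1}" "ts \<noteq> []" for ts
      using that
    proof (induction ts)
      case (Cons x ts)
      show ?case
      proof (cases ts)
        case (Cons y zs)
        let ?D = "\<lambda>ts i. ennreal (dist (f (\<phi> (g (ts ! i)))) (f (\<phi> (g (ts ! Suc i)))))"
        have IH: "(\<Sum>i<length ts - 1. ?D ts i) \<le> boundary_integral \<rho> (g ` {y<..last ts})"
          using Cons.IH Cons.prems Cons by simp
        have xy: "0 \<le> x" "x \<le> y" "y \<le> 1" "0 \<le> y" using Cons.prems Cons by auto
        have yl: "y \<le> last ts" "last ts \<le> 1"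
          using Cons.prems Cons by (auto simp: subset_iff dest!: last_in_set)
        have "(\<Sum>i<length (x # ts) - 1. ?D (x # ts) i) = (\<Sum>i<Suc (length ts - 1). ?D (x # ts) i)"
          using Cons by simp
        also have "\<dots> = ?D (x # ts) 0 + (\<Sum>i<length ts - 1. ?D ts i)"
          unfolding sum.lessThan_Suc_shift by simp
        also have "\<dots> \<le> boundary_integral \<rho> (g ` {x<..y}) + boundary_integral \<rho> (g ` {y<..last ts})"
          using step(2)[OF _ _ _ xy(1-3)] IH Cons by (intro add_mono) auto
        also have "\<dots> = boundary_integral \<rho> (g ` {x<..y} \<union> g ` {y<..last ts})"
        proof (rule boundary_integral_Un[symmetric, OF _ _ _ w])
          show "trace_borel (g ` {x<..y})" "trace_borel (g ` {y<..last ts})"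
            using step(1) xy yl by blast+
          show "g ` {x<..y} \<inter> g ` {y<..last ts} = {}"
            using inj xy yl by (subst inj_on_image_Int[of g "{0..1}", symmetric]) auto
        qed
        also have "g ` {x<..y} \<union> g ` {y<..last ts} = g ` {hd (x # ts)<..last (x # ts)}"
          using xy yl Cons by (auto simp flip: image_Un)
        finally show ?thesis .
      qed simp
    qed simp
    fix ts :: "real list" assume ts: "ts \<in> {ts. sorted ts \<and> set ts \<subseteq> {0..1}}"
    show "(\<Sum>i<length ts - 1. ennreal (dist ((f \<circ> \<phi> \<circ> g) (ts ! i)) ((f \<circ> \<phi> \<circ> g) (ts ! Suc i)))) \<le> boundary_integral \<rho> (path_image g)"
    proof (cases "ts = []")
      case False
      then have "hd ts \<in> {0..1}" "last ts \<in> {0..1}"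
        using ts subsetD[OF _ hd_in_set[OF False]] subsetD[OF _ last_in_set[OF False]] by blast+
      then have "g ` {hd ts<..last ts} \<subseteq> path_image g" by (auto simp: path_image_def)
      then have "boundary_integral \<rho> (g ` {hd ts<..last ts}) \<le> boundary_integral \<rho> (path_image g)"
        by (rule boundary_integral_mono)
      moreover have "(\<Sum>i<length ts - 1. ennreal (dist (f (\<phi> (g (ts ! i)))) (f (\<phi> (g (ts ! Suc i))))))
        \<le> boundary_integral \<rho> (g ` {hd ts<..last ts})"
        using ts False by (intro sum_le) auto
      ultimately show ?thesis unfolding comp_apply by (rule order_trans[rotated])
    qed simp
  qed
  have tb: "trace_borel (path_image g)" if "g \<in> G" for g
    using G(2)[OF that] by (intro trace_borel_closed compact_imp_closed compact_path_image arc_imp_path)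
  have "(\<Sum>g\<in>G. path_length (f \<circ> \<phi> \<circ> g)) \<le> (\<Sum>g\<in>G. boundary_integral \<rho> (path_image g))"
    using G len by (intro sum_mono) auto
  also have "\<dots> = boundary_integral \<rho> (\<Union>g\<in>G. path_image g)"
    using boundary_integral_disjoint[OF G(1) tb G(4) w] by simp
  also have "\<dots> \<le> boundary_integral \<rho> UNIV" by (rule boundary_integral_mono) simp
  finally show "(\<Sum>g\<in>G. path_length (f \<circ> \<phi> \<circ> g)) \<le> boundary_integral \<rho> UNIV" .
qed

text \<open>Because k is at most |c|^2 - 1, the length of the image is at most the boundary integral
  of \<open>\<rho>\<close>, which is the function u of the overview. The flux inequality replaces u
  by 1, and the integral of 1 is at most the length of the boundary.\<close>

lemma inverted_boundary_length:
  fixes f :: "'a \<Rightarrow> 'a"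
  assumes ball: "\<phi> ` M \<subseteq> cball 0 1" and c: "norm c > 1" and min: "minimal_surface M \<phi>"
    and sph: "\<phi> ` surface_boundary M \<phi> \<subseteq> sphere 0 1" and orth: "meets_sphere_orthogonally M \<phi>"
    and k: "0 \<le> k" "k \<le> (norm c)\<^sup>2 - 1"
    and f: "\<And>x y. x \<in> cball 0 1 \<Longrightarrow> y \<in> cball 0 1 \<Longrightarrow> dist (f x) (f y) = k * dist (unit_inv c x) (unit_inv c y)"
  shows "curve_length (f \<circ> \<phi>) (surface_boundary M \<phi>) \<le> curve_length \<phi> (surface_boundary M \<phi>)"
proof -
  define \<rho> where "\<rho> = (\<lambda>x. ((norm c)\<^sup>2 - 1) / (norm (x - c))\<^sup>2)"
  have c1: "(norm c)\<^sup>2 - 1 \<ge> 0" using c by (simp add: one_le_power)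
  have nc: "x \<noteq> c" if "x \<in> \<phi> ` M" for x using ball c that by auto
  have w: "weight_on (\<phi> ` M) \<rho>"
    using c1 nc by (auto simp: weight_on_def \<rho>_def intro!: continuous_intros)
  have w1: "weight_on (\<phi> ` M) (\<lambda>x. 1)" by (simp add: weight_on_def)
  have "curve_length (f \<circ> \<phi>) (surface_boundary M \<phi>) \<le> boundary_integral \<rho> UNIV"
  proof (rule curve_length_le_boundary_integral[OF w])
    fix i a b assume i: "i \<in> I" and ab: "a \<le> b" and sub: "axis_pt ` {a..b} \<subseteq> U i"
    note lpD = local_paramD[OF lp[OF i]]
    have U: "axis_pt x \<in> U i" if "x \<in> {a..b}" for x using sub that by auto
    have FM: "F i (axis_pt x) \<in> \<phi> ` M" if "x \<in> {a..b}" for x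
      using lpD(4,6)[OF U[OF that]] by (metis axis_pt_in_half_plane imageI)
    have "{a..b} \<subseteq> {x. axis_pt x \<in> U i}" using U by auto
    note cs = continuous_on_subset[OF _ this]
    have cF: "continuous_on {a..b} (\<lambda>x. F i (axis_pt x))" by (rule cs[OF weight_on_chart(3)[OF lp[OF i] w]])
    have cD: "continuous_on {a..b} (\<lambda>x. pderiv_at 1 (F i) (axis_pt x))"
      by (rule continuous_on_compose2[OF smooth_map_onD(4)[OF lpD(1,2)]]) (use U in \<open>auto intro!: continuous_intros\<close>)
    let ?r = "\<lambda>x. 1 / (norm (F i (axis_pt x) - c))\<^sup>2"
    have cr: "continuous_on {a..b} ?r"
      using nc[OF FM] by (intro continuous_intros cF) auto
    have "dist (f (F i (axis_pt a))) (f (F i (axis_pt b))) = k * dist (unit_inv c (F i (axis_pt a))) (unit_inv c (F i (axis_pt b)))"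
      using FM[of a] FM[of b] ball ab by (intro f) auto
    also have "\<dots> \<le> ((norm c)\<^sup>2 - 1) * dist (unit_inv c (F i (axis_pt a))) (unit_inv c (F i (axis_pt b)))"
      using k by (intro mult_right_mono) auto
    also have "\<dots> \<le> ((norm c)\<^sup>2 - 1) * integral {a..b} (\<lambda>x. ?r x * norm (pderiv_at 1 (F i) (axis_pt x)))"
    proof (intro mult_left_mono c1 dist_compose_le_integral[OF ab _ cD, where \<rho> = "\<lambda>x. 1 / (norm (x - c))\<^sup>2"])
      show "((\<lambda>x. F i (axis_pt x)) has_vector_derivative pderiv_at 1 (F i) (axis_pt x)) (at x)" if "x \<in> {a..b}" for x
        by (rule chart_boundary_derivative[OF smooth_map_onD(1)[OF lpD(1,2) U[OF that]]])
      show "continuous_on {a..b} ?r" by (rule cr)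
      show "(unit_inv c has_derivative (\<lambda>v. (1 / (norm (F i (axis_pt x) - c))\<^sup>2) *\<^sub>R v
        - (2 * ((F i (axis_pt x) - c) \<bullet> v) / ((norm (F i (axis_pt x) - c))\<^sup>2)\<^sup>2) *\<^sub>R (F i (axis_pt x) - c))) (at (F i (axis_pt x)))"
        if "x \<in> {a..b}" for x
        by (rule has_derivative_unit_inv[OF nc[OF FM[OF that]]])
    next
      fix x v assume "x \<in> {a..b}"
      then show "norm ((1 / (norm (F i (axis_pt x) - c))\<^sup>2) *\<^sub>R v
        - (2 * ((F i (axis_pt x) - c) \<bullet> v) / ((norm (F i (axis_pt x) - c))\<^sup>2)\<^sup>2) *\<^sub>R (F i (axis_pt x) - c))
        \<le> 1 / (norm (F i (axis_pt x) - c))\<^sup>2 * norm v"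
        using norm_unit_inv_derivative[OF nc[OF FM]] by simp
    qed
    also have "\<dots> = integral {a..b} (\<lambda>x. ((norm c)\<^sup>2 - 1) * (?r x * norm (pderiv_at 1 (F i) (axis_pt x))))"
      by (rule integral_mult_right[symmetric])
    also have "\<dots> = integral {a..b} (\<lambda>x. \<rho> (F i (axis_pt x)) * norm (pderiv_at 1 (F i) (axis_pt x)))"
      by (intro Henstock_Kurzweil_Integration.integral_cong) (simp add: \<rho>_def)
    finally show "dist (f (F i (axis_pt a))) (f (F i (axis_pt b))) \<le> integral {a..b} (\<lambda>x. \<rho> (F i (axis_pt x)) * norm (pderiv_at 1 (F i) (axis_pt x)))" .
  qed
  also have "\<dots> \<le> boundary_integral (\<lambda>x. 1) UNIV"
  proof -
    have lw: "local_weight r i = (\<lambda>x. indicator {x. axis_pt x \<in> U i} x *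
         (\<psi> i (h i (axis_pt x)) * (r (F i (axis_pt x)) * norm (pderiv_at 1 (F i) (axis_pt x)))))" for r i
      by (auto simp: local_weight_def fun_eq_iff)
    show ?thesis
      unfolding boundary_integral_UNIV[OF w] boundary_integral_UNIV[OF w1] lw
      using boundary_integral_inequality[OF ball c min sph orth] by (intro ennreal_leI) (simp add: \<rho>_def)
  qed
  also have "\<dots> \<le> curve_length \<phi> (surface_boundary M \<phi>)"
    by (rule boundary_integral_le_curve_length)
  finally show ?thesis .
qed

end

theorem theorem3p3:
  fixes M :: "'p::t2_space set"
    and \<phi> :: "'p \<Rightarrow> real^'n"
    and f :: "real^'n \<Rightarrow> real^'n"
  assumes "compact_immersed_surface M \<phi>"
    and "minimal_surface M \<phi>"
    and "\<phi> ` M \<subseteq> cball 0 1"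
    and "\<phi> ` surface_boundary M \<phi> \<subseteq> sphere 0 1"
    and "meets_sphere_orthogonally M \<phi>"
    and "conformal_ball_map f"
  shows "curve_length (f \<circ> \<phi>) (surface_boundary M \<phi>) \<le> curve_length \<phi> (surface_boundary M \<phi>)"
  using assms(6)
proof (cases rule: conformal_ball_map_cases)
  \<comment> \<open>With \<open>l \<le> 1\<close> no chord gets longer, so the lengths can be
    compared arc by arc.\<close>
  case (similarity l)
  show ?thesis
  proof (intro curve_length_mono path_length_mono)
    fix g and s t :: real
    assume g: "path_image g \<subseteq> surface_boundary M \<phi>" and st: "s \<in> {0..1}" "t \<in> {0..1}"
    have "\<phi> (g r) \<in> cball 0 1" if "r \<in> {0..1}" for r
      using g that surface_boundary_subset assms(3) unfolding path_image_def by blast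
    then have "dist (f (\<phi> (g s))) (f (\<phi> (g t))) = l * dist (\<phi> (g s)) (\<phi> (g t))"
      using similarity(3) st by blast
    also have "\<dots> \<le> dist (\<phi> (g s)) (\<phi> (g t))"
      using similarity(1,2) by (simp add: mult_left_le_one_le)
    finally show "dist ((f \<circ> \<phi> \<circ> g) s) ((f \<circ> \<phi> \<circ> g) t) \<le> dist ((\<phi> \<circ> g) s) ((\<phi> \<circ> g) t)" by simp
  qed
next
  case (inversion c k)
  obtain I :: "'p set" and U h F K \<psi> where part: "finite I"
    "\<forall>i\<in>I. local_param M \<phi> (U i) (h i) (F i) \<and> compact (K i) \<and> K i \<subseteq> U i \<and> C1_on_surface M \<phi> (\<psi> i) \<and>
        (\<forall>x\<in>M. \<psi> i x \<ge> 0) \<and> (\<forall>x\<in>M. \<psi> i x \<noteq> 0 \<longrightarrow> x \<in> h i ` (K i \<inter> half_plane))"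
    "\<forall>x\<in>M. (\<Sum>i\<in>I. \<psi> i x) = 1"
    using partition_of_unity[OF assms(1)] by blast
  interpret surface_partition M \<phi> I U h F K \<psi>
    using part by unfold_locales auto
  show ?thesis
    by (rule inverted_boundary_length[OF assms(3) inversion(1) assms(2,4,5) inversion(2,3,4)])
qed

end
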